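(* Let $n\ge1$ and consider a classification problem with $m$ classes, where class $c\in\{1,\dots,m\}$ is described by a bounded probability density $\rho_c$ on $[0,1]^n$ (with respect to Lebesgue measure). Let $\mathcal{C}:[0,1]^n\to\{1,\dots,m\}$ be a classifier with measurable level sets, and let $f_c=\mathrm{vol}\{x\in[0,1]^n:\mathcal{C}(x)=c\}$. Choose a class $c$ with $f_c<\frac12$, let $p\ge 0$, set $p^*=\min(p,2)$ (for $p>0$), and let $\epsilon>0$. Let $\mathrm{supp}(\rho_c)=\{x:\rho_c(x)>0\}$. Then there exists a point $x$ with $\rho_c(x)>0$ and a point $\hat x\in[0,1]^n$ with $\mathcal{C}(\hat x)\ne c$ and $\|x-\hat x\|_p\le\epsilon$, provided that $$\mathrm{vol}[\mathrm{supp}(\rho_c)]\ge\frac12\exp\left(-\pi\epsilon^2n^{1-2/p^*}\right)\quad\text{in the case }p>0,$$ or, in the case $p=0$ and $\epsilon\ge\sqrt{n\log2/2}$, $$\mathrm{vol}[\mathrm{supp}(\rho_c)]\ge\exp\left(-\frac{2}{n}\left(\epsilon-\sqrt{\frac{n\log2}{2}}\right)^2\right).$$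
   Context: $\|z\|_p=(\sum_i|z_i|^p)^{1/p}$ for $p>0$ and $\|z\|_0=\#\{i:z_i\ne0\}$; $\mathrm{vol}$ is Lebesgue measure. *)

theory Defs
  imports "HOL-Analysis.Analysis"
begin

definition unit_cube :: "(real ^ 'n) set" where
  "unit_cube = {x. \<forall>i. 0 \<le> x $ i \<and> x $ i \<le> 1}"

definition lp_norm :: "real \<Rightarrow> real ^ 'n \<Rightarrow> real" where
  "lp_norm p z = (if p = 0 then real (card {i. z $ i \<noteq> 0})
                  else (\<Sum>i\<in>UNIV. \<bar>z $ i\<bar> powr p) powr (1 / p))"

definition bounded_prob_density_cube :: "(real ^ 'n \<Rightarrow> real) \<Rightarrow> bool" where
  "bounded_prob_density_cube \<rho> \<longleftrightarrow>
     (\<forall>x\<in>unit_cube. 0 \<le> \<rho> x) \<and>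
     set_integrable lebesgue unit_cube \<rho> \<and>
     (LINT x : unit_cube | lebesgue. \<rho> x) = 1 \<and>
     (\<exists>B. \<forall>x\<in>unit_cube. \<rho> x \<le> B)"

end

theory Submission
  imports Defs "HOL-Probability.Probability" "HOL-Real_Asymp.Real_Asymp"
begin

text \<open>
  Let \<open>K\<close> be a compact subset of \<open>{x. C x \<noteq> c}\<close> that still has volume greater than 1/2. If no
  point of the support of \<open>\<rho>\<^sub>c\<close> had an adversarial example, the support would lie in the set of
  points at distance greater than \<open>\<epsilon>\<close> from \<open>K\<close>, and concentration of measure on the cube makes
  the volume of that set strictly smaller than the bound in the hypothesis.

  For \<open>p = 0\<close> the concentration is McDiarmid's inequality for the Hamming distance to \<open>K\<close>, applied
  twice: its lower tail bounds the mean because the distance vanishes on \<open>K\<close>, and its upper tail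
  then gives the claim.

  For \<open>p > 0\<close> the norm is compared with the Euclidean one, which turns \<open>\<epsilon>\<^sup>2\<close> into
  \<open>\<epsilon>\<^sup>2 n\<^bsup>1-2/p*\<^esup>\<close>, and one needs the sharp Gaussian-type isoperimetry of the cube. It comes from
  Bobkov's inequality \<open>I(\<integral>f) \<le> \<integral>\<surd>(I(f)\<^sup>2 + \<kappa>|\<nabla>f|\<^sup>2)\<close> for the Gaussian profile \<open>I = \<phi> \<circ> \<Phi>\<^sup>-\<^sup>1\<close>: the
  two-point inequality is iterated along a simple random walk, the limit of the walk gives the
  Gaussian measure on the line, the map \<open>\<Phi>\<close>, which is \<open>1/\<surd>(2\<pi>)\<close>-Lipschitz, carries it to
  the unit interval with \<open>\<kappa> = 1/(2\<pi>)\<close>, and Minkowski's inequality passes to products. Applied to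
  mollified cut-offs of the distance to \<open>K\<close>, it shows that \<open>\<Phi>\<^sup>-\<^sup>1\<close> of the volume of the
  \<open>t\<close>-neighbourhood of \<open>K\<close> grows at least at rate \<open>\<surd>(2\<pi>)\<close>.
\<close>

section \<open>The Gaussian isoperimetric profile\<close>

text \<open>The hypotheses on the support are non-strict, so the concentration bounds have to be
  strict. The slack comes from \<open>f_c < 1/2\<close>, which leaves a compact set of volume
  strictly above 1/2 outside the class. The constant is the Gaussian one: the quantile of the
  neighbourhood volume starts above 0 and grows at rate sqrt(2 pi), and the tail bound
  \<open>1 - \<Phi>(s) \<le> exp (- s^2 / 2) / 2\<close> at s = sqrt(2 pi) t is exactly
  \<open>exp (- pi * t^2) / 2\<close>. A functional inequality is proved instead of a statement
  about sets because it passes to products with the same constant, so no dimensional factor appears.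
  The price is regularity: the profile is controlled only inside the open unit interval, and a
  distance function need not be differentiable. Test functions therefore take values in
  \<open>[\<eta>, 1 - \<eta>]\<close>, and smoothness always means a uniform quadratic remainder
  bound. Both devices disappear only in the growth estimate for neighbourhoods, where \<eta> tends
  to 0 and the final bound does not see the mollification radius.\<close>

abbreviation gauss_cdf :: "real \<Rightarrow> real" where
  "gauss_cdf \<equiv> cdf std_normal_distribution"

text \<open>Outside the open unit interval \<open>inv\<close> returns an unspecified value. Hence
  \<open>gauss_profile\<close> is positive everywhere and, unlike the classical profile, carries no
  information at 0 and 1.\<close>

definition gauss_quantile :: "real \<Rightarrow> real" where
  "gauss_quantile = inv gauss_cdf"

definition gauss_profile :: "real \<Rightarrow> real" where
  "gauss_profile a = std_normal_density (gauss_quantile a)"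

interpretation std_normal: real_distribution std_normal_distribution
  by (rule real_dist_normal_dist)

lemma std_normal_density_le: "std_normal_density x \<le> 1 / sqrt (2 * pi)"
  by (simp add: std_normal_density_def divide_le_cancel)

lemma std_normal_density_le_1: "std_normal_density x \<le> 1"
proof -
  have "1 \<le> 2 * pi" using pi_gt3 by simp
  then have "1 / sqrt (2 * pi) \<le> 1" by simp
  then show ?thesis using std_normal_density_le[of x] by linarith
qed

lemma has_real_derivative_std_normal_density:
  "(std_normal_density has_real_derivative - x * std_normal_density x) (at x within S)"
proof -
  have "((\<lambda>x. (1 / sqrt (2 * pi)) * exp (- x\<^sup>2 / 2)) has_real_derivative
      (1 / sqrt (2 * pi)) * (exp (- x\<^sup>2 / 2) * (- x))) (at x within S)"
    by (intro DERIV_cmult) (auto intro!: derivative_eq_intros)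
  then show ?thesis
    by (simp add: std_normal_density_def[abs_def] mult_ac)
qed

lemma continuous_on_std_normal_density: "continuous_on S std_normal_density"
  by (rule DERIV_continuous_on[OF has_real_derivative_std_normal_density])

lemma gauss_cdf_diff:
  assumes "a \<le> b"
  shows "gauss_cdf b - gauss_cdf a = integral {a..b} std_normal_density"
proof -
  have "integrable lborel std_normal_density"
    using integrable_std_normal_moment[of 0] by simp
  then have si: "set_integrable lborel {a..b} std_normal_density"
    unfolding set_integrable_def by (intro integrable_mult_indicator) auto
  have "gauss_cdf b - gauss_cdf a = measure std_normal_distribution {a<..b}"
    using std_normal.cdf_diff_eq[of a b] assms by (cases "a = b") auto
  also have "\<dots> = (LINT x:{a<..b}|lborel. std_normal_density x)"
  proof -
    have "emeasure std_normal_distribution {a<..b} = (\<integral>\<^sup>+x\<in>{a<..b}. std_normal_density x \<partial>lborel)"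
      by (simp add: emeasure_density)
    also have "\<dots> = (\<integral>\<^sup>+x. ennreal (indicator {a<..b} x * std_normal_density x) \<partial>lborel)"
      by (intro nn_integral_cong) (auto simp: indicator_def)
    finally show ?thesis
      by (simp add: measure_def set_lebesgue_integral_def integral_eq_nn_integral)
  qed
  also have "\<dots> = (LINT x:{a..b}|lborel. std_normal_density x)"
    unfolding set_lebesgue_integral_def
    by (intro integral_cong_AE eventually_mono[OF AE_lborel_singleton[of a]])
       (auto simp: indicator_def)
  also have "\<dots> = integral {a..b} std_normal_density"
    by (rule set_borel_integral_eq_integral[OF si])
  finally show ?thesis .
qed

lemma has_real_derivative_gauss_cdf:
  "(gauss_cdf has_real_derivative std_normal_density x) (at x)"
proof -
  have "((\<lambda>u. integral {x-1..u} std_normal_density) has_real_derivative std_normal_density x)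
      (at x within {x-1..x+1})"
    by (rule integral_has_real_derivative) (auto simp: continuous_on_std_normal_density)
  then have "((\<lambda>u. integral {x-1..u} std_normal_density) has_real_derivative std_normal_density x) (at x)"
    by (simp add: at_within_Icc_at)
  then have "((\<lambda>u. gauss_cdf (x-1) + integral {x-1..u} std_normal_density)
      has_real_derivative std_normal_density x) (at x)"
    by (auto intro!: derivative_eq_intros)
  then show ?thesis
    by (rule DERIV_cong_ev[THEN iffD1, rotated -1])
       (auto intro!: eventually_mono[OF eventually_nhds_in_open[of "{x-1<..}" x]]
             simp: gauss_cdf_diff[symmetric])
qed

lemma isCont_gauss_cdf: "isCont gauss_cdf x"
  by (rule DERIV_isCont[OF has_real_derivative_gauss_cdf])

lemma strict_mono_gauss_cdf: "strict_mono gauss_cdf"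
proof (rule strict_monoI)
  fix x y :: real assume "x < y"
  then show "gauss_cdf x < gauss_cdf y"
  proof (rule DERIV_pos_imp_increasing)
    fix z
    show "\<exists>d. (gauss_cdf has_real_derivative d) (at z) \<and> d > 0"
      by (rule exI[of _ "std_normal_density z"])
         (simp add: has_real_derivative_gauss_cdf normal_density_pos)
  qed
qed

lemma gauss_cdf_less_iff [simp]: "gauss_cdf x < gauss_cdf y \<longleftrightarrow> x < y"
  and gauss_cdf_le_iff [simp]: "gauss_cdf x \<le> gauss_cdf y \<longleftrightarrow> x \<le> y"
  and gauss_cdf_eq_iff [simp]: "gauss_cdf x = gauss_cdf y \<longleftrightarrow> x = y"
  using strict_mono_gauss_cdf
  by (simp_all add: strict_mono_less strict_mono_less_eq strict_mono_eq)

lemma gauss_cdf_pos: "0 < gauss_cdf x"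
  using gauss_cdf_less_iff[of "x - 1" x] std_normal.cdf_nonneg[of "x - 1"] by linarith

lemma gauss_cdf_less_1: "gauss_cdf x < 1"
  using gauss_cdf_less_iff[of x "x + 1"] std_normal.cdf_bounded_prob[of "x + 1"] by linarith

lemma gauss_cdf_surj:
  assumes "0 < a" "a < 1"
  shows "\<exists>x. gauss_cdf x = a"
proof -
  have "\<forall>\<^sub>F x in at_bot. gauss_cdf x < a"
    using order_tendstoD(2)[OF std_normal.cdf_lim_at_bot assms(1)] .
  then obtain l where l: "gauss_cdf l < a" by (auto simp: eventually_at_bot_linorder)
  have "\<forall>\<^sub>F x in at_top. gauss_cdf x > a"
    using order_tendstoD(1)[OF std_normal.cdf_lim_at_top_prob assms(2)] .
  then obtain u where u: "gauss_cdf u > a" by (auto simp: eventually_at_top_linorder)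
  have "l \<le> u" using l u gauss_cdf_le_iff[of l u] by linarith
  then show ?thesis
    using IVT[of gauss_cdf l a u] l u isCont_gauss_cdf by auto
qed

lemma gauss_cdf_quantile [simp]: "0 < a \<Longrightarrow> a < 1 \<Longrightarrow> gauss_cdf (gauss_quantile a) = a"
  unfolding gauss_quantile_def by (rule f_inv_into_f) (use gauss_cdf_surj in auto)

lemma gauss_quantile_cdf [simp]: "gauss_quantile (gauss_cdf x) = x"
  unfolding gauss_quantile_def by (rule inv_f_f) (simp add: inj_def)

lemma gauss_quantile_le_iff:
  "0 < a \<Longrightarrow> a < 1 \<Longrightarrow> 0 < b \<Longrightarrow> b < 1 \<Longrightarrow> gauss_quantile a \<le> gauss_quantile b \<longleftrightarrow> a \<le> b"
  using gauss_cdf_le_iff[of "gauss_quantile a" "gauss_quantile b"] by simp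

text \<open>The density is even, so \<open>gauss_cdf (- x) + gauss_cdf x\<close> has derivative 0;
  the constant is read off at infinity.\<close>

lemma gauss_cdf_minus: "gauss_cdf (- x) = 1 - gauss_cdf x"
proof -
  have "((\<lambda>x. gauss_cdf (- x) + gauss_cdf x) has_real_derivative 0) (at x)" for x
  proof -
    have "std_normal_density (- x) = std_normal_density x"
      by (simp add: std_normal_density_def)
    then show ?thesis
      using DERIV_add[OF DERIV_chain2[OF has_real_derivative_gauss_cdf[of "- x"] DERIV_minus[OF DERIV_ident]]
          has_real_derivative_gauss_cdf[of x]] by simp
  qed
  then have const: "gauss_cdf (- y) + gauss_cdf y = gauss_cdf (- x) + gauss_cdf x" for y
    by (rule DERIV_isconst_all[of "\<lambda>x. gauss_cdf (- x) + gauss_cdf x", OF allI])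
  have "((\<lambda>x. gauss_cdf (- x) + gauss_cdf x) \<longlongrightarrow> 0 + 1) at_top"
    by (intro tendsto_add std_normal.cdf_lim_at_top_prob
        filterlim_compose[OF std_normal.cdf_lim_at_bot] filterlim_uminus_at_bot_at_top)
  then have "((\<lambda>y::real. gauss_cdf (- x) + gauss_cdf x) \<longlongrightarrow> 0 + 1) at_top"
    by (subst (asm) const)
  then show ?thesis by (simp add: tendsto_const_iff)
qed

lemma gauss_cdf_0: "gauss_cdf 0 = 1 / 2"
  using gauss_cdf_minus[of 0] by simp

lemma gauss_quantile_minus:
  "0 < a \<Longrightarrow> a < 1 \<Longrightarrow> gauss_quantile (1 - a) = - gauss_quantile a"
  using gauss_cdf_minus[of "gauss_quantile a"] gauss_quantile_cdf[of "- gauss_quantile a"] by simp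

lemma has_real_derivative_gauss_quantile:
  assumes "0 < a" "a < 1"
  shows "(gauss_quantile has_real_derivative 1 / gauss_profile a) (at a)"
proof -
  let ?x = "gauss_quantile a"
  have "isCont gauss_quantile (gauss_cdf ?x)"
    by (rule isCont_inverse_function2[of "?x - 1" _ "?x + 1"]) (auto simp: isCont_gauss_cdf)
  then have cont: "isCont gauss_quantile a"
    using assms by simp
  have "(gauss_quantile has_real_derivative inverse (gauss_profile a)) (at a)"
    unfolding gauss_profile_def
    by (rule DERIV_inverse_function[OF has_real_derivative_gauss_cdf _ assms _ cont]) 
       (use normal_density_pos[of 1 0 ?x] in auto)
  then show ?thesis by (simp add: inverse_eq_divide)
qed

lemma gauss_profile_pos: "0 < gauss_profile a"
  by (simp add: gauss_profile_def normal_density_pos)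

lemma gauss_profile_le_1: "gauss_profile a \<le> 1"
  by (simp add: gauss_profile_def std_normal_density_le_1)

text \<open>The factor \<open>- x\<close> in the derivative of the density survives, while the
  density itself cancels against the derivative \<open>1 / I\<close> of the quantile. One more
  differentiation gives \<open>I'' = - 1 / I\<close>, the equation behind the two-point
  inequality.\<close>

lemma has_real_derivative_gauss_profile:
  assumes "0 < a" "a < 1"
  shows "(gauss_profile has_real_derivative - gauss_quantile a) (at a)"
proof -
  have "((\<lambda>a. std_normal_density (gauss_quantile a)) has_real_derivative
      (- gauss_quantile a * gauss_profile a) * (1 / gauss_profile a)) (at a)"
    by (rule DERIV_chain2[OF _ has_real_derivative_gauss_quantile[OF assms]])
       (unfold gauss_profile_def, rule has_real_derivative_std_normal_density)
  then show ?thesis using gauss_profile_pos[of a] by (simp add: gauss_profile_def[abs_def])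
qed

section \<open>The two-point inequality for the Gaussian profile\<close>

lemma std_normal_density_mono:
  assumes "\<bar>x\<bar> \<le> \<bar>y\<bar>" shows "std_normal_density y \<le> std_normal_density x"
proof -
  have "x\<^sup>2 \<le> y\<^sup>2" using assms by (simp only: abs_le_square_iff)
  then show ?thesis by (simp add: std_normal_density_def divide_le_cancel)
qed

lemma gauss_profile_minus: "0 < a \<Longrightarrow> a < 1 \<Longrightarrow> gauss_profile (1 - a) = gauss_profile a"
  by (simp add: gauss_profile_def gauss_quantile_minus std_normal_density_def)

text \<open>Since \<open>I I'' = -1\<close>, the second derivative of \<open>I\<^sup>2\<close> is \<open>2 I'\<^sup>2 - 2\<close>, and \<open>I'\<^sup>2\<close> is convex and
  symmetric about 1/2; integrating twice gives the last two bounds.\<close>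

lemma gauss_profile_sq_diff:
  assumes c: "c \<le> 1 / 2" and s: "0 \<le> s" "s < c"
  shows "gauss_profile (c - s) \<le> gauss_profile (c + s)"
    and "(gauss_profile (c + s))\<^sup>2 - (gauss_profile (c - s))\<^sup>2
           \<le> - 4 * gauss_profile c * gauss_quantile c * s"
    and "(gauss_profile (c + s))\<^sup>2 + (gauss_profile (c - s))\<^sup>2 + 2 * s\<^sup>2
           \<ge> 2 * (gauss_profile c)\<^sup>2 + 2 * (gauss_quantile c)\<^sup>2 * s\<^sup>2"
proof -
  let ?I = gauss_profile and ?w = gauss_quantile
  have in01: "0 < c + t" "c + t < 1" "0 < c - t" "c - t < 1" if "0 \<le> t" "t \<le> s" for t
    using that c s by auto
  have w_abs: "\<bar>?w (c + t)\<bar> \<le> \<bar>?w (c - t)\<bar>" "?w (c - t) \<le> ?w (c + t)" "?w (c - t) \<le> - ?w (c + t)"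
    if t: "0 \<le> t" "t \<le> s" for t
  proof -
    show 1: "?w (c - t) \<le> ?w (c + t)"
      using in01[OF t] t by (subst gauss_quantile_le_iff) auto
    \<comment> \<open>As \<open>c \<le> 1 / 2\<close>, the reflection \<open>1 - (c - t)\<close>
      lies to the right of \<open>c + t\<close>: among the two points, \<open>c - t\<close> is the
      one further from 1/2.\<close>
    have "?w (c + t) \<le> ?w (1 - (c - t))"
      using in01[OF t] t c by (subst gauss_quantile_le_iff) auto
    then show 2: "?w (c - t) \<le> - ?w (c + t)"
      using in01[OF t] by (simp add: gauss_quantile_minus)
    show "\<bar>?w (c + t)\<bar> \<le> \<bar>?w (c - t)\<bar>"
      using 1 2 by linarith
  qed
  show "?I (c - s) \<le> ?I (c + s)"
    unfolding gauss_profile_def using w_abs[of s] s by (intro std_normal_density_mono) auto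
  \<comment> \<open>The difference of the squared profiles at \<open>c + t\<close> and
    \<open>c - t\<close> has derivative \<open>- 2 * H t\<close>; their sum plus
    \<open>2 * t^2\<close> has derivative \<open>2 * K t\<close>; and \<open>m\<close> is the
    derivative of \<open>K\<close>.\<close>
  define H where "H = (\<lambda>t. ?I (c + t) * ?w (c + t) + ?I (c - t) * ?w (c - t))"
  define K where "K = (\<lambda>t. ?I (c - t) * ?w (c - t) - ?I (c + t) * ?w (c + t) + 2 * t)"
  define m where "m = (\<lambda>t. (?w (c + t))\<^sup>2 + (?w (c - t))\<^sup>2)"
  have Dw: "((\<lambda>t. ?w (c + t)) has_real_derivative 1 / ?I (c + t)) (at t)"
      "((\<lambda>t. ?w (c - t)) has_real_derivative - (1 / ?I (c - t))) (at t)"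
      "((\<lambda>t. ?I (c + t)) has_real_derivative - ?w (c + t)) (at t)"
      "((\<lambda>t. ?I (c - t)) has_real_derivative ?w (c - t)) (at t)"
    if t: "0 \<le> t" "t \<le> s" for t
  proof -
    have d: "((\<lambda>t. c + t) has_real_derivative 1) (at t)" "((\<lambda>t. c - t) has_real_derivative - 1) (at t)"
      by (auto intro!: derivative_eq_intros)
    note q = has_real_derivative_gauss_quantile and p = has_real_derivative_gauss_profile
    show "((\<lambda>t. ?w (c + t)) has_real_derivative 1 / ?I (c + t)) (at t)"
      "((\<lambda>t. ?w (c - t)) has_real_derivative - (1 / ?I (c - t))) (at t)"
      "((\<lambda>t. ?I (c + t)) has_real_derivative - ?w (c + t)) (at t)"
      "((\<lambda>t. ?I (c - t)) has_real_derivative ?w (c - t)) (at t)"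
      using DERIV_chain2[OF q d(1)] DERIV_chain2[OF q d(2)] DERIV_chain2[OF p d(1)]
        DERIV_chain2[OF p d(2)] in01[OF t] by simp_all
  qed
  have nz: "?I x \<noteq> 0" for x using gauss_profile_pos[of x] by simp
  have DH: "(H has_real_derivative (?w (c - t))\<^sup>2 - (?w (c + t))\<^sup>2) (at t)"
    if t: "0 \<le> t" "t \<le> s" for t
    unfolding H_def
    by ((rule Dw[OF t] derivative_eq_intros refl)+) (simp add: nz power2_eq_square)
  have H_ge: "H t \<ge> 2 * ?I c * ?w c" if t: "0 \<le> t" "t \<le> s" for t
  proof -
    have "H 0 \<le> H t"
    proof (rule DERIV_nonneg_imp_nondecreasing[OF t(1)])
      fix x assume x: "0 \<le> x" "x \<le> t"
      have "(?w (c + x))\<^sup>2 \<le> (?w (c - x))\<^sup>2"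
        using w_abs(1)[of x] x t by (simp only: abs_le_square_iff) 
      then show "\<exists>y. (H has_real_derivative y) (at x) \<and> 0 \<le> y"
        using DH[of x] x t by (intro exI[of _ "(?w (c - x))\<^sup>2 - (?w (c + x))\<^sup>2"]) auto
    qed
    then show ?thesis by (simp add: H_def)
  qed
  have "(\<lambda>t. (?I (c + t))\<^sup>2 - (?I (c - t))\<^sup>2 + 4 * ?I c * ?w c * t) s
      \<le> (\<lambda>t. (?I (c + t))\<^sup>2 - (?I (c - t))\<^sup>2 + 4 * ?I c * ?w c * t) 0"
  proof (rule DERIV_nonpos_imp_nonincreasing[OF s(1)])
    fix t assume t: "0 \<le> t" "t \<le> s"
    have "((\<lambda>t. (?I (c + t))\<^sup>2 - (?I (c - t))\<^sup>2 + 4 * ?I c * ?w c * t) has_real_derivative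
        - 2 * H t + 4 * ?I c * ?w c) (at t)"
      by ((rule Dw[OF t] derivative_eq_intros refl)+) (simp add: H_def algebra_simps)
    then show "\<exists>y. ((\<lambda>t. (?I (c + t))\<^sup>2 - (?I (c - t))\<^sup>2 + 4 * ?I c * ?w c * t) has_real_derivative y) (at t)
        \<and> y \<le> 0"
      using H_ge[OF t] by (intro exI[of _ "- 2 * H t + 4 * ?I c * ?w c"]) auto
  qed
  then show "(?I (c + s))\<^sup>2 - (?I (c - s))\<^sup>2 \<le> - 4 * ?I c * ?w c * s"
    by simp
  have m_ge: "m t \<ge> 2 * (?w c)\<^sup>2" if t: "0 \<le> t" "t \<le> s" for t
  proof -
    have "m 0 \<le> m t"
    proof (rule DERIV_nonneg_imp_nondecreasing[OF t(1)])
      fix x assume x: "0 \<le> x" "x \<le> t"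
      then have x': "0 \<le> x" "x \<le> s" using t by auto
      have I_le: "?I (c - x) \<le> ?I (c + x)"
        unfolding gauss_profile_def using w_abs(1)[OF x'] by (rule std_normal_density_mono)
      \<comment> \<open>The quantile at \<open>c - x\<close> is nonpositive, larger in absolute
        value than the one at \<open>c + x\<close>, and divided by a smaller profile. So its
        quotient dominates whatever the sign at \<open>c + x\<close>, and \<open>m\<close>
        increases.\<close>
      have "\<bar>?w (c + x)\<bar> / ?I (c + x) \<le> - ?w (c - x) / ?I (c - x)"
        using w_abs[OF x'] I_le gauss_profile_pos by (intro frac_le) auto
      moreover have "- ?w (c + x) / ?I (c + x) \<le> \<bar>?w (c + x)\<bar> / ?I (c + x)"
        using gauss_profile_pos[of "c + x"] by (intro divide_right_mono) auto
      ultimately have "0 \<le> ?w (c + x) / ?I (c + x) - ?w (c - x) / ?I (c - x)"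
        by simp
      moreover have "(m has_real_derivative
          2 * (?w (c + x) / ?I (c + x) - ?w (c - x) / ?I (c - x))) (at x)"
        unfolding m_def by ((rule Dw[OF x'] derivative_eq_intros refl)+) (simp add: algebra_simps)
      ultimately show "\<exists>y. (m has_real_derivative y) (at x) \<and> 0 \<le> y"
        by (intro exI[of _ "2 * (?w (c + x) / ?I (c + x) - ?w (c - x) / ?I (c - x))"]) auto
    qed
    then show ?thesis by (simp add: m_def)
  qed
  have K_ge: "K t \<ge> 2 * (?w c)\<^sup>2 * t" if t: "0 \<le> t" "t \<le> s" for t
  proof -
    have "K 0 - 2 * (?w c)\<^sup>2 * 0 \<le> K t - 2 * (?w c)\<^sup>2 * t"
    proof (rule DERIV_nonneg_imp_nondecreasing[OF t(1)])
      fix x assume x: "0 \<le> x" "x \<le> t"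
      then have x': "0 \<le> x" "x \<le> s" using t by auto
      have "((\<lambda>x. K x - 2 * (?w c)\<^sup>2 * x) has_real_derivative m x - 2 * (?w c)\<^sup>2) (at x)"
        unfolding K_def m_def
        by ((rule Dw[OF x'] derivative_eq_intros refl)+) (simp add: nz power2_eq_square)
      then show "\<exists>y. ((\<lambda>x. K x - 2 * (?w c)\<^sup>2 * x) has_real_derivative y) (at x) \<and> 0 \<le> y"
        using m_ge[OF x'] by (intro exI[of _ "m x - 2 * (?w c)\<^sup>2"]) auto
    qed
    then show ?thesis by (simp add: K_def)
  qed
  have "(\<lambda>t. (?I (c + t))\<^sup>2 + (?I (c - t))\<^sup>2 + 2 * t\<^sup>2 - 2 * (?w c)\<^sup>2 * t\<^sup>2) 0
      \<le> (\<lambda>t. (?I (c + t))\<^sup>2 + (?I (c - t))\<^sup>2 + 2 * t\<^sup>2 - 2 * (?w c)\<^sup>2 * t\<^sup>2) s"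
  proof (rule DERIV_nonneg_imp_nondecreasing[OF s(1)])
    fix t assume t: "0 \<le> t" "t \<le> s"
    have "((\<lambda>t. (?I (c + t))\<^sup>2 + (?I (c - t))\<^sup>2 + 2 * t\<^sup>2 - 2 * (?w c)\<^sup>2 * t\<^sup>2) has_real_derivative
        2 * (K t - 2 * (?w c)\<^sup>2 * t)) (at t)"
      by ((rule Dw[OF t] derivative_eq_intros refl)+) (simp add: K_def algebra_simps)
    moreover have "0 \<le> 2 * (K t - 2 * (?w c)\<^sup>2 * t)"
      using K_ge[OF t] by (simp only: zero_le_mult_iff) simp
    ultimately show "\<exists>y. ((\<lambda>t. (?I (c + t))\<^sup>2 + (?I (c - t))\<^sup>2 + 2 * t\<^sup>2 - 2 * (?w c)\<^sup>2 * t\<^sup>2)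
        has_real_derivative y) (at t) \<and> 0 \<le> y"
      by blast
  qed
  then show "(?I (c + s))\<^sup>2 + (?I (c - s))\<^sup>2 + 2 * s\<^sup>2 \<ge> 2 * (?I c)\<^sup>2 + 2 * (?w c)\<^sup>2 * s\<^sup>2"
    by simp
qed

text \<open>Let p, q be the radicands on the right and u the squared profile at \<open>c\<close>.
  Squaring twice reduces the claim to \<open>(q - p)^2 \<le> 8 * u * (p + q - 2 * u)\<close>. The
  bounds on the difference and on the sum of the squared profiles fit together here: the left side
  is at most 16 u w^2 s^2 and \<open>p + q - 2 * u\<close> is at least 2 w^2 s^2, with w the
  quantile of \<open>c\<close>.\<close>

lemma two_point_centre_le_half:
  assumes c: "c \<le> 1 / 2" and s: "0 \<le> s" "s < c"
  shows "2 * gauss_profile c \<le> sqrt ((gauss_profile (c - s))\<^sup>2 + s\<^sup>2)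
           + sqrt ((gauss_profile (c + s))\<^sup>2 + s\<^sup>2)"
proof -
  define u where "u = (gauss_profile c)\<^sup>2"
  define p where "p = (gauss_profile (c - s))\<^sup>2 + s\<^sup>2"
  define q where "q = (gauss_profile (c + s))\<^sup>2 + s\<^sup>2"
  note sq = gauss_profile_sq_diff[OF assms]
  have nn: "u \<ge> 0" "p \<ge> 0" "q \<ge> 0" by (auto simp: u_def p_def q_def)
  have S: "p + q - 2 * u \<ge> 2 * (gauss_quantile c)\<^sup>2 * s\<^sup>2"
    using sq(3) by (simp add: u_def p_def q_def)
  have "0 \<le> q - p"
    using power_mono[OF sq(1), of 2] gauss_profile_pos[of "c - s"] by (simp add: p_def q_def)
  moreover have "q - p \<le> - 4 * gauss_profile c * gauss_quantile c * s"
    using sq(2) by (simp add: p_def q_def)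
  ultimately have "(q - p)\<^sup>2 \<le> (- 4 * gauss_profile c * gauss_quantile c * s)\<^sup>2"
    by (intro power_mono)
  also have "\<dots> = 8 * u * (2 * (gauss_quantile c)\<^sup>2 * s\<^sup>2)"
    unfolding u_def by (simp only: power_mult_distrib) simp
  also have "\<dots> \<le> 8 * u * (p + q - 2 * u)"
    using S nn by (intro mult_left_mono) auto
  finally have "(q - p)\<^sup>2 \<le> 8 * u * (p + q - 2 * u)" .
  moreover have "(4 * u - (p + q))\<^sup>2 - 4 * (p * q) = (q - p)\<^sup>2 - 8 * u * (p + q - 2 * u)"
    by (simp add: power2_eq_square algebra_simps)
  moreover have "(2 * sqrt (p * q))\<^sup>2 = 4 * (p * q)"
    using nn real_sqrt_pow2[of "p * q"] by (simp only: power_mult_distrib mult_nonneg_nonneg) simp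
  ultimately have "(4 * u - (p + q))\<^sup>2 \<le> (2 * sqrt (p * q))\<^sup>2"
    by linarith
  then have "4 * u - (p + q) \<le> 2 * sqrt (p * q)"
    by (rule power2_le_imp_le) (use nn in simp)
  moreover have "(sqrt p + sqrt q)\<^sup>2 = p + q + 2 * sqrt (p * q)"
    by (simp only: power2_sum real_sqrt_mult real_sqrt_pow2[OF nn(2)] real_sqrt_pow2[OF nn(3)] mult.assoc)
  moreover have "(2 * gauss_profile c)\<^sup>2 = 4 * u"
    by (simp add: u_def power_mult_distrib)
  ultimately have "(2 * gauss_profile c)\<^sup>2 \<le> (sqrt p + sqrt q)\<^sup>2"
    by linarith
  then have "2 * gauss_profile c \<le> sqrt p + sqrt q"
    by (rule power2_le_imp_le) (use nn in simp)
  then show ?thesis by (simp add: p_def q_def)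
qed

text \<open>This is Bobkov's inequality for a fair coin. Exchanging the points and reflecting
  \<open>a\<close> to \<open>1 - a\<close> leave both sides unchanged, so the midpoint may be taken
  at most 1/2 and the points ordered.\<close>

proposition two_point_inequality:
  assumes "0 < a" "a < 1" "0 < b" "b < 1"
  shows "gauss_profile ((a + b) / 2) \<le>
    (sqrt ((gauss_profile a)\<^sup>2 + ((a - b) / 2)\<^sup>2) + sqrt ((gauss_profile b)\<^sup>2 + ((a - b) / 2)\<^sup>2)) / 2"
proof -
  let ?P = "\<lambda>a b. gauss_profile ((a + b) / 2) \<le>
    (sqrt ((gauss_profile a)\<^sup>2 + ((a - b) / 2)\<^sup>2) + sqrt ((gauss_profile b)\<^sup>2 + ((a - b) / 2)\<^sup>2)) / 2"
  have *: "?P a b" if "0 < a" "a < 1" "0 < b" "b < 1" "a \<le> b" "a + b \<le> 1" for a b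
  proof -
    have "(a + b) / 2 - (b - a) / 2 = a" "(a + b) / 2 + (b - a) / 2 = b"
      by (simp_all add: field_simps)
    moreover have "((b - a) / 2)\<^sup>2 = ((a - b) / 2)\<^sup>2"
      by (simp add: power2_commute power_divide)
    ultimately show ?thesis
      using two_point_centre_le_half[of "(a + b) / 2" "(b - a) / 2"] that by simp
  qed
  have **: "?P a b" if "0 < a" "a < 1" "0 < b" "b < 1" "a \<le> b" for a b
  proof (cases "a + b \<le> 1")
    case True then show ?thesis using * that by blast
  next
    case False
    have eq: "((1 - b) + (1 - a)) / 2 = 1 - (a + b) / 2" "(1 - b) - (1 - a) = a - b"
      by (simp_all add: field_simps)
    have "gauss_profile (1 - (a + b) / 2) = gauss_profile ((a + b) / 2)"
      using that by (intro gauss_profile_minus) auto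
    then show ?thesis
      using *[of "1 - b" "1 - a"] that False unfolding eq
      by (simp add: gauss_profile_minus add.commute)
  qed
  show ?thesis
  proof (cases "a \<le> b")
    case True then show ?thesis using ** assms by blast
  next
    case False
    moreover have "((b - a) / 2)\<^sup>2 = ((a - b) / 2)\<^sup>2"
      by (simp add: power2_commute power_divide)
    ultimately show ?thesis using **[of b a] assms
      by (simp add: add.commute)
  qed
qed

section \<open>Bobkov's inequality on the line\<close>

text \<open>In one step of the walk the three coordinates are the profile, the gradient and the
  error accumulated so far.\<close>

lemma Minkowski_3:
  fixes a b c :: real
  shows "sqrt ((a + a')\<^sup>2 + (b + b')\<^sup>2 + (c + c')\<^sup>2)
    \<le> sqrt (a\<^sup>2 + b\<^sup>2 + c\<^sup>2) + sqrt (a'\<^sup>2 + b'\<^sup>2 + c'\<^sup>2)"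
  using norm_triangle_ineq[of "(a, b, c)" "(a', b', c')"]
  by (simp add: norm_Pair add.assoc)

text \<open>This says that \<open>f\<close> has a Lipschitz derivative \<open>V\<close>, in a form that is obviously preserved
  under averaging, so that no differentiation under an integral is needed.\<close>

definition quad_approx :: "real \<Rightarrow> (real \<Rightarrow> real) \<Rightarrow> (real \<Rightarrow> real) \<Rightarrow> bool" where
  "quad_approx K f V \<longleftrightarrow> (\<forall>x h. \<bar>f (x + h) - f x - h * V x\<bar> \<le> K * h\<^sup>2)"

lemma quad_approxD: "quad_approx K f V \<Longrightarrow> \<bar>f (x + h) - f x - h * V x\<bar> \<le> K * h\<^sup>2"
  by (simp add: quad_approx_def)

lemma abs_add_le:
  fixes a b c :: real
  shows "\<bar>a\<bar> \<le> c \<Longrightarrow> \<bar>b\<bar> \<le> c \<Longrightarrow> \<bar>a + b\<bar> \<le> 2 * c"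
  by linarith

lemma quad_approx_nonneg: "quad_approx K f V \<Longrightarrow> 0 \<le> K"
  using quad_approxD[of K f V 0 1] by simp

text \<open>Adding the expansion about \<open>x\<close> evaluated at \<open>y\<close> to the one
  about \<open>y\<close> evaluated at \<open>x\<close> cancels the values of \<open>f\<close> and
  leaves \<open>(y - x) * (V y - V x)\<close>.\<close>

lemma quad_approx_Lipschitz:
  assumes "quad_approx K f V"
  shows "\<bar>V y - V x\<bar> \<le> 2 * K * \<bar>y - x\<bar>"
proof (cases "y = x")
  case False
  have a: "\<bar>f y - f x - (y - x) * V x\<bar> \<le> K * (y - x)\<^sup>2"
    using quad_approxD[OF assms, of x "y - x"] by simp
  have b: "\<bar>f x - f y - (x - y) * V y\<bar> \<le> K * (y - x)\<^sup>2"
    using quad_approxD[OF assms, of y "x - y"] by (simp add: power2_commute[of y x])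
  have "\<bar>(f y - f x - (y - x) * V x) + (f x - f y - (x - y) * V y)\<bar> \<le> 2 * (K * (y - x)\<^sup>2)"
    by (rule abs_add_le[OF a b])
  also have "(f y - f x - (y - x) * V x) + (f x - f y - (x - y) * V y) = (y - x) * (V y - V x)"
    by (simp add: algebra_simps)
  also have "2 * (K * (y - x)\<^sup>2) = \<bar>y - x\<bar> * (2 * K * \<bar>y - x\<bar>)"
    using power2_abs[of "y - x"] by (simp add: power2_eq_square)
  finally have "\<bar>y - x\<bar> * \<bar>V y - V x\<bar> \<le> \<bar>y - x\<bar> * (2 * K * \<bar>y - x\<bar>)"
    by (simp only: abs_mult)
  then show ?thesis
    by (rule mult_left_le_imp_le) (use False in simp)
qed simp

lemma quad_approx_isCont:
  assumes "quad_approx K f V"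
  shows "isCont f x" "isCont V x"
proof -
  have "((\<lambda>y. 2 * K * \<bar>y - x\<bar>) \<longlongrightarrow> 0) (at x)"
    by (auto intro!: tendsto_eq_intros)
  then have "((\<lambda>y. V y - V x) \<longlongrightarrow> 0) (at x)"
    by (rule Lim_null_comparison[rotated])
       (rule always_eventually, simp add: quad_approx_Lipschitz[OF assms])
  then show "isCont V x" by (simp add: isCont_def LIM_zero_iff)
  have "((\<lambda>y. K * (y - x)\<^sup>2 + \<bar>y - x\<bar> * \<bar>V x\<bar>) \<longlongrightarrow> 0) (at x)"
    by (auto intro!: tendsto_eq_intros)
  moreover have "norm (f y - f x) \<le> K * (y - x)\<^sup>2 + \<bar>y - x\<bar> * \<bar>V x\<bar>" for y
    using quad_approxD[OF assms, of x "y - x"] abs_mult[of "y - x" "V x"] by simp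
  ultimately have "((\<lambda>y. f y - f x) \<longlongrightarrow> 0) (at x)"
    by (rule Lim_null_comparison[rotated, OF _ always_eventually, OF _ allI])
  then show "isCont f x" by (simp add: isCont_def LIM_zero_iff)
qed

text \<open>One step of the walk: the gradient coefficient grows by \<open>h\<^sup>2\<close>, and the
  quadratic error enters under the root, so that it only contributes order \<open>h\<^sup>3\<close>.\<close>

lemma gauss_profile_step:
  assumes qa: "quad_approx K f V" and V: "\<And>x. \<bar>V x\<bar> \<le> B"
    and f: "\<And>x. 0 < f x \<and> f x < 1" and h: "0 \<le> h" "h \<le> 1"
    and \<beta>: "0 \<le> \<beta>" and \<delta>: "0 \<le> \<delta>"
  shows "sqrt ((gauss_profile ((f (x + h) + f (x - h)) / 2))\<^sup>2 + \<beta> * ((V (x + h) + V (x - h)) / 2)\<^sup>2 + \<delta>)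
    \<le> (sqrt ((gauss_profile (f (x + h)))\<^sup>2 + (\<beta> + h\<^sup>2) * (V (x + h))\<^sup>2 + (\<delta> + (4 * K * B + 4 * K\<^sup>2) * h ^ 3))
      + sqrt ((gauss_profile (f (x - h)))\<^sup>2 + (\<beta> + h\<^sup>2) * (V (x - h))\<^sup>2 + (\<delta> + (4 * K * B + 4 * K\<^sup>2) * h ^ 3))) / 2"
proof -
  define d where "d = (f (x + h) - f (x - h)) / 2"
  define P where "P = sqrt ((gauss_profile (f (x + h)))\<^sup>2 + d\<^sup>2)"
  define Q where "Q = sqrt ((gauss_profile (f (x - h)))\<^sup>2 + d\<^sup>2)"
  have K: "0 \<le> K" by (rule quad_approx_nonneg[OF qa])
  have B: "0 \<le> B" using V[of 0] by linarith
  \<comment> \<open>Origin of the constant \<open>4 * K * B + 4 * K^2\<close>: the cross term uses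
    \<open>\<bar>v\<bar> \<le> B\<close>, and the term of order h^4 is absorbed into h^3 because
    \<open>h \<le> 1\<close>.\<close>
  have d_le: "d\<^sup>2 \<le> h\<^sup>2 * v\<^sup>2 + (4 * K * B + 4 * K\<^sup>2) * h ^ 3"
    if "\<bar>d\<bar> \<le> h * \<bar>v\<bar> + 2 * K * h\<^sup>2" "\<bar>v\<bar> \<le> B" for v
  proof -
    have "d\<^sup>2 \<le> (h * \<bar>v\<bar> + 2 * K * h\<^sup>2)\<^sup>2"
      using power_mono[OF that(1), of 2] by simp
    also have "\<dots> = h\<^sup>2 * v\<^sup>2 + 4 * K * \<bar>v\<bar> * h ^ 3 + 4 * K\<^sup>2 * (h ^ 3 * h)"
      by (simp add: power2_eq_square power3_eq_cube algebra_simps)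
    also have "\<dots> \<le> h\<^sup>2 * v\<^sup>2 + 4 * K * B * h ^ 3 + 4 * K\<^sup>2 * (h ^ 3 * 1)"
      using that(2) h K B by (intro add_mono mult_mono mult_left_mono order_refl) auto
    finally show ?thesis by (simp add: algebra_simps)
  qed
  \<comment> \<open>The expansion is taken about the endpoint \<open>x + h\<close> with increment
    \<open>- 2 * h\<close>, so that \<open>d\<close> is compared with \<open>V\<close> at the same
    point at which the profile is evaluated; likewise at \<open>x - h\<close> below.\<close>
  have dp: "\<bar>d\<bar> \<le> h * \<bar>V (x + h)\<bar> + 2 * K * h\<^sup>2"
  proof -
    have "\<bar>f (x + h + - 2 * h) - f (x + h) - (- 2 * h) * V (x + h)\<bar> \<le> K * (- 2 * h)\<^sup>2"
      using quad_approxD[OF qa] .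
    moreover have "f (x + h + - 2 * h) - f (x + h) - (- 2 * h) * V (x + h) = - 2 * d + 2 * h * V (x + h)"
    proof -
      have "x + h + - 2 * h = x - h" by simp
      then show ?thesis by (simp only: d_def) simp
    qed
    ultimately have "\<bar>- 2 * d + 2 * h * V (x + h)\<bar> \<le> 4 * K * h\<^sup>2"
      by (simp add: power_mult_distrib)
    then have "\<bar>d\<bar> \<le> \<bar>h * V (x + h)\<bar> + 2 * K * h\<^sup>2" by linarith
    then show ?thesis using h by (simp add: abs_mult)
  qed
  have dm: "\<bar>d\<bar> \<le> h * \<bar>V (x - h)\<bar> + 2 * K * h\<^sup>2"
  proof -
    have "\<bar>f (x - h + 2 * h) - f (x - h) - (2 * h) * V (x - h)\<bar> \<le> K * (2 * h)\<^sup>2"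
      using quad_approxD[OF qa] .
    moreover have "f (x - h + 2 * h) - f (x - h) - (2 * h) * V (x - h) = 2 * d - 2 * h * V (x - h)"
    proof -
      have "x - h + 2 * h = x + h" by simp
      then show ?thesis by (simp only: d_def) simp
    qed
    ultimately have "\<bar>2 * d - 2 * h * V (x - h)\<bar> \<le> 4 * K * h\<^sup>2"
      by (simp add: power_mult_distrib)
    then have "\<bar>d\<bar> \<le> \<bar>h * V (x - h)\<bar> + 2 * K * h\<^sup>2" by linarith
    then show ?thesis using h by (simp add: abs_mult)
  qed
  have PQ: "0 \<le> P" "0 \<le> Q" by (auto simp: P_def Q_def)
  have "gauss_profile ((f (x + h) + f (x - h)) / 2) \<le> (P + Q) / 2"
    using two_point_inequality[of "f (x + h)" "f (x - h)"] f by (simp add: P_def Q_def d_def)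
  then have "(gauss_profile ((f (x + h) + f (x - h)) / 2))\<^sup>2 \<le> ((P + Q) / 2)\<^sup>2"
    using gauss_profile_pos less_imp_le by (intro power_mono) blast+
  then have "sqrt ((gauss_profile ((f (x + h) + f (x - h)) / 2))\<^sup>2 + \<beta> * ((V (x + h) + V (x - h)) / 2)\<^sup>2 + \<delta>)
    \<le> sqrt (((P + Q) / 2)\<^sup>2 + \<beta> * ((V (x + h) + V (x - h)) / 2)\<^sup>2 + \<delta>)"
    by simp
  \<comment> \<open>All three terms become squares of sums with one summand for each endpoint, as
    the triangle inequality requires.\<close>
  also have "((P + Q) / 2)\<^sup>2 + \<beta> * ((V (x + h) + V (x - h)) / 2)\<^sup>2 + \<delta>
    = (P / 2 + Q / 2)\<^sup>2 + (sqrt \<beta> * V (x + h) / 2 + sqrt \<beta> * V (x - h) / 2)\<^sup>2 + (sqrt \<delta> / 2 + sqrt \<delta> / 2)\<^sup>2"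
  proof -
    have "(sqrt \<beta> * V (x + h) / 2 + sqrt \<beta> * V (x - h) / 2)\<^sup>2 = (sqrt \<beta>)\<^sup>2 * ((V (x + h) + V (x - h)) / 2)\<^sup>2"
      by (simp only: power_mult_distrib[symmetric] distrib_left add_divide_distrib times_divide_eq_right)
    then show ?thesis using \<beta> \<delta> by (simp add: add_divide_distrib)
  qed
  also have "sqrt \<dots> \<le> sqrt ((P / 2)\<^sup>2 + (sqrt \<beta> * V (x + h) / 2)\<^sup>2 + (sqrt \<delta> / 2)\<^sup>2)
      + sqrt ((Q / 2)\<^sup>2 + (sqrt \<beta> * V (x - h) / 2)\<^sup>2 + (sqrt \<delta> / 2)\<^sup>2)"
    by (rule Minkowski_3)
  also have "\<dots> = (sqrt (P\<^sup>2 + \<beta> * (V (x + h))\<^sup>2 + \<delta>) + sqrt (Q\<^sup>2 + \<beta> * (V (x - h))\<^sup>2 + \<delta>)) / 2"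
  proof -
    have "sqrt ((p / 2)\<^sup>2 + (sqrt \<beta> * v / 2)\<^sup>2 + (sqrt \<delta> / 2)\<^sup>2) = sqrt (p\<^sup>2 + \<beta> * v\<^sup>2 + \<delta>) / 2" for p v
    proof -
      have "(p / 2)\<^sup>2 + (sqrt \<beta> * v / 2)\<^sup>2 + (sqrt \<delta> / 2)\<^sup>2 = (p\<^sup>2 + \<beta> * v\<^sup>2 + \<delta>) / 4"
        using \<beta> \<delta> by (simp add: power_divide power_mult_distrib add_divide_distrib)
      then show ?thesis by (simp only: real_sqrt_divide) simp
    qed
    then show ?thesis by simp
  qed
  also have "\<dots> \<le> (sqrt ((gauss_profile (f (x + h)))\<^sup>2 + (\<beta> + h\<^sup>2) * (V (x + h))\<^sup>2 + (\<delta> + (4 * K * B + 4 * K\<^sup>2) * h ^ 3))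
      + sqrt ((gauss_profile (f (x - h)))\<^sup>2 + (\<beta> + h\<^sup>2) * (V (x - h))\<^sup>2 + (\<delta> + (4 * K * B + 4 * K\<^sup>2) * h ^ 3))) / 2"
  proof -
    have "P\<^sup>2 = (gauss_profile (f (x + h)))\<^sup>2 + d\<^sup>2" "Q\<^sup>2 = (gauss_profile (f (x - h)))\<^sup>2 + d\<^sup>2"
      by (simp_all add: P_def Q_def)
    then show ?thesis
      using d_le[OF dp V] d_le[OF dm V]
      by (intro divide_right_mono add_mono[OF real_sqrt_le_mono real_sqrt_le_mono]) (simp_all add: distrib_right)
  qed
  finally show ?thesis .
qed

section \<open>Iteration along the simple random walk\<close>

fun walk :: "real \<Rightarrow> nat \<Rightarrow> real pmf" where
  "walk h 0 = return_pmf 0"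
| "walk h (Suc n) = bind_pmf (walk h n) (\<lambda>x. pmf_of_set {x + h, x - h})"

lemma finite_set_pmf_walk: "finite (set_pmf (walk h n))"
  by (induction n) auto

lemma expectation_walk_Suc:
  fixes g :: "real \<Rightarrow> 'b :: {banach, second_countable_topology}"
  assumes "h \<noteq> 0"
  shows "measure_pmf.expectation (walk h (Suc n)) g
    = measure_pmf.expectation (walk h n) (\<lambda>x. (1 / 2) *\<^sub>R (g (x + h) + g (x - h)))"
proof -
  have "measure_pmf.expectation (walk h (Suc n)) g
    = (\<Sum>x\<in>set_pmf (walk h n). pmf (walk h n) x *\<^sub>R measure_pmf.expectation (pmf_of_set {x + h, x - h}) g)"
    unfolding walk.simps
    by (rule pmf_expectation_bind[OF finite_set_pmf_walk]) auto
  also have "\<dots> = (\<Sum>x\<in>set_pmf (walk h n). pmf (walk h n) x *\<^sub>R ((1 / 2) *\<^sub>R (g (x + h) + g (x - h))))"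
  proof (intro sum.cong refl arg_cong2[where f=scaleR])
    fix x
    have "measure_pmf.expectation (pmf_of_set {x + h, x - h}) g
      = (\<Sum>a\<in>{x + h, x - h}. pmf (pmf_of_set {x + h, x - h}) a *\<^sub>R g a)"
      by (rule integral_measure_pmf) auto
    also have "\<dots> = (1 / 2) *\<^sub>R (g (x + h) + g (x - h))"
      using assms by (simp add: scaleR_add_right)
    finally show "measure_pmf.expectation (pmf_of_set {x + h, x - h}) g = (1 / 2) *\<^sub>R (g (x + h) + g (x - h))" .
  qed
  also have "\<dots> = measure_pmf.expectation (walk h n) (\<lambda>x. (1 / 2) *\<^sub>R (g (x + h) + g (x - h)))"
    by (rule integral_measure_pmf[symmetric, OF finite_set_pmf_walk]) auto
  finally show ?thesis .
qed

text \<open>Averaging \<open>f\<close> and \<open>V\<close> over one step preserves all hypotheses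
  with the same \<open>K\<close> and \<open>B\<close>. The induction hypothesis is applied to the
  averages \<open>Tf\<close>, \<open>TV\<close>, and the one-step estimate with coefficients
  \<open>real n * h^2\<close> and \<open>n\<close> times the error is then used inside the
  expectation.\<close>

lemma gauss_profile_walk:
  assumes "quad_approx K f V" "\<And>x. \<bar>V x\<bar> \<le> B" "\<And>x. 0 < f x \<and> f x < 1" "0 < h" "h \<le> 1"
  shows "gauss_profile (measure_pmf.expectation (walk h n) f)
    \<le> measure_pmf.expectation (walk h n) (\<lambda>x. sqrt ((gauss_profile (f x))\<^sup>2 + real n * h\<^sup>2 * (V x)\<^sup>2
         + real n * ((4 * K * B + 4 * K\<^sup>2) * h ^ 3)))"
  using assms
proof (induction n arbitrary: f V)
  case 0
  then show ?case using gauss_profile_pos[of "f 0"] by (simp add: less_imp_le)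
next
  case (Suc n)
  let ?R = "(4 * K * B + 4 * K\<^sup>2) * h ^ 3"
  define Tf where "Tf = (\<lambda>x. (f (x + h) + f (x - h)) / 2)"
  define TV where "TV = (\<lambda>x. (V (x + h) + V (x - h)) / 2)"
  have K: "0 \<le> K" by (rule quad_approx_nonneg[OF Suc.prems(1)])
  have B: "0 \<le> B" using Suc.prems(2)[of 0] by linarith
  have "quad_approx K Tf TV"
    unfolding quad_approx_def
  proof (intro allI)
    fix x s
    have "\<bar>f (x + h + s) - f (x + h) - s * V (x + h)\<bar> \<le> K * s\<^sup>2"
         "\<bar>f (x - h + s) - f (x - h) - s * V (x - h)\<bar> \<le> K * s\<^sup>2"
      using quad_approxD[OF Suc.prems(1)] by blast+
    then have "\<bar>(f (x + h + s) - f (x + h) - s * V (x + h)) + (f (x - h + s) - f (x - h) - s * V (x - h))\<bar> \<le> 2 * (K * s\<^sup>2)"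
      by (rule abs_add_le)
    also have "(f (x + h + s) - f (x + h) - s * V (x + h)) + (f (x - h + s) - f (x - h) - s * V (x - h))
        = 2 * (Tf (x + s) - Tf x - s * TV x)"
      by (simp add: Tf_def TV_def field_simps)
    finally show "\<bar>Tf (x + s) - Tf x - s * TV x\<bar> \<le> K * s\<^sup>2"
      by (simp add: abs_mult)
  qed
  moreover have "\<bar>TV x\<bar> \<le> B" for x
    using abs_add_le[OF Suc.prems(2)[of "x + h"] Suc.prems(2)[of "x - h"]] by (simp add: TV_def)
  moreover have "0 < Tf x \<and> Tf x < 1" for x
    using Suc.prems(3)[of "x + h"] Suc.prems(3)[of "x - h"] unfolding Tf_def by auto
  ultimately have "gauss_profile (measure_pmf.expectation (walk h n) Tf)
    \<le> measure_pmf.expectation (walk h n) (\<lambda>x. sqrt ((gauss_profile (Tf x))\<^sup>2 + real n * h\<^sup>2 * (TV x)\<^sup>2 + real n * ?R))"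
    using Suc.prems(4,5) by (rule Suc.IH)
  also have "\<dots> \<le> measure_pmf.expectation (walk h n) (\<lambda>x. (1 / 2) *\<^sub>R
      (sqrt ((gauss_profile (f (x + h)))\<^sup>2 + real (Suc n) * h\<^sup>2 * (V (x + h))\<^sup>2 + real (Suc n) * ?R)
     + sqrt ((gauss_profile (f (x - h)))\<^sup>2 + real (Suc n) * h\<^sup>2 * (V (x - h))\<^sup>2 + real (Suc n) * ?R)))"
  proof (rule integral_mono)
    fix x
    show "sqrt ((gauss_profile (Tf x))\<^sup>2 + real n * h\<^sup>2 * (TV x)\<^sup>2 + real n * ?R) \<le> (1 / 2) *\<^sub>R
      (sqrt ((gauss_profile (f (x + h)))\<^sup>2 + real (Suc n) * h\<^sup>2 * (V (x + h))\<^sup>2 + real (Suc n) * ?R)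
     + sqrt ((gauss_profile (f (x - h)))\<^sup>2 + real (Suc n) * h\<^sup>2 * (V (x - h))\<^sup>2 + real (Suc n) * ?R))"
      using gauss_profile_step[OF Suc.prems(1-3), of h "real n * h\<^sup>2" "real n * ?R" x] Suc.prems(4,5) K B
      by (simp add: Tf_def TV_def algebra_simps)
  qed (auto intro!: integrable_measure_pmf_finite finite_set_pmf_walk)
  finally show ?case
    unfolding expectation_walk_Suc[OF less_imp_neq[OF Suc.prems(4), symmetric]] Tf_def by simp
qed

section \<open>Central limit theorem for the walk, and Bobkov's inequality for the Gaussian
  measure\<close>

lemma walk_weak_conv:
  "weak_conv_m (\<lambda>n. distr (measure_pmf (walk (1 / sqrt (real (Suc n))) (Suc n))) borel (\<lambda>x. x)) std_normal_distribution"
proof (rule levy_continuity)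
  show "real_distribution (distr (measure_pmf (walk (1 / sqrt (real (Suc n))) (Suc n))) borel (\<lambda>x. x))" for n
    by (simp add: real_distribution_def real_distribution_axioms_def measure_pmf.prob_space_distr)
  show "real_distribution std_normal_distribution" by (rule real_dist_normal_dist)
  fix t
  \<comment> \<open>Averaging over the two signs of a step multiplies \<open>iexp (t * x)\<close> by
    the real factor \<open>cos (t * h)\<close>, so the characteristic function is a power of
    it.\<close>
  have walk_char: "measure_pmf.expectation (walk h n) (\<lambda>x. iexp (t * x)) = complex_of_real (cos (t * h) ^ n)"
    if "h \<noteq> 0" for h n
  proof (induction n)
    case (Suc n)
    have "(1 / 2) *\<^sub>R (iexp (t * (x + h)) + iexp (t * (x - h))) = complex_of_real (cos (t * h)) * iexp (t * x)" for x
    proof -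
      have "iexp (t * (x + h)) + iexp (t * (x - h)) = iexp (t * x) * (iexp (t * h) + iexp (- (t * h)))"
        by (simp add: algebra_simps exp_add exp_diff exp_minus field_simps)
      also have "iexp (t * h) + iexp (- (t * h)) = 2 * complex_of_real (cos (t * h))"
        unfolding cis_conv_exp[symmetric] by (simp add: complex_eq_iff)
      finally show ?thesis by (simp add: scaleR_conv_of_real)
    qed
    then show ?case
      using Suc that by (subst expectation_walk_Suc) auto
  qed simp
  have "(\<lambda>n::nat. cos (t / sqrt (real (Suc n))) ^ Suc n) \<longlonglongrightarrow> exp (- (t\<^sup>2) / 2)"
  proof -
    have pos: "(\<lambda>n::nat. cos (s / sqrt (real (Suc n))) ^ Suc n) \<longlonglongrightarrow> exp (- (s\<^sup>2) / 2)" if "s > 0" for s :: real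
      using that unfolding power2_eq_square by real_asymp
    \<comment> \<open>The asymptotic expansion is carried out for a positive argument; evenness of
      the cosine covers negative \<open>t\<close>.\<close>
    consider "t = 0" | "t > 0" | "- t > 0" by linarith
    then show ?thesis
    proof cases
      case 3
      then show ?thesis using pos[of "- t"] by simp
    qed (use pos in auto)
  qed
  then have "(\<lambda>n::nat. complex_of_real (cos (t / sqrt (real (Suc n))) ^ Suc n)) \<longlonglongrightarrow> complex_of_real (exp (- (t\<^sup>2) / 2))"
    by (rule tendsto_of_real)
  moreover have "char (distr (measure_pmf (walk (1 / sqrt (real (Suc n))) (Suc n))) borel (\<lambda>x. x)) t
      = complex_of_real (cos (t / sqrt (real (Suc n))) ^ Suc n)" for n
    using walk_char[of "1 / sqrt (real (Suc n))" "Suc n"]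
    by (simp add: char_def integral_distr del: walk.simps)
  ultimately show "(\<lambda>n. char (distr (measure_pmf (walk (1 / sqrt (real (Suc n))) (Suc n))) borel (\<lambda>x. x)) t)
      \<longlonglongrightarrow> char std_normal_distribution t"
    by (simp add: char_std_normal_distribution)
qed

text \<open>The constant \<kappa> weighs the gradient: it is the square of the Lipschitz constant of
  the map that transports the Gaussian to \<open>M\<close>. The parameter \<eta> keeps
  \<open>f\<close> where the profile is continuous.\<close>

definition bobkov1 :: "real \<Rightarrow> real measure \<Rightarrow> bool" where
  "bobkov1 \<kappa> M \<longleftrightarrow> (\<forall>K B \<eta> f V. quad_approx K f V \<longrightarrow> (\<forall>x. \<bar>V x\<bar> \<le> B) \<longrightarrow> 0 < \<eta> \<longrightarrow>
     (\<forall>x. \<eta> \<le> f x \<and> f x \<le> 1 - \<eta>) \<longrightarrow>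
     gauss_profile (\<integral>x. f x \<partial>M) \<le> (\<integral>x. sqrt ((gauss_profile (f x))\<^sup>2 + \<kappa> * (V x)\<^sup>2) \<partial>M))"

lemma isCont_gauss_profile: "0 < a \<Longrightarrow> a < 1 \<Longrightarrow> isCont gauss_profile a"
  by (rule DERIV_isCont[OF has_real_derivative_gauss_profile])

lemma sqrt_gauss_profile_bound:
  assumes "\<bar>v\<bar> \<le> B" "0 \<le> \<kappa>"
  shows "\<bar>sqrt ((gauss_profile a)\<^sup>2 + \<kappa> * v\<^sup>2)\<bar> \<le> sqrt (1 + \<kappa> * B\<^sup>2)"
proof -
  have "(gauss_profile a)\<^sup>2 \<le> 1"
    using gauss_profile_le_1[of a] gauss_profile_pos[of a] by (simp add: power_le_one)
  moreover have "v\<^sup>2 \<le> B\<^sup>2"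
    using assms(1) by (metis power2_abs power_mono abs_ge_zero)
  ultimately have "(gauss_profile a)\<^sup>2 + \<kappa> * v\<^sup>2 \<le> 1 + \<kappa> * B\<^sup>2"
    using assms(2) by (intro add_mono mult_left_mono)
  then show ?thesis using assms(2) by simp
qed

theorem bobkov1_std_normal: "bobkov1 1 std_normal_distribution"
  unfolding bobkov1_def
proof (intro allI impI)
  fix K B \<eta> f V
  assume qa: "quad_approx K f V" and V: "\<forall>x. \<bar>V x\<bar> \<le> B" and \<eta>: "0 < (\<eta>::real)"
    and f: "\<forall>x. \<eta> \<le> f x \<and> f x \<le> 1 - \<eta>"
  define R where "R = 4 * K * B + 4 * K\<^sup>2"
  have "0 \<le> K" by (rule quad_approx_nonneg[OF qa])
  moreover have "0 \<le> B" using spec[OF V, of 0] by linarith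
  ultimately have R: "0 \<le> R" by (simp add: R_def)
  have f01: "0 < f x \<and> f x < 1" for x using f \<eta> by (meson le_less_trans less_le_trans diff_less_eq less_add_same_cancel1)
  define h where "h = (\<lambda>n. 1 / sqrt (real (Suc n)))"
  define \<mu> where "\<mu> = (\<lambda>n. measure_pmf (walk (h n) (Suc n)))"
  define g where "g = (\<lambda>x. sqrt ((gauss_profile (f x))\<^sup>2 + 1 * (V x)\<^sup>2))"
  have cont: "isCont f x" "isCont V x" for x using quad_approx_isCont[OF qa] by auto
  have g_cont: "isCont g x" for x
    unfolding g_def using f01[of x]
    by (intro continuous_intros isCont_o2[OF cont(1) isCont_gauss_profile] cont) auto
  have g_bound: "norm (g x) \<le> sqrt (1 + 1 * B\<^sup>2)" for x
    unfolding g_def real_norm_def using V by (intro sqrt_gauss_profile_bound) auto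
  have f_bound: "norm (f x) \<le> 1" for x using f01[of x] by auto
  have lim: "(\<lambda>n. integral\<^sup>L (\<mu> n) F) \<longlonglongrightarrow> integral\<^sup>L std_normal_distribution F"
    if "\<And>x. isCont F x" "\<And>x. norm (F x) \<le> C" for F :: "real \<Rightarrow> real" and C
  proof -
    have m: "F \<in> borel_measurable borel"
      using that(1) by (auto intro!: borel_measurable_continuous_onI continuous_at_imp_continuous_on)
    have "(\<lambda>n. integral\<^sup>L (distr (\<mu> n) borel (\<lambda>x. x)) F) \<longlonglongrightarrow> integral\<^sup>L std_normal_distribution F"
      unfolding \<mu>_def h_def
      by (rule weak_conv_imp_integral_bdd_continuous_conv[OF _ real_dist_normal_dist walk_weak_conv that])
         (simp add: real_distribution_def real_distribution_axioms_def measure_pmf.prob_space_distr)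
    then show ?thesis using m by (simp add: \<mu>_def integral_distr)
  qed
  have fin: "integrable (\<mu> n) F" for n and F :: "real \<Rightarrow> real"
    unfolding \<mu>_def by (rule integrable_measure_pmf_finite[OF finite_set_pmf_walk])
  have main: "gauss_profile (integral\<^sup>L (\<mu> n) f) \<le> integral\<^sup>L (\<mu> n) g + sqrt (R * h n)" for n
  proof -
    have h: "0 < h n" "h n \<le> 1" by (auto simp: h_def)
    \<comment> \<open>The choice of \<open>h n\<close> makes the gradient coefficient exactly 1,
      while \<open>Suc n\<close> errors of order h^3 add up to \<open>R * h n\<close>, which
      vanishes in the limit.\<close>
    have h2: "real (Suc n) * (h n)\<^sup>2 = 1" by (simp add: h_def power_divide)
    have h3: "real (Suc n) * (R * h n ^ 3) = R * h n"
    proof -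
      have "real (Suc n) * (R * h n ^ 3) = (real (Suc n) * (h n)\<^sup>2) * (R * h n)"
        by (simp add: power2_eq_square power3_eq_cube)
      then show ?thesis unfolding h2 by simp
    qed
    have "gauss_profile (integral\<^sup>L (\<mu> n) f) \<le> (\<integral>x. sqrt ((gauss_profile (f x))\<^sup>2
        + real (Suc n) * (h n)\<^sup>2 * (V x)\<^sup>2 + real (Suc n) * (R * h n ^ 3)) \<partial>\<mu> n)"
      unfolding \<mu>_def R_def by (rule gauss_profile_walk[OF qa]) (use V f01 h in auto)
    also have "\<dots> \<le> (\<integral>x. g x + sqrt (R * h n) \<partial>\<mu> n)"
    proof (rule integral_mono[OF fin fin])
      fix x
      show "sqrt ((gauss_profile (f x))\<^sup>2 + real (Suc n) * (h n)\<^sup>2 * (V x)\<^sup>2 + real (Suc n) * (R * h n ^ 3))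
        \<le> g x + sqrt (R * h n)"
        unfolding h2 h3 g_def using R h by (intro order_trans[OF sqrt_add_le_add_sqrt]) auto
    qed
    also have "\<dots> = integral\<^sup>L (\<mu> n) g + sqrt (R * h n)"
      by (subst Bochner_Integration.integral_add[OF fin fin]) (simp add: \<mu>_def)
    finally show ?thesis .
  qed
  \<comment> \<open>The limiting mean has to lie in \<open>[\<eta>, 1 - \<eta>]\<close>, so that the
    profile is continuous there and the left-hand sides converge.\<close>
  have "integrable std_normal_distribution f"
    by (rule std_normal.integrable_const_bound[of _ 1])
       (use f_bound cont in \<open>auto intro!: borel_measurable_continuous_onI continuous_at_imp_continuous_on\<close>)
  then have "\<eta> \<le> integral\<^sup>L std_normal_distribution f" "integral\<^sup>L std_normal_distribution f \<le> 1 - \<eta>"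
    using f by (auto intro!: std_normal.integral_ge_const std_normal.integral_le_const)
  then have "isCont gauss_profile (integral\<^sup>L std_normal_distribution f)"
    using \<eta> by (intro isCont_gauss_profile) auto
  then have L: "(\<lambda>n. gauss_profile (integral\<^sup>L (\<mu> n) f)) \<longlonglongrightarrow> gauss_profile (integral\<^sup>L std_normal_distribution f)"
    by (rule isCont_tendsto_compose[OF _ lim[OF cont(1) f_bound]])
  have "h \<longlonglongrightarrow> 0" unfolding h_def by real_asymp
  then have "(\<lambda>n. sqrt (R * h n)) \<longlonglongrightarrow> 0"
    by (auto intro!: tendsto_eq_intros)
  then have "(\<lambda>n. integral\<^sup>L (\<mu> n) g + sqrt (R * h n)) \<longlonglongrightarrow> integral\<^sup>L std_normal_distribution g + 0"
    by (intro tendsto_add lim[OF g_cont g_bound])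
  from LIMSEQ_le[OF L this] main
  show "gauss_profile (integral\<^sup>L std_normal_distribution f)
    \<le> (\<integral>x. sqrt ((gauss_profile (f x))\<^sup>2 + 1 * (V x)\<^sup>2) \<partial>std_normal_distribution)"
    unfolding g_def by auto
qed

section \<open>Transfer to the uniform measure on the unit interval\<close>

abbreviation unif01 :: "real measure" where
  "unif01 \<equiv> uniform_measure lborel {0..1}"

lemma prob_space_unif01: "prob_space unif01"
  by (rule prob_space_uniform_measure) auto

text \<open>The probability integral transform. Both distribution functions agree because, for 0 < u
  < 1, \<open>gauss_cdf x \<le> u\<close> means that \<open>x\<close> is at most the quantile of
  \<open>u\<close>; for other u the event is empty or everything.\<close>

lemma distr_gauss_cdf: "distr std_normal_distribution borel gauss_cdf = unif01"
proof (rule cdf_unique)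
  have m: "gauss_cdf \<in> borel_measurable borel"
    using isCont_gauss_cdf by (auto intro!: borel_measurable_continuous_onI continuous_at_imp_continuous_on)
  show "real_distribution (distr std_normal_distribution borel gauss_cdf)"
    using m by (intro std_normal.real_distribution_distr) simp
  show "real_distribution unif01"
    by (simp add: real_distribution_def real_distribution_axioms_def prob_space_unif01)
  show "cdf (distr std_normal_distribution borel gauss_cdf) = cdf unif01"
  proof
    fix u :: real
    have 1: "cdf (distr std_normal_distribution borel gauss_cdf) u
      = measure std_normal_distribution {x. gauss_cdf x \<le> u}"
      using m by (simp add: cdf_def measure_distr vimage_def)
    have 2: "cdf unif01 u = measure lborel ({0..1} \<inter> {..u})"
      by (simp add: cdf_def)
    consider "u \<le> 0" | "0 < u" "u < 1" | "1 \<le> u" by linarith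
    then show "cdf (distr std_normal_distribution borel gauss_cdf) u = cdf unif01 u"
    proof cases
      case 1
      then have "{x. gauss_cdf x \<le> u} = {}"
        using gauss_cdf_pos by (auto simp: not_le intro: le_less_trans)
      moreover have "{0..1} \<inter> {..u} = (if u = 0 then {0} else {})"
        using 1 by auto
      ultimately show ?thesis unfolding \<open>cdf (distr _ _ _) u = _\<close> 2 by simp
    next
      case 2
      then have "{x. gauss_cdf x \<le> u} = {..gauss_quantile u}"
        by (metis (no_types, lifting) Collect_cong atMost_def gauss_cdf_le_iff gauss_cdf_quantile)
      then have "measure std_normal_distribution {x. gauss_cdf x \<le> u} = gauss_cdf (gauss_quantile u)"
        by (simp add: cdf_def)
      moreover have "{0..1} \<inter> {..u} = {0..u}" using 2 by auto
      ultimately show ?thesis using 2 unfolding \<open>cdf (distr _ _ _) u = _\<close> \<open>cdf unif01 u = _\<close> by simp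
    next
      case 3
      then have "{x. gauss_cdf x \<le> u} = UNIV"
        using gauss_cdf_less_1 by (auto intro: less_imp_le less_le_trans)
      moreover have "{0..1} \<inter> {..u} = {0..1}" using 3 by auto
      ultimately show ?thesis unfolding 1 2 using std_normal.prob_space by simp
    qed
  qed
qed

text \<open>The derivative is bounded by 1, since
  \<open>\<bar>z\<bar> \<le> 1 + z^2 / 2 \<le> exp (z^2 / 2)\<close> cancels the Gaussian
  factor.\<close>

lemma std_normal_density_Lipschitz: "\<bar>std_normal_density y - std_normal_density x\<bar> \<le> \<bar>y - x\<bar>"
proof -
  have "\<bar>- z * std_normal_density z\<bar> \<le> 1" for z
  proof -
    have "\<bar>z\<bar> \<le> 1 + z\<^sup>2 / 2"
      using zero_le_power2[of "\<bar>z\<bar> - 1"] by (simp add: power2_eq_square algebra_simps abs_mult[symmetric])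
    also have "\<dots> \<le> exp (z\<^sup>2 / 2)" by (rule exp_ge_add_one_self)
    finally have "\<bar>z\<bar> * exp (- (z\<^sup>2 / 2)) \<le> exp (z\<^sup>2 / 2) * exp (- (z\<^sup>2 / 2))"
      by (intro mult_right_mono) auto
    then have 1: "\<bar>z\<bar> * exp (- (z\<^sup>2 / 2)) \<le> 1" by (simp add: exp_minus)
    have "1 / sqrt (2 * pi) \<le> 1"
      using pi_gt3 by simp
    then have "(1 / sqrt (2 * pi)) * (\<bar>z\<bar> * exp (- (z\<^sup>2 / 2))) \<le> 1 * 1"
      using 1 by (intro mult_mono) auto
    then show ?thesis by (simp add: std_normal_density_def abs_mult)
  qed
  then have "norm (std_normal_density y - std_normal_density x) \<le> 1 * norm (y - x)"
    by (intro field_differentiable_bound[of UNIV std_normal_density "\<lambda>z. - z * std_normal_density z"]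
        has_real_derivative_std_normal_density) auto
  then show ?thesis by simp
qed

text \<open>After subtracting the linear part, the derivative is a difference of two density values,
  at most \<open>\<bar>h\<bar>\<close> on the ball of that radius; the mean value inequality
  contributes the second factor \<open>\<bar>h\<bar>\<close>.\<close>

lemma quad_approx_gauss_cdf: "quad_approx 1 gauss_cdf std_normal_density"
  unfolding quad_approx_def
proof (intro allI)
  fix x h
  let ?g = "\<lambda>y. gauss_cdf y - y * std_normal_density x"
  have "norm (?g (x + h) - ?g x) \<le> \<bar>h\<bar> * norm (x + h - x)"
  proof (rule field_differentiable_bound[of "cball x \<bar>h\<bar>" ?g "\<lambda>z. std_normal_density z - std_normal_density x"])
    fix z assume "z \<in> cball x \<bar>h\<bar>"
    then show "norm (std_normal_density z - std_normal_density x) \<le> \<bar>h\<bar>"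
      using std_normal_density_Lipschitz[of z x] by (simp add: dist_real_def abs_minus_commute)
    show "(?g has_real_derivative std_normal_density z - std_normal_density x) (at z within cball x \<bar>h\<bar>)"
      by (rule has_field_derivative_at_within)
         (auto intro!: derivative_eq_intros has_real_derivative_gauss_cdf)
  qed (auto simp: dist_real_def)
  moreover have "?g (x + h) - ?g x = gauss_cdf (x + h) - gauss_cdf x - h * std_normal_density x"
    by (simp add: algebra_simps)
  ultimately show "\<bar>gauss_cdf (x + h) - gauss_cdf x - h * std_normal_density x\<bar> \<le> 1 * h\<^sup>2"
    by (simp add: power2_eq_square abs_mult[symmetric])
qed

lemma gauss_cdf_Lipschitz: "\<bar>gauss_cdf (x + h) - gauss_cdf x\<bar> \<le> \<bar>h\<bar>"
proof -
  have "norm (gauss_cdf (x + h) - gauss_cdf x) \<le> 1 * norm (x + h - x)"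
    by (rule field_differentiable_bound[of UNIV gauss_cdf std_normal_density])
       (auto intro: has_real_derivative_gauss_cdf std_normal_density_le_1)
  then show ?thesis by simp
qed

theorem bobkov1_unif01: "bobkov1 (1 / (2 * pi)) unif01"
  unfolding bobkov1_def
proof (intro allI impI)
  fix K B \<eta> f V
  assume qa: "quad_approx K f V" and V: "\<forall>x. \<bar>V x\<bar> \<le> B" and \<eta>: "0 < (\<eta>::real)"
    and f: "\<forall>x. \<eta> \<le> f x \<and> f x \<le> 1 - \<eta>"
  have K: "0 \<le> K" by (rule quad_approx_nonneg[OF qa])
  have B: "0 \<le> B" using spec[OF V, of 0] by linarith
  have m: "gauss_cdf \<in> borel_measurable borel"
    using isCont_gauss_cdf by (auto intro!: borel_measurable_continuous_onI continuous_at_imp_continuous_on)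
  have [measurable]: "f \<in> borel_measurable borel" "V \<in> borel_measurable borel"
    using quad_approx_isCont[OF qa]
    by (auto intro!: borel_measurable_continuous_onI continuous_at_imp_continuous_on)
  have f01: "0 < f x \<and> f x < 1" for x using f \<eta> by (meson le_less_trans less_le_trans diff_less_eq less_add_same_cancel1)
  define V' where "V' = (\<lambda>x. V (gauss_cdf x) * std_normal_density x)"
  have V': "\<bar>V' x\<bar> \<le> B" for x
  proof -
    have "\<bar>V (gauss_cdf x)\<bar> * std_normal_density x \<le> B * 1"
      using V B std_normal_density_le_1 by (intro mult_mono) auto
    then show ?thesis by (simp add: V'_def abs_mult)
  qed
  have "quad_approx (K + B) (\<lambda>x. f (gauss_cdf x)) V'"
    unfolding quad_approx_def
  proof (intro allI)
    fix x h
    define d where "d = gauss_cdf (x + h) - gauss_cdf x"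
    have "\<bar>f (gauss_cdf x + d) - f (gauss_cdf x) - d * V (gauss_cdf x)\<bar> \<le> K * d\<^sup>2"
      by (rule quad_approxD[OF qa])
    also have "\<dots> \<le> K * h\<^sup>2"
      using gauss_cdf_Lipschitz[of x h] K by (intro mult_left_mono) (auto simp: d_def abs_le_square_iff)
    finally have 1: "\<bar>f (gauss_cdf x + d) - f (gauss_cdf x) - d * V (gauss_cdf x)\<bar> \<le> K * h\<^sup>2" .
    have "\<bar>d - h * std_normal_density x\<bar> * \<bar>V (gauss_cdf x)\<bar> \<le> (1 * h\<^sup>2) * B"
      using quad_approxD[OF quad_approx_gauss_cdf, of x h] V
      by (intro mult_mono) (auto simp: d_def)
    then have 2: "\<bar>(d - h * std_normal_density x) * V (gauss_cdf x)\<bar> \<le> B * h\<^sup>2"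
      by (simp add: abs_mult mult.commute)
    have "f (gauss_cdf (x + h)) - f (gauss_cdf x) - h * V' x
      = (f (gauss_cdf x + d) - f (gauss_cdf x) - d * V (gauss_cdf x)) + (d - h * std_normal_density x) * V (gauss_cdf x)"
      by (simp add: V'_def d_def algebra_simps)
    also have "\<bar>\<dots>\<bar> \<le> K * h\<^sup>2 + B * h\<^sup>2"
      by (rule order_trans[OF abs_triangle_ineq add_mono[OF 1 2]])
    finally show "\<bar>f (gauss_cdf (x + h)) - f (gauss_cdf x) - h * V' x\<bar> \<le> (K + B) * h\<^sup>2"
      by (simp add: distrib_right)
  qed
  then have "gauss_profile (\<integral>x. f (gauss_cdf x) \<partial>std_normal_distribution)
    \<le> (\<integral>x. sqrt ((gauss_profile (f (gauss_cdf x)))\<^sup>2 + 1 * (V' x)\<^sup>2) \<partial>std_normal_distribution)"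
    using bobkov1_std_normal V' \<eta> f unfolding bobkov1_def by blast
  also have "\<dots> \<le> (\<integral>x. sqrt ((gauss_profile (f (gauss_cdf x)))\<^sup>2 + 1 / (2 * pi) * (V (gauss_cdf x))\<^sup>2) \<partial>std_normal_distribution)"
  proof (rule integral_mono)
    have profile_measurable: "(\<lambda>x. gauss_profile (f (gauss_cdf x))) \<in> borel_measurable borel"
      using f01
      by (intro borel_measurable_continuous_onI continuous_at_imp_continuous_on ballI
          isCont_o2[OF isCont_o2[OF isCont_gauss_cdf quad_approx_isCont(1)[OF qa]] isCont_gauss_profile]) auto
    have Vm: "(\<lambda>x. V (gauss_cdf x)) \<in> borel_measurable borel"
      using measurable_compose[OF m \<open>V \<in> _\<close>] .
    have V'm: "V' \<in> borel_measurable borel"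
      unfolding V'_def using Vm by measurable
    show "integrable std_normal_distribution (\<lambda>x. sqrt ((gauss_profile (f (gauss_cdf x)))\<^sup>2 + 1 * (V' x)\<^sup>2))"
      using profile_measurable V'm sqrt_gauss_profile_bound[OF V', of 1]
      by (intro std_normal.integrable_const_bound[of _ "sqrt (1 + 1 * B\<^sup>2)"]) auto
    show "integrable std_normal_distribution (\<lambda>x. sqrt ((gauss_profile (f (gauss_cdf x)))\<^sup>2 + 1 / (2 * pi) * (V (gauss_cdf x))\<^sup>2))"
      using profile_measurable Vm sqrt_gauss_profile_bound[OF spec[OF V], of "1 / (2 * pi)"]
      by (intro std_normal.integrable_const_bound[of _ "sqrt (1 + 1 / (2 * pi) * B\<^sup>2)"]) auto
    fix x
    \<comment> \<open>The maximum of the density supplies \<kappa> = 1 / (2 pi).\<close>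
    have "(std_normal_density x)\<^sup>2 \<le> (1 / sqrt (2 * pi))\<^sup>2"
      by (intro power_mono std_normal_density_le) auto
    then have "(V (gauss_cdf x))\<^sup>2 * (std_normal_density x)\<^sup>2 \<le> (V (gauss_cdf x))\<^sup>2 * (1 / (2 * pi))"
      by (intro mult_left_mono) (simp_all add: power_divide)
    then show "sqrt ((gauss_profile (f (gauss_cdf x)))\<^sup>2 + 1 * (V' x)\<^sup>2)
      \<le> sqrt ((gauss_profile (f (gauss_cdf x)))\<^sup>2 + 1 / (2 * pi) * (V (gauss_cdf x))\<^sup>2)"
      by (simp add: V'_def power_mult_distrib)
  qed
  also have "\<dots> = (\<integral>x. sqrt ((gauss_profile (f x))\<^sup>2 + 1 / (2 * pi) * (V x)\<^sup>2) \<partial>distr std_normal_distribution borel gauss_cdf)"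
  proof (rule integral_distr[symmetric])
    have [measurable]: "(\<lambda>x. gauss_profile (f x)) \<in> borel_measurable borel"
      using f01
      by (intro borel_measurable_continuous_onI continuous_at_imp_continuous_on ballI
          isCont_o2[OF quad_approx_isCont(1)[OF qa] isCont_gauss_profile]) auto
    show "(\<lambda>x. sqrt ((gauss_profile (f x))\<^sup>2 + 1 / (2 * pi) * (V x)\<^sup>2)) \<in> borel_measurable borel"
      by measurable
  qed (use m in simp)
  also have "(\<integral>x. f (gauss_cdf x) \<partial>std_normal_distribution) = (\<integral>x. f x \<partial>distr std_normal_distribution borel gauss_cdf)"
    using m by (intro integral_distr[symmetric]) auto
  finally show "gauss_profile (\<integral>x. f x \<partial>unif01)
    \<le> (\<integral>x. sqrt ((gauss_profile (f x))\<^sup>2 + 1 / (2 * pi) * (V x)\<^sup>2) \<partial>unif01)"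
    unfolding distr_gauss_cdf .
qed

section \<open>Products\<close>

lemma (in prob_space) abs_integral_le_const:
  fixes f :: "'a \<Rightarrow> real"
  assumes "\<And>x. x \<in> space M \<Longrightarrow> \<bar>f x\<bar> \<le> c"
  shows "\<bar>\<integral>x. f x \<partial>M\<bar> \<le> c"
proof (cases "integrable M f")
  case True
  have "\<bar>\<integral>x. f x \<partial>M\<bar> \<le> (\<integral>x. \<bar>f x\<bar> \<partial>M)" by (rule integral_abs_bound)
  also have "\<dots> \<le> c"
    using True assms by (intro integral_le_const AE_I2) auto
  finally show ?thesis .
next
  \<comment> \<open>The integral is then 0 by convention, and \<open>0 \<le> c\<close> follows from
    the bound at any point of the nonempty space.\<close>
  case False
  obtain x where "x \<in> space M" using not_empty by auto
  then have "0 \<le> c" using assms[of x] by linarith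
  then show ?thesis using False by (simp add: not_integrable_integral_eq)
qed

text \<open>Duality: pair the integrand vector with the vector \<open>m\<close> of its integrals,
  apply Cauchy-Schwarz pointwise, and divide by the length \<open>N\<close> of
  \<open>m\<close>.\<close>

lemma Minkowski_integral:
  fixes c :: "'i \<Rightarrow> 'a \<Rightarrow> real"
  assumes I: "finite I" and c: "\<And>i. i \<in> I \<Longrightarrow> integrable M (c i)"
    and s: "integrable M (\<lambda>x. sqrt (\<Sum>i\<in>I. (c i x)\<^sup>2))"
  shows "sqrt (\<Sum>i\<in>I. (\<integral>x. c i x \<partial>M)\<^sup>2) \<le> (\<integral>x. sqrt (\<Sum>i\<in>I. (c i x)\<^sup>2) \<partial>M)"
proof -
  define m where "m = (\<lambda>i. \<integral>x. c i x \<partial>M)"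
  define N where "N = sqrt (\<Sum>i\<in>I. (m i)\<^sup>2)"
  have nn: "0 \<le> (\<Sum>i\<in>I. (m i)\<^sup>2)" by (intro sum_nonneg) auto
  have "N * N = (\<Sum>i\<in>I. m i * (\<integral>x. c i x \<partial>M))"
    using nn by (simp add: N_def m_def power2_eq_square)
  also have "\<dots> = (\<integral>x. (\<Sum>i\<in>I. m i * c i x) \<partial>M)"
    using c by (simp add: Bochner_Integration.integral_sum)
  also have "\<dots> \<le> (\<integral>x. N * sqrt (\<Sum>i\<in>I. (c i x)\<^sup>2) \<partial>M)"
  proof (rule integral_mono)
    show "integrable M (\<lambda>x. \<Sum>i\<in>I. m i * c i x)" using c by auto
    show "integrable M (\<lambda>x. N * sqrt (\<Sum>i\<in>I. (c i x)\<^sup>2))" using s by auto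
    fix x
    have "(\<Sum>i\<in>I. m i * c i x)\<^sup>2 \<le> (\<Sum>i\<in>I. (m i)\<^sup>2) * (\<Sum>i\<in>I. (c i x)\<^sup>2)"
      by (rule Cauchy_Schwarz_ineq_sum)
    then have "\<bar>\<Sum>i\<in>I. m i * c i x\<bar> \<le> sqrt ((\<Sum>i\<in>I. (m i)\<^sup>2) * (\<Sum>i\<in>I. (c i x)\<^sup>2))"
      using real_sqrt_le_mono by fastforce
    then show "(\<Sum>i\<in>I. m i * c i x) \<le> N * sqrt (\<Sum>i\<in>I. (c i x)\<^sup>2)"
      by (simp add: N_def real_sqrt_mult)
  qed
  finally have *: "N * N \<le> N * (\<integral>x. sqrt (\<Sum>i\<in>I. (c i x)\<^sup>2) \<partial>M)" by simp
  show ?thesis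
  proof (cases "N = 0")
    case True
    then show ?thesis unfolding N_def m_def by (simp add: sum_nonneg)
  next
    case False
    moreover have "0 \<le> N" using nn by (simp add: N_def)
    ultimately have "N \<le> (\<integral>x. sqrt (\<Sum>i\<in>I. (c i x)\<^sup>2) \<partial>M)" using * by simp
    then show ?thesis by (simp add: N_def m_def)
  qed
qed

text \<open>The profile is known to be continuous only on the open unit interval, so measurability
  goes through the space restricted to it.\<close>

lemma measurable_gauss_profile:
  assumes "f \<in> borel_measurable M" "\<And>x. x \<in> space M \<Longrightarrow> 0 < f x \<and> f x < 1"
  shows "(\<lambda>x. gauss_profile (f x)) \<in> borel_measurable M"
proof -
  have "continuous_on {0<..<1} gauss_profile"
    using isCont_gauss_profile by (auto intro!: continuous_at_imp_continuous_on)
  then have "gauss_profile \<in> borel_measurable (restrict_space borel {0<..<1})"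
    by (rule borel_measurable_continuous_on_restrict)
  moreover have "f \<in> M \<rightarrow>\<^sub>M restrict_space borel {0<..<1}"
    using assms by (intro measurable_restrict_space2) auto
  ultimately show ?thesis using measurable_compose by blast
qed

section \<open>Finite powers of a probability measure on the line\<close>

locale real_prob_power = U: prob_space U for U :: "real measure" +
  assumes sets_U [measurable_cong, simp]: "sets U = sets borel"
begin

abbreviation PU :: "'i set \<Rightarrow> ('i \<Rightarrow> real) measure" where
  "PU I \<equiv> PiM I (\<lambda>_. U)"

lemma space_U [simp]: "space U = UNIV"
  using sets_eq_imp_space_eq[OF sets_U] by simp

lemma product_prob_space_U: "product_prob_space (\<lambda>_. U)"
  by (simp add: product_prob_space_def product_prob_space_axioms_def product_sigma_finite_def
      U.sigma_finite_measure_axioms U.prob_space_axioms)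

lemma prob_space_PU: "prob_space (PU I)"
proof -
  interpret product_prob_space "\<lambda>_. U" I by (rule product_prob_space_U)
  show ?thesis by (rule P.prob_space_axioms)
qed

text \<open>As \<open>space U\<close> is the whole line, any real may be put into a coordinate, even
  where \<open>U\<close> is concentrated on an interval. The increments in the remainder bounds rely
  on this.\<close>

lemma space_PU_upd: "x \<in> space (PU I) \<Longrightarrow> x(i := y) \<in> space (PU (insert i I))"
  by (auto simp: space_PiM PiE_iff extensional_def)

lemma space_PU_upd_in: "x \<in> space (PU I) \<Longrightarrow> i \<in> I \<Longrightarrow> x(i := y) \<in> space (PU I)"
  by (auto simp: space_PiM PiE_iff extensional_def)

lemma measurable_section:
  assumes "f \<in> borel_measurable (PU (insert i J))" "i \<notin> J" "x \<in> space (PU J)"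
  shows "(\<lambda>y. f (x(i := y))) \<in> borel_measurable U"
  using assms by (intro measurable_compose[OF measurable_component_update])

lemma measurable_section_integral:
  fixes f :: "_ \<Rightarrow> real"
  assumes "f \<in> borel_measurable (PU (insert i J))"
  shows "(\<lambda>x. \<integral>y. f (x(i := y)) \<partial>U) \<in> borel_measurable (PU J)"
proof -
  have "(\<lambda>p. f (case p of (x, y) \<Rightarrow> x(i := y))) \<in> borel_measurable (PU J \<Otimes>\<^sub>M U)"
    by (rule measurable_compose[OF measurable_add_dim assms])
  then have "case_prod (\<lambda>x y. f (x(i := y))) \<in> borel_measurable (PU J \<Otimes>\<^sub>M U)"
    by (simp add: case_prod_unfold)
  then show ?thesis by (rule U.borel_measurable_lebesgue_integral)
qed

lemma integral_PU_insert:
  fixes f :: "_ \<Rightarrow> real"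
  assumes "finite J" "i \<notin> J" "f \<in> borel_measurable (PU (insert i J))"
    and "\<And>x. x \<in> space (PU (insert i J)) \<Longrightarrow> \<bar>f x\<bar> \<le> c"
  shows "(\<integral>x. f x \<partial>PU (insert i J)) = (\<integral>x. (\<integral>y. f (x(i := y)) \<partial>U) \<partial>PU J)"
proof -
  interpret product_prob_space "\<lambda>_. U" "insert i J" by (rule product_prob_space_U)
  interpret P: prob_space "PU (insert i J)" by (rule prob_space_PU)
  show ?thesis
    using assms by (intro product_integral_insert P.integrable_const_bound[of _ c]) auto
qed

text \<open>Integrating out the coordinate \<open>i\<close> turns \<open>f\<close> and the other
  derivatives into averages \<open>g\<close> and \<open>W j\<close>, which satisfy the same bounds
  because a remainder estimate can be averaged over \<open>y\<close>. The induction hypothesis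
  handles \<open>g\<close>; for fixed \<open>x\<close> the one-dimensional inequality in
  \<open>y\<close> bounds the profile of \<open>g x\<close>, and the triangle inequality for
  integrals restores the remaining gradient terms.\<close>

theorem bobkov_tensor:
  assumes "bobkov1 \<kappa> U" "0 \<le> \<kappa>" "finite I"
    and "f \<in> borel_measurable (PU I)" "\<And>j. j \<in> I \<Longrightarrow> V j \<in> borel_measurable (PU I)"
    and "0 < \<eta>" "\<And>x. x \<in> space (PU I) \<Longrightarrow> \<eta> \<le> f x \<and> f x \<le> 1 - \<eta>"
    and "\<And>j x. j \<in> I \<Longrightarrow> x \<in> space (PU I) \<Longrightarrow> \<bar>V j x\<bar> \<le> B"
    and "\<And>j x h. j \<in> I \<Longrightarrow> x \<in> space (PU I) \<Longrightarrow> \<bar>f (x(j := x j + h)) - f x - h * V j x\<bar> \<le> K * h\<^sup>2"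
  shows "gauss_profile (\<integral>x. f x \<partial>PU I)
    \<le> (\<integral>x. sqrt ((gauss_profile (f x))\<^sup>2 + \<kappa> * (\<Sum>j\<in>I. (V j x)\<^sup>2)) \<partial>PU I)"
  using assms(3-)
proof (induction I arbitrary: f V rule: finite_induct)
  case empty
  show ?case
    using gauss_profile_pos by (simp add: PiM_empty lebesgue_integral_count_space_finite less_imp_le)
next
  case (insert i J)
  note fm = insert.prems(1) and Vm = insert.prems(2) and \<eta> = insert.prems(3)
    and fb = insert.prems(4) and Vb = insert.prems(5) and fV = insert.prems(6)
  interpret PJ: prob_space "PU J" by (rule prob_space_PU)
  let ?S = "space (PU J)"
  define g where "g = (\<lambda>x. \<integral>y. f (x(i := y)) \<partial>U)"
  define W where "W = (\<lambda>j x. \<integral>y. V j (x(i := y)) \<partial>U)"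
  define F where "F = (\<lambda>x. sqrt ((gauss_profile (f x))\<^sup>2 + \<kappa> * (\<Sum>j\<in>insert i J. (V j x)\<^sup>2)))"
  have f01: "0 < f x \<and> f x < 1" if "x \<in> space (PU (insert i J))" for x
    using fb[OF that] \<eta> by linarith
  have f_int: "integrable U (\<lambda>y. f (x(i := y)))" if "x \<in> ?S" for x
  proof (rule U.integrable_const_bound[of _ 1])
    show "AE y in U. norm (f (x(i := y))) \<le> 1"
    proof (rule AE_I2)
      fix y show "norm (f (x(i := y))) \<le> 1"
        using f01[OF space_PU_upd[OF that, of i y]] by simp
    qed
  qed (rule measurable_section[OF fm insert.hyps(2) that])
  have V_int: "integrable U (\<lambda>y. V j (x(i := y)))" if "x \<in> ?S" "j \<in> insert i J" for x j
    by (rule U.integrable_const_bound[of _ B, OF AE_I2])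
       (simp add: Vb[OF that(2) space_PU_upd[OF that(1)]],
        rule measurable_section[OF Vm[OF that(2)] insert.hyps(2) that(1)])
  have Pm: "(\<lambda>x. gauss_profile (f x)) \<in> borel_measurable (PU (insert i J))"
    using fm f01 by (rule measurable_gauss_profile)
  have Fm: "F \<in> borel_measurable (PU (insert i J))"
  proof -
    have "(\<lambda>x. \<Sum>j\<in>insert i J. (V j x)\<^sup>2) \<in> borel_measurable (PU (insert i J))"
      by (intro borel_measurable_sum borel_measurable_power Vm)
    then show ?thesis unfolding F_def using Pm by measurable
  qed
  define CF where "CF = sqrt (1 + \<kappa> * (\<Sum>j\<in>insert i J. B\<^sup>2))"
  have Fb: "\<bar>F x\<bar> \<le> CF" if "x \<in> space (PU (insert i J))" for x
  proof -
    have "(gauss_profile (f x))\<^sup>2 \<le> 1"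
      using gauss_profile_le_1[of "f x"] gauss_profile_pos[of "f x"] by (simp add: power_le_one)
    moreover have "(\<Sum>j\<in>insert i J. (V j x)\<^sup>2) \<le> (\<Sum>j\<in>insert i J. B\<^sup>2)"
    proof (rule sum_mono)
      fix j assume "j \<in> insert i J"
      then show "(V j x)\<^sup>2 \<le> B\<^sup>2"
        using Vb[OF _ that, of j] by (metis power2_abs power_mono abs_ge_zero)
    qed
    ultimately have "(gauss_profile (f x))\<^sup>2 + \<kappa> * (\<Sum>j\<in>insert i J. (V j x)\<^sup>2)
        \<le> 1 + \<kappa> * (\<Sum>j\<in>insert i J. B\<^sup>2)"
      using assms(2) by (intro add_mono mult_left_mono)
    moreover have "0 \<le> (gauss_profile (f x))\<^sup>2 + \<kappa> * (\<Sum>j\<in>insert i J. (V j x)\<^sup>2)"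
      using assms(2) by (intro add_nonneg_nonneg mult_nonneg_nonneg sum_nonneg) auto
    ultimately show ?thesis by (simp add: F_def CF_def)
  qed
  have F_int: "integrable U (\<lambda>y. F (x(i := y)))" if "x \<in> ?S" for x
    by (rule U.integrable_const_bound[of _ CF])
       (use measurable_section[OF Fm insert.hyps(2) that] Fb[OF space_PU_upd[OF that]] in auto)
  have gm: "g \<in> borel_measurable (PU J)"
    unfolding g_def by (rule measurable_section_integral[OF fm])
  have Wm: "W j \<in> borel_measurable (PU J)" if "j \<in> J" for j
    unfolding W_def using that by (intro measurable_section_integral Vm) simp
  have gb: "\<eta> \<le> g x \<and> g x \<le> 1 - \<eta>" if "x \<in> ?S" for x
    unfolding g_def
    by (intro conjI U.integral_ge_const U.integral_le_const f_int[OF that] AE_I2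
        conjunct1[OF fb[OF space_PU_upd[OF that]]] conjunct2[OF fb[OF space_PU_upd[OF that]]])
  have Wb: "\<bar>W j x\<bar> \<le> B" if "j \<in> J" "x \<in> ?S" for j x
    unfolding W_def using Vb space_PU_upd[OF that(2)] that(1)
    by (intro U.abs_integral_le_const) auto
  have gW: "\<bar>g (x(j := x j + h)) - g x - h * W j x\<bar> \<le> K * h\<^sup>2" if j: "j \<in> J" and x: "x \<in> ?S" for j x h
  proof -
    have ji: "j \<noteq> i" using j insert.hyps(2) by auto
    have "g (x(j := x j + h)) - g x - h * W j x
      = (\<integral>y. f ((x(j := x j + h))(i := y)) - f (x(i := y)) - h * V j (x(i := y)) \<partial>U)"
      unfolding g_def W_def using f_int[OF x] f_int[OF space_PU_upd_in[OF x j]] V_int[OF x, of j] j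
      by simp
    also have "\<bar>\<dots>\<bar> \<le> K * h\<^sup>2"
    proof (rule U.abs_integral_le_const)
      fix y
      have eq: "(x(j := x j + h))(i := y) = (x(i := y))(j := (x(i := y)) j + h)"
        using ji by (auto simp: fun_eq_iff)
      show "\<bar>f ((x(j := x j + h))(i := y)) - f (x(i := y)) - h * V j (x(i := y))\<bar> \<le> K * h\<^sup>2"
        unfolding eq by (rule fV[OF _ space_PU_upd[OF x]]) (use j in simp)
    qed
    finally show ?thesis .
  qed
  have "gauss_profile (\<integral>x. f x \<partial>PU (insert i J)) = gauss_profile (\<integral>x. g x \<partial>PU J)"
    unfolding g_def using f01 by (subst integral_PU_insert[OF insert.hyps fm, of 1]) force+
  also have "\<dots> \<le> (\<integral>x. sqrt ((gauss_profile (g x))\<^sup>2 + \<kappa> * (\<Sum>j\<in>J. (W j x)\<^sup>2)) \<partial>PU J)"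
    by (rule insert.IH[OF gm Wm \<eta> gb Wb gW])
  also have "\<dots> \<le> (\<integral>x. (\<integral>y. F (x(i := y)) \<partial>U) \<partial>PU J)"
  proof (rule integral_mono_AE')
    show "integrable (PU J) (\<lambda>x. \<integral>y. F (x(i := y)) \<partial>U)"
      by (rule PJ.integrable_const_bound[of _ CF])
         (use measurable_section_integral[OF Fm] in
           \<open>auto intro!: U.abs_integral_le_const Fb space_PU_upd\<close>)
    show "AE x in PU J. 0 \<le> (\<integral>y. F (x(i := y)) \<partial>U)"
      using assms(2) unfolding F_def
      by (intro AE_I2 Bochner_Integration.integral_nonneg real_sqrt_ge_zero add_nonneg_nonneg
          mult_nonneg_nonneg sum_nonneg zero_le_power2)
    show "AE x in PU J. sqrt ((gauss_profile (g x))\<^sup>2 + \<kappa> * (\<Sum>j\<in>J. (W j x)\<^sup>2)) \<le> (\<integral>y. F (x(i := y)) \<partial>U)"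
    proof (rule AE_I2)
      fix x assume x: "x \<in> ?S"
      define a where "a = (\<lambda>y. sqrt ((gauss_profile (f (x(i := y))))\<^sup>2 + \<kappa> * (V i (x(i := y)))\<^sup>2))"
      \<comment> \<open>The vector has the one-dimensional integrand \<open>a\<close> in slot
        \<open>i\<close> and the scaled derivatives elsewhere. Its length at \<open>y\<close> is
        \<open>F (x(i := y))\<close>, and the length of its integral dominates the integrand
        supplied by the induction hypothesis.\<close>
      define c where "c = (\<lambda>j y. if j = i then a y else sqrt \<kappa> * V j (x(i := y)))"
      have "quad_approx K (\<lambda>y. f (x(i := y))) (\<lambda>y. V i (x(i := y)))"
        unfolding quad_approx_def
      proof (intro allI)
        fix y h
        have eq: "(x(i := y))(i := (x(i := y)) i + h) = x(i := y + h)" by simp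
        show "\<bar>f (x(i := y + h)) - f (x(i := y)) - h * V i (x(i := y))\<bar> \<le> K * h\<^sup>2"
          using fV[OF insertI1 space_PU_upd[OF x, of i y], of h] unfolding eq .
      qed
      then have ga: "gauss_profile (g x) \<le> (\<integral>y. a y \<partial>U)"
        unfolding g_def a_def
        using assms(1)[unfolded bobkov1_def, rule_format, of K "\<lambda>y. f (x(i := y))" "\<lambda>y. V i (x(i := y))" B \<eta>]
          Vb[OF insertI1 space_PU_upd[OF x]] \<eta> fb[OF space_PU_upd[OF x]] by blast
      have a_int: "integrable U a"
      proof (rule U.integrable_const_bound[of _ "sqrt (1 + \<kappa> * B\<^sup>2)"])
        show "AE y in U. norm (a y) \<le> sqrt (1 + \<kappa> * B\<^sup>2)"
          unfolding a_def real_norm_def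
          using Vb[OF insertI1 space_PU_upd[OF x]] assms(2) by (intro AE_I2 sqrt_gauss_profile_bound)
        show "a \<in> borel_measurable U"
          unfolding a_def using measurable_section[OF Pm insert.hyps(2) x]
            measurable_section[OF Vm[OF insertI1] insert.hyps(2) x]
          by measurable
      qed
      have c_int: "integrable U (c j)" if "j \<in> insert i J" for j
        using a_int V_int[OF x that] by (cases "j = i") (auto simp: c_def)
      have cF: "sqrt (\<Sum>j\<in>insert i J. (c j y)\<^sup>2) = F (x(i := y))" for y
      proof -
        have "(\<Sum>j\<in>insert i J. (c j y)\<^sup>2) = (a y)\<^sup>2 + (\<Sum>j\<in>J. (c j y)\<^sup>2)"
          using insert.hyps by (simp add: c_def)
        also have "(\<Sum>j\<in>J. (c j y)\<^sup>2) = (\<Sum>j\<in>J. \<kappa> * (V j (x(i := y)))\<^sup>2)"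
          using insert.hyps(2) assms(2)
          by (intro sum.cong) (auto simp: c_def power_mult_distrib)
        finally show ?thesis
          using insert.hyps assms(2)
          by (simp add: F_def a_def sum_distrib_left distrib_left add.assoc)
      qed
      have c_eq: "(\<Sum>j\<in>insert i J. (\<integral>y. c j y \<partial>U)\<^sup>2) = (\<integral>y. a y \<partial>U)\<^sup>2 + \<kappa> * (\<Sum>j\<in>J. (W j x)\<^sup>2)"
      proof -
        have "(\<Sum>j\<in>insert i J. (\<integral>y. c j y \<partial>U)\<^sup>2) = (\<integral>y. a y \<partial>U)\<^sup>2 + (\<Sum>j\<in>J. (\<integral>y. c j y \<partial>U)\<^sup>2)"
          using insert.hyps by (simp add: c_def)
        also have "(\<Sum>j\<in>J. (\<integral>y. c j y \<partial>U)\<^sup>2) = (\<Sum>j\<in>J. \<kappa> * (W j x)\<^sup>2)"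
        proof (rule sum.cong[OF refl])
          fix j assume "j \<in> J"
          then have "j \<noteq> i" using insert.hyps(2) by auto
          then show "(\<integral>y. c j y \<partial>U)\<^sup>2 = \<kappa> * (W j x)\<^sup>2"
            using assms(2) by (simp add: c_def W_def power_mult_distrib)
        qed
        finally show ?thesis by (simp add: sum_distrib_left)
      qed
      have "(gauss_profile (g x))\<^sup>2 \<le> (\<integral>y. a y \<partial>U)\<^sup>2"
        using ga gauss_profile_pos[of "g x"] by (intro power_mono) auto
      then have "sqrt ((gauss_profile (g x))\<^sup>2 + \<kappa> * (\<Sum>j\<in>J. (W j x)\<^sup>2))
        \<le> sqrt (\<Sum>j\<in>insert i J. (\<integral>y. c j y \<partial>U)\<^sup>2)"
        unfolding c_eq by simp
      also have "\<dots> \<le> (\<integral>y. sqrt (\<Sum>j\<in>insert i J. (c j y)\<^sup>2) \<partial>U)"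
        using insert.hyps(1) c_int F_int[OF x] by (intro Minkowski_integral) (auto simp: cF simp del: sum.insert)
      finally show "sqrt ((gauss_profile (g x))\<^sup>2 + \<kappa> * (\<Sum>j\<in>J. (W j x)\<^sup>2)) \<le> (\<integral>y. F (x(i := y)) \<partial>U)"
        unfolding cF .
    qed
  qed
  also have "\<dots> = (\<integral>x. F x \<partial>PU (insert i J))"
    by (rule integral_PU_insert[OF insert.hyps Fm Fb, symmetric])
  finally show ?case by (simp only: F_def)
qed

text \<open>Hoeffding's lemma, integrating out one coordinate at a time.\<close>

theorem mcdiarmid_mgf:
  assumes "finite I" "l > 0"
    and "g \<in> borel_measurable (PU I)" "\<And>x. x \<in> space (PU I) \<Longrightarrow> \<bar>g x\<bar> \<le> C"
    and "\<And>x j y. x \<in> space (PU I) \<Longrightarrow> j \<in> I \<Longrightarrow> \<bar>g (x(j := y)) - g x\<bar> \<le> 1"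
  shows "(\<integral>x. exp (l * g x) \<partial>PU I) \<le> exp (l * (\<integral>x. g x \<partial>PU I) + l\<^sup>2 * real (card I) / 8)"
  using assms(1,3-)
proof (induction I arbitrary: g rule: finite_induct)
  case empty
  show ?case by (simp add: PiM_empty lebesgue_integral_count_space_finite)
next
  case (insert i J)
  note gm = insert.prems(1) and gb = insert.prems(2) and gd = insert.prems(3)
  interpret PJ: prob_space "PU J" by (rule prob_space_PU)
  let ?S = "space (PU J)"
  define G where "G = (\<lambda>x. \<integral>y. g (x(i := y)) \<partial>U)"
  have em: "(\<lambda>x. exp (l * g x)) \<in> borel_measurable (PU (insert i J))"
    using gm by measurable
  have eb: "\<bar>exp (l * g x)\<bar> \<le> exp (l * C)" if "x \<in> space (PU (insert i J))" for x
    using abs_le_D1[OF gb[OF that]] assms(2) by simp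
  have g_int: "integrable U (\<lambda>y. g (x(i := y)))" if "x \<in> ?S" for x
    by (rule U.integrable_const_bound[of _ C, OF AE_I2])
       (simp add: gb[OF space_PU_upd[OF that]], rule measurable_section[OF gm insert.hyps(2) that])
  have Gm: "G \<in> borel_measurable (PU J)"
    unfolding G_def by (rule measurable_section_integral[OF gm])
  have Gb: "\<bar>G x\<bar> \<le> C" if "x \<in> ?S" for x
    unfolding G_def using gb space_PU_upd[OF that] by (intro U.abs_integral_le_const) auto
  have Gd: "\<bar>G (x(j := y)) - G x\<bar> \<le> 1" if x: "x \<in> ?S" and j: "j \<in> J" for x j y
  proof -
    have ji: "j \<noteq> i" using j insert.hyps(2) by auto
    have "G (x(j := y)) - G x = (\<integral>z. g ((x(j := y))(i := z)) - g (x(i := z)) \<partial>U)"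
      unfolding G_def using g_int[OF x] g_int[OF space_PU_upd_in[OF x j]] by simp
    also have "\<bar>\<dots>\<bar> \<le> 1"
    proof (rule U.abs_integral_le_const)
      fix z
      have eq: "(x(j := y))(i := z) = (x(i := z))(j := y)" using ji by (auto simp: fun_eq_iff)
      show "\<bar>g ((x(j := y))(i := z)) - g (x(i := z))\<bar> \<le> 1"
        unfolding eq by (rule gd[OF space_PU_upd[OF x]]) (use j in simp)
    qed
    finally show ?thesis .
  qed
  have inner: "(\<integral>y. exp (l * g (x(i := y))) \<partial>U) \<le> exp (l\<^sup>2 / 8) * exp (l * G x)" if x: "x \<in> ?S" for x
  proof -
    \<comment> \<open>Changing coordinate \<open>i\<close> moves \<open>g\<close> by at most 1, so
      the section lies in the unit-length interval above its infimum. Hoeffding's lemma for such an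
      interval gives the factor \<open>exp (l^2 / 8)\<close>.\<close>
    define a where "a = (INF y. g (x(i := y)))"
    have bdd: "bdd_below (range (\<lambda>y. g (x(i := y))))"
    proof (rule bdd_belowI)
      fix v assume "v \<in> range (\<lambda>y. g (x(i := y)))"
      then obtain y where v: "v = g (x(i := y))" by (rule rangeE)
      show "- C \<le> v"
        using gb[OF space_PU_upd[OF x, of i y]] unfolding v by linarith
    qed
    have lower: "a \<le> g (x(i := y))" for y
      unfolding a_def using bdd by (intro cINF_lower) auto
    have upper: "g (x(i := y)) \<le> a + 1" for y
    proof -
      have "g (x(i := y)) - 1 \<le> a"
        unfolding a_def
      proof (rule cINF_greatest)
        fix z
        show "g (x(i := y)) - 1 \<le> g (x(i := z))"
        proof -
          have "\<bar>g ((x(i := z))(i := y)) - g (x(i := z))\<bar> \<le> 1"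
            by (rule gd[OF space_PU_upd[OF x]]) simp
          then show ?thesis unfolding fun_upd_upd abs_le_iff by linarith
        qed
      qed simp
      then show ?thesis by simp
    qed
    interpret X: interval_bounded_random_variable U "\<lambda>y. g (x(i := y))" a "a + 1"
    proof unfold_locales
      show "(\<lambda>y. g (x(i := y))) \<in> borel_measurable U"
        by (rule measurable_section[OF gm insert.hyps(2) x])
      show "AE y in U. g (x(i := y)) \<in> {a..a + 1}"
        by (rule AE_I2) (simp only: atLeastAtMost_iff lower upper simp_thms)
    qed
    have 1: "(\<integral>\<^sup>+y. exp (l * (g (x(i := y)) - G x)) \<partial>U) \<le> ennreal (exp (l\<^sup>2 / 8))"
      using X.Hoeffdings_lemma_nn_integral[OF assms(2)] by (simp add: G_def)
    have m: "(\<lambda>y. exp (l * (g (x(i := y)) - G x))) \<in> borel_measurable U"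
      using X.random_variable by measurable
    have "(\<integral>y. exp (l * (g (x(i := y)) - G x)) \<partial>U) = enn2real (\<integral>\<^sup>+y. exp (l * (g (x(i := y)) - G x)) \<partial>U)"
      using m by (intro integral_eq_nn_integral) auto
    also have "\<dots> \<le> exp (l\<^sup>2 / 8)"
      using enn2real_mono[OF 1] by simp
    finally have "(\<integral>y. exp (l * (g (x(i := y)) - G x)) \<partial>U) * exp (l * G x) \<le> exp (l\<^sup>2 / 8) * exp (l * G x)"
      by (rule mult_right_mono) simp
    also have "(\<integral>y. exp (l * (g (x(i := y)) - G x)) \<partial>U) * exp (l * G x) = (\<integral>y. exp (l * g (x(i := y))) \<partial>U)"
    proof -
      have "exp (l * (u - G x)) * exp (l * G x) = exp (l * u)" for u
        by (simp add: mult_exp_exp right_diff_distrib)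
      then show ?thesis
        by (subst Bochner_Integration.integral_mult_left_zero[symmetric]) simp
    qed
    finally show ?thesis .
  qed
  have "(\<integral>x. exp (l * g x) \<partial>PU (insert i J)) = (\<integral>x. (\<integral>y. exp (l * g (x(i := y))) \<partial>U) \<partial>PU J)"
    by (rule integral_PU_insert[OF insert.hyps em eb])
  also have "\<dots> \<le> (\<integral>x. exp (l\<^sup>2 / 8) * exp (l * G x) \<partial>PU J)"
  proof (rule integral_mono_AE')
    show "integrable (PU J) (\<lambda>x. exp (l\<^sup>2 / 8) * exp (l * G x))"
    proof (intro integrable_mult_right PJ.integrable_const_bound[of _ "exp (l * C)"])
      show "AE x in PU J. norm (exp (l * G x)) \<le> exp (l * C)"
        using abs_le_D1[OF Gb] assms(2) by (intro AE_I2) simp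
      show "(\<lambda>x. exp (l * G x)) \<in> borel_measurable (PU J)" using Gm by measurable
    qed
    show "AE x in PU J. (\<integral>y. exp (l * g (x(i := y))) \<partial>U) \<le> exp (l\<^sup>2 / 8) * exp (l * G x)"
      by (rule AE_I2) (rule inner)
  qed simp
  also have "\<dots> = exp (l\<^sup>2 / 8) * (\<integral>x. exp (l * G x) \<partial>PU J)" by simp
  also have "\<dots> \<le> exp (l\<^sup>2 / 8) * exp (l * (\<integral>x. G x \<partial>PU J) + l\<^sup>2 * real (card J) / 8)"
    by (intro mult_left_mono insert.IH Gm Gb Gd) auto
  also have "(\<integral>x. G x \<partial>PU J) = (\<integral>x. g x \<partial>PU (insert i J))"
    unfolding G_def by (rule integral_PU_insert[OF insert.hyps gm gb, symmetric])
  also have "exp (l\<^sup>2 / 8) * exp (l * (\<integral>x. g x \<partial>PU (insert i J)) + l\<^sup>2 * real (card J) / 8)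
    = exp (l * (\<integral>x. g x \<partial>PU (insert i J)) + l\<^sup>2 * real (card (insert i J)) / 8)"
  proof -
    have "l\<^sup>2 / 8 + (X + l\<^sup>2 * real (card J) / 8) = X + l\<^sup>2 * real (card (insert i J)) / 8" for X
      using insert.hyps by (simp add: field_simps)
    then show ?thesis unfolding mult_exp_exp by simp
  qed
  finally show ?case .
qed

end

section \<open>Isoperimetry in the unit cube\<close>

interpretation unif01: real_prob_power unif01
  by (simp add: real_prob_power_def real_prob_power_axioms_def prob_space_unif01)

section \<open>The cube as a product of intervals\<close>

definition of_coords :: "('a::euclidean_space \<Rightarrow> real) \<Rightarrow> 'a" where
  "of_coords x = (\<Sum>b\<in>Basis. x b *\<^sub>R b)"

abbreviation unif_cube :: "'a::euclidean_space measure" where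
  "unif_cube \<equiv> uniform_measure lborel (cbox 0 One)"

lemma of_coords_inner: "b \<in> Basis \<Longrightarrow> of_coords x \<bullet> b = x b"
  by (simp add: of_coords_def inner_sum_left inner_Basis if_distrib sum.delta cong: if_cong)

lemma of_coords_upd: "b \<in> Basis \<Longrightarrow> of_coords (x(b := y)) = of_coords x + (y - x b) *\<^sub>R b"
  by (rule euclidean_eqI) (auto simp: of_coords_inner inner_add_left inner_Basis)

lemma measurable_of_coords [measurable]:
  "of_coords \<in> borel_measurable (unif01.PU (Basis :: 'a::euclidean_space set))"
  unfolding of_coords_def by measurable

lemma prob_space_unif_cube: "prob_space (unif_cube :: 'a::euclidean_space measure)"
  by (rule prob_space_uniform_measure) (auto simp: emeasure_lborel_cbox)

text \<open>Lebesgue measure is the image of the product of the one-dimensional Lebesgue measures.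
  Normalised restriction to the box of unit intervals yields the product of the uniform measures, as
  comparison on product sets shows, and that box corresponds to the cube.\<close>

lemma distr_of_coords:
  "distr (unif01.PU Basis) borel of_coords = (unif_cube :: 'a::euclidean_space measure)"
proof -
  interpret L: product_sigma_finite "\<lambda>_::'a. lborel :: real measure"
    by (simp add: product_sigma_finite_def sigma_finite_lborel)
  interpret P: product_sigma_finite "\<lambda>_::'a. unif01"
    using unif01.product_prob_space_U unfolding product_prob_space_def by blast
  let ?L = "PiM (Basis :: 'a set) (\<lambda>_. lborel :: real measure)"
  let ?C = "PiE (Basis :: 'a set) (\<lambda>_. {0..1::real})"
  have C: "?C \<in> sets ?L" by (intro sets_PiM_I_finite) auto
  have C1: "emeasure ?L ?C = 1" by (subst L.emeasure_PiM) auto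
  have eq: "uniform_measure ?L ?C = unif01.PU Basis"
  proof (rule P.PiM_eqI)
    fix A :: "'a \<Rightarrow> real set"
    assume "\<And>i. i \<in> Basis \<Longrightarrow> A i \<in> sets unif01"
    then have A: "\<And>i. i \<in> Basis \<Longrightarrow> A i \<in> sets borel" by simp
    have "emeasure (uniform_measure ?L ?C) (PiE Basis A) = emeasure ?L (?C \<inter> PiE Basis A) / emeasure ?L ?C"
      using C A by (intro emeasure_uniform_measure sets_PiM_I_finite) auto
    also have "?C \<inter> PiE Basis A = PiE Basis (\<lambda>i. {0..1} \<inter> A i)"
      by (auto simp: PiE_iff)
    also have "emeasure ?L (PiE Basis (\<lambda>i. {0..1} \<inter> A i)) = (\<Prod>i\<in>Basis. emeasure lborel ({0..1} \<inter> A i))"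
      using A by (intro L.emeasure_PiM) auto
    also have "\<dots> / emeasure ?L ?C = (\<Prod>i\<in>Basis. emeasure unif01 (A i))"
      using A unfolding C1 by (simp add: divide_ennreal_def cong: prod.cong)
    finally show "emeasure (uniform_measure ?L ?C) (PiE Basis A) = (\<Prod>i\<in>Basis. emeasure unif01 (A i))" .
  qed (auto intro!: sets_PiM_cong)
  have m: "of_coords \<in> ?L \<rightarrow>\<^sub>M (borel :: 'a measure)"
    unfolding of_coords_def by measurable
  have lb: "(lborel :: 'a measure) = distr ?L borel of_coords"
    unfolding of_coords_def by (rule lborel_eq)
  show ?thesis
  proof (rule measure_eqI)
    fix A assume "A \<in> sets (distr (unif01.PU Basis) borel (of_coords :: _ \<Rightarrow> 'a))"
    then have A: "A \<in> sets (borel :: 'a measure)" by simp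
    have pre: "of_coords -` A \<inter> space ?L \<in> sets ?L"
      using m A by (rule measurable_sets)
    have "emeasure (distr (unif01.PU Basis) borel of_coords) A
      = emeasure (unif01.PU Basis) (of_coords -` A \<inter> space (unif01.PU Basis))"
      using A by (intro emeasure_distr) auto
    also have "\<dots> = emeasure (uniform_measure ?L ?C) (of_coords -` A \<inter> space ?L)"
      unfolding eq[symmetric] by simp
    also have "\<dots> = emeasure ?L (?C \<inter> (of_coords -` A \<inter> space ?L))"
      using C pre C1 by (subst emeasure_uniform_measure) (auto simp: divide_ennreal_def)
    also have "?C \<inter> (of_coords -` A \<inter> space ?L) = of_coords -` (cbox 0 One \<inter> A) \<inter> space ?L"
      by (auto simp: space_PiM mem_box of_coords_inner PiE_iff)
    also have "emeasure ?L \<dots> = emeasure lborel (cbox 0 One \<inter> A)"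
      using A m by (subst lb, subst emeasure_distr) auto
    also have "\<dots> = emeasure unif_cube A"
      using A by (subst emeasure_uniform_measure) (auto simp: divide_ennreal_def emeasure_lborel_cbox)
    finally show "emeasure (distr (unif01.PU Basis) borel of_coords) A = emeasure unif_cube A" .
  qed simp
qed

text \<open>The components of \<open>V\<close> along the basis serve as coordinate derivatives, with
  \<open>w\<close> a multiple of one basis vector; the sum of their squares is the squared
  norm.\<close>

theorem bobkov_cube:
  fixes f :: "'a::euclidean_space \<Rightarrow> real" and V :: "'a \<Rightarrow> 'a"
  assumes \<eta>: "0 < \<eta>" "\<And>x. \<eta> \<le> f x \<and> f x \<le> 1 - \<eta>"
    and m: "f \<in> borel_measurable borel" "V \<in> borel_measurable borel"
    and V: "\<And>x. norm (V x) \<le> B"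
    and fV: "\<And>x w. \<bar>f (x + w) - f x - w \<bullet> V x\<bar> \<le> K * (norm w)\<^sup>2"
  shows "gauss_profile (\<integral>x. f x \<partial>unif_cube)
    \<le> (\<integral>x. sqrt ((gauss_profile (f x))\<^sup>2 + 1 / (2 * pi) * (norm (V x))\<^sup>2) \<partial>unif_cube)"
proof -
  let ?P = "unif01.PU (Basis :: 'a set)"
  have Pm: "(\<lambda>x. gauss_profile (f x)) \<in> borel_measurable borel"
  proof (intro measurable_gauss_profile m(1))
    fix x show "0 < f x \<and> f x < 1" using \<eta>(1) \<eta>(2)[of x] by auto
  qed
  have nrm: "(\<Sum>j\<in>Basis. (v \<bullet> j)\<^sup>2) = (norm v)\<^sup>2" for v :: 'a
    unfolding power2_norm_eq_inner euclidean_inner[of v v] by (simp add: power2_eq_square)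
  have "gauss_profile (\<integral>x. f (of_coords x) \<partial>?P)
    \<le> (\<integral>x. sqrt ((gauss_profile (f (of_coords x)))\<^sup>2
          + 1 / (2 * pi) * (\<Sum>j\<in>Basis. (V (of_coords x) \<bullet> j)\<^sup>2)) \<partial>?P)"
  proof (rule unif01.bobkov_tensor[OF bobkov1_unif01 _ finite_Basis])
    show "(\<lambda>x. f (of_coords x)) \<in> borel_measurable ?P"
      by (rule measurable_compose[OF measurable_of_coords m(1)])
    show "(\<lambda>x. V (of_coords x) \<bullet> j) \<in> borel_measurable ?P" for j
      using measurable_compose[OF measurable_of_coords m(2)] by measurable
    show "\<bar>V (of_coords x) \<bullet> j\<bar> \<le> B" if "j \<in> Basis" for x j
      using Basis_le_norm[OF that] V order_trans by blast
    show "\<bar>f (of_coords (x(j := x j + h))) - f (of_coords x) - h * (V (of_coords x) \<bullet> j)\<bar> \<le> K * h\<^sup>2"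
      if "j \<in> Basis" for x j h
      using fV[of "of_coords x" "h *\<^sub>R j"] that by (simp add: of_coords_upd inner_commute)
  qed (use \<eta> in auto)
  also have "\<dots> = (\<integral>x. sqrt ((gauss_profile (f (of_coords x)))\<^sup>2 + 1 / (2 * pi) * (norm (V (of_coords x)))\<^sup>2) \<partial>?P)"
    by (simp only: nrm)
  also have "(\<integral>x. f (of_coords x) \<partial>?P) = (\<integral>x. f x \<partial>unif_cube)"
    unfolding distr_of_coords[symmetric] using m(1) by (simp add: integral_distr)
  also have "(\<integral>x. sqrt ((gauss_profile (f (of_coords x)))\<^sup>2 + 1 / (2 * pi) * (norm (V (of_coords x)))\<^sup>2) \<partial>?P)
    = (\<integral>x. sqrt ((gauss_profile (f x))\<^sup>2 + 1 / (2 * pi) * (norm (V x))\<^sup>2) \<partial>unif_cube)"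
    unfolding distr_of_coords[symmetric] using m Pm by (intro integral_distr[symmetric]) auto
  finally show ?thesis .
qed

section \<open>Mollification of Lipschitz functions\<close>

lemma lborel_integral_reflect:
  fixes g :: "'a::euclidean_space \<Rightarrow> 'b::{banach, second_countable_topology}"
  assumes "g \<in> borel_measurable borel"
  shows "(\<integral>y. g (x - y) \<partial>lborel) = (\<integral>y. g y \<partial>lborel)"
proof -
  have "(lborel :: 'a measure) = distr lborel borel (\<lambda>y. x + (- 1) *\<^sub>R y)"
    by (subst lborel_affine[of "- 1" x]) (simp_all add: density_1)
  then have "(\<integral>y. g y \<partial>lborel) = (\<integral>y. g y \<partial>distr lborel borel (\<lambda>y. x + (- 1) *\<^sub>R y))"
    by simp
  also have "\<dots> = (\<integral>y. g (x - y) \<partial>lborel)"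
    using assms by (subst integral_distr) auto
  finally show ?thesis by simp
qed

text \<open>A polynomial kernel on the ball, cut off at its boundary. Squaring the positive part
  makes its gradient \<open>bump_grad\<close> Lipschitz, which is all the regularity that a
  quadratic remainder demands.\<close>

definition bump :: "real \<Rightarrow> 'a::euclidean_space \<Rightarrow> real" where
  "bump \<delta> z = (max 0 (\<delta>\<^sup>2 - (norm z)\<^sup>2))\<^sup>2"

definition bump_grad :: "real \<Rightarrow> 'a::euclidean_space \<Rightarrow> 'a" where
  "bump_grad \<delta> z = - (4 * max 0 (\<delta>\<^sup>2 - (norm z)\<^sup>2)) *\<^sub>R z"

lemma bump_measurable [measurable]:
  "bump \<delta> \<in> borel_measurable borel" "bump_grad \<delta> \<in> borel_measurable borel"
  unfolding bump_def bump_grad_def by measurable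

lemma bump_nonneg: "0 \<le> bump \<delta> z"
  by (simp add: bump_def)

lemma bump_outside:
  assumes "0 \<le> \<delta>" "\<delta> \<le> norm z"
  shows "bump \<delta> z = 0" "bump_grad \<delta> z = 0"
proof -
  have "\<delta>\<^sup>2 \<le> (norm z)\<^sup>2" using assms by (intro power_mono)
  then show "bump \<delta> z = 0" "bump_grad \<delta> z = 0" by (auto simp: bump_def bump_grad_def max_def)
qed

lemma bump_bounds:
  assumes "0 \<le> \<delta>" "\<delta> \<le> 1"
  shows "bump \<delta> z \<le> 1" "norm (bump_grad \<delta> z) \<le> 4"
proof -
  have m: "max 0 (\<delta>\<^sup>2 - (norm z)\<^sup>2) \<le> 1"
  proof -
    have "\<delta>\<^sup>2 - (norm z)\<^sup>2 \<le> 1"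
      using power_le_one[OF assms, of 2] zero_le_power2[of "norm z"] by linarith
    then show ?thesis by simp
  qed
  then show "bump \<delta> z \<le> 1" by (simp add: bump_def power_le_one)
  show "norm (bump_grad \<delta> z) \<le> 4"
  proof (cases "\<delta> \<le> norm z")
    case True then show ?thesis by (simp add: bump_outside(2)[OF assms(1)])
  next
    case False
    have "max 0 (\<delta>\<^sup>2 - (norm z)\<^sup>2) * norm z \<le> 1 * 1"
      using m False assms by (intro mult_mono) auto
    then show ?thesis by (simp add: bump_grad_def)
  qed
qed

text \<open>The squared positive part has the 2-Lipschitz derivative \<open>2 * max 0 s\<close>; the
  remainder is computed according to the signs of \<open>s\<close> and \<open>s + r\<close>.\<close>

lemma pos_part_sq_quad: "\<bar>(max 0 (s + r))\<^sup>2 - (max 0 s)\<^sup>2 - 2 * max 0 s * r\<bar> \<le> (r::real)\<^sup>2"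
proof -
  consider "0 \<le> s" "0 \<le> s + r" | "0 \<le> s" "s + r < 0" | "s < 0" "0 \<le> s + r" | "s < 0" "s + r < 0"
    by linarith
  then show ?thesis
  proof cases
    case 1
    then show ?thesis by (simp add: max_def power2_eq_square algebra_simps)
  next
    case 2
    have "s * (s + 2 * r) \<le> 0" using 2 by (intro mult_nonneg_nonpos) auto
    moreover have "0 \<le> (s + r)\<^sup>2" by simp
    ultimately show ?thesis using 2
      by (simp add: max_def power2_eq_square algebra_simps abs_le_iff)
  next
    case 3
    then have "(s + r)\<^sup>2 \<le> r\<^sup>2" by (intro power_mono) auto
    then show ?thesis using 3 by (simp add: max_def)
  next
    case 4
    then show ?thesis by (simp add: max_def)
  qed
qed

text \<open>The constant is 25 + 2: the change \<open>r\<close> of the squared norm is at most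
  \<open>5 * norm w\<close> on the ball of radius 2, and the quadratic part of \<open>r\<close>
  itself contributes at most twice \<open>(norm w)^2\<close>. Further out, \<open>z\<close> and
  \<open>z + w\<close> both miss the support; the indicator makes the bound integrable.\<close>

lemma bump_quad:
  assumes \<delta>: "0 \<le> \<delta>" "\<delta> \<le> 1" and w: "norm w \<le> 1"
  shows "\<bar>bump \<delta> (z + w) - bump \<delta> z - w \<bullet> bump_grad \<delta> z\<bar> \<le> 27 * (norm w)\<^sup>2 * indicator (cball 0 2) z"
proof (cases "norm z \<le> 2")
  case True
  define s where "s = \<delta>\<^sup>2 - (norm z)\<^sup>2"
  define r where "r = - (2 * (w \<bullet> z) + (norm w)\<^sup>2)"
  have sr: "\<delta>\<^sup>2 - (norm (z + w))\<^sup>2 = s + r"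
    unfolding s_def r_def power2_norm_eq_inner by (simp add: inner_simps inner_commute)
  have s1: "max 0 s \<le> 1"
  proof -
    have "s \<le> 1"
      using power_le_one[OF \<delta>, of 2] zero_le_power2[of "norm z"] unfolding s_def by linarith
    then show ?thesis by simp
  qed
  have "\<bar>w \<bullet> z\<bar> \<le> norm w * norm z" by (rule Cauchy_Schwarz_ineq2)
  also have "\<dots> \<le> norm w * 2" using True by (intro mult_left_mono) auto
  finally have "\<bar>2 * (w \<bullet> z)\<bar> \<le> 4 * norm w" by simp
  moreover have "(norm w)\<^sup>2 \<le> norm w" using w by (simp add: power2_eq_square mult_left_le)
  moreover have "0 \<le> (norm w)\<^sup>2" by simp
  ultimately have "\<bar>r\<bar> \<le> 5 * norm w" unfolding r_def by linarith
  then have "r\<^sup>2 \<le> (5 * norm w)\<^sup>2" by (metis abs_ge_zero power2_abs power_mono)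
  then have r2: "r\<^sup>2 \<le> 25 * (norm w)\<^sup>2" by (simp add: power_mult_distrib)
  have "bump \<delta> (z + w) - bump \<delta> z - w \<bullet> bump_grad \<delta> z
    = ((max 0 (s + r))\<^sup>2 - (max 0 s)\<^sup>2 - 2 * max 0 s * r) + (- 2 * max 0 s * (norm w)\<^sup>2)"
    unfolding bump_def bump_grad_def sr s_def[symmetric] by (simp add: r_def algebra_simps)
  also have "\<bar>\<dots>\<bar> \<le> r\<^sup>2 + 2 * 1 * (norm w)\<^sup>2"
  proof (rule order_trans[OF abs_triangle_ineq add_mono[OF pos_part_sq_quad]])
    have "max 0 s * (norm w)\<^sup>2 \<le> 1 * (norm w)\<^sup>2" using s1 by (rule mult_right_mono) simp
    then show "\<bar>- 2 * max 0 s * (norm w)\<^sup>2\<bar> \<le> 2 * 1 * (norm w)\<^sup>2" by (simp add: abs_mult)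
  qed
  finally show ?thesis using r2 True by simp
next
  case False
  have "norm z \<le> norm (z + w) + norm w" using norm_triangle_ineq4[of "z + w" w] by simp
  then have "\<delta> \<le> norm (z + w)" "\<delta> \<le> norm z" using False w \<delta> by auto
  then show ?thesis by (simp add: bump_outside[OF \<delta>(1)])
qed

lemma integrable_compact_support:
  fixes g :: "'a::euclidean_space \<Rightarrow> 'b::{banach, second_countable_topology}"
  assumes "g \<in> borel_measurable borel" "\<And>y. norm (g y) \<le> c" "\<And>y. y \<notin> cball x r \<Longrightarrow> g y = 0"
  shows "integrable lborel g"
proof (rule Bochner_Integration.integrable_bound)
  show "integrable lborel (\<lambda>y. c * indicator (cball x r) y :: real)"
    using emeasure_lborel_cball_finite[of x r]
    by (intro integrable_mult_right integrable_real_indicator) (auto simp: top.not_eq_extremum)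
  show "AE y in lborel. norm (g y) \<le> norm (c * indicator (cball x r) y)"
    using assms(2,3) by (auto simp: indicator_def intro: order_trans[OF _ abs_ge_self])
qed (use assms in auto)

text \<open>Move a distance \<open>t\<close> in the direction of \<open>V\<close>: the increment
  \<open>t * norm V\<close> is at most \<open>L * t + K * t^2\<close>. Divide by \<open>t\<close>
  and let it tend to 0. Only a neighbourhood of \<open>x\<close> is involved, so
  \<open>L = 0\<close> shows that the gradient vanishes where \<open>f\<close> is locally
  constant.\<close>

lemma gradient_norm_le:
  fixes V :: "'a::real_inner" and f :: "'a \<Rightarrow> real"
  assumes r: "0 < r" and L: "0 \<le> L" and f: "\<And>w. norm w < r \<Longrightarrow> \<bar>f (x + w) - f x\<bar> \<le> L * norm w"
    and fV: "\<And>w. norm w < r \<Longrightarrow> \<bar>f (x + w) - f x - w \<bullet> V\<bar> \<le> K * (norm w)\<^sup>2"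
  shows "norm V \<le> L"
proof (cases "V = 0")
  case False
  define n where "n = norm V"
  have n: "0 < n" using False by (simp add: n_def)
  have "n \<le> L + K * t" if t: "0 < t" "t < r" for t
  proof -
    define w where "w = (t / n) *\<^sub>R V"
    have nw: "norm w = t" using t n by (simp add: w_def n_def)
    have "w \<bullet> V = t * n"
      using n by (simp add: w_def n_def power2_norm_eq_inner[symmetric] power2_eq_square)
    then have "t * n \<le> \<bar>f (x + w) - f x\<bar> + \<bar>f (x + w) - f x - w \<bullet> V\<bar>" by linarith
    also have "\<dots> \<le> L * t + K * t\<^sup>2" using f[of w] fV[of w] nw t by simp
    also have "\<dots> = t * (L + K * t)" by (simp add: power2_eq_square algebra_simps)
    finally show ?thesis using t by simp
  qed
  then have "\<forall>\<^sub>F t in at_right 0. n \<le> L + K * t"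
    unfolding eventually_at_right_field using r by blast
  moreover have "((\<lambda>t. L + K * t) \<longlongrightarrow> L + K * 0) (at_right 0)"
    by (intro tendsto_intros)
  ultimately have "n \<le> L + K * 0"
    by (intro tendsto_lowerbound[where F="at_right (0::real)"]) auto
  then show ?thesis by (simp add: n_def)
qed (use L in simp)

text \<open>Convolution with the normalised bump averages translates of \<open>f0\<close>, which
  keeps the range and the Lipschitz constant. The last property records locality: values further
  than \<delta> away have no influence.\<close>

proposition Lipschitz_mollify:
  fixes f0 :: "'a::euclidean_space \<Rightarrow> real"
  assumes L: "0 \<le> L" "\<And>x y. \<bar>f0 x - f0 y\<bar> \<le> L * norm (x - y)"
    and ab: "0 \<le> a" "b \<le> 1" "\<And>x. a \<le> f0 x \<and> f0 x \<le> b" and \<delta>: "0 < \<delta>" "\<delta> \<le> 1"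
  obtains f :: "'a \<Rightarrow> real" and V :: "'a \<Rightarrow> 'a" and K where
    "f \<in> borel_measurable borel" "V \<in> borel_measurable borel"
    "\<And>x. a \<le> f x \<and> f x \<le> b" "\<And>x. norm (V x) \<le> L"
    "\<And>x w. \<bar>f (x + w) - f x - w \<bullet> V x\<bar> \<le> K * (norm w)\<^sup>2"
    "\<And>x c. (\<And>y. y \<in> cball x \<delta> \<Longrightarrow> f0 y = c) \<Longrightarrow> f x = c"
proof -
  have Lipschitz_cont: "continuous_on UNIV g" if "\<And>x y. \<bar>g x - g y\<bar> \<le> L * norm (x - y)" for g :: "'a \<Rightarrow> real"
    using that L(1) by (intro lipschitz_on_continuous_on[of L] lipschitz_onI) (auto simp: dist_norm)
  have f0m [measurable]: "f0 \<in> borel_measurable borel"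
    by (rule borel_measurable_continuous_onI[OF Lipschitz_cont[OF L(2)]])
  have f01: "\<bar>f0 y\<bar> \<le> 1" "0 \<le> f0 y" for y using ab(1,2) ab(3)[of y] by auto
  let ?q = "bump \<delta> :: 'a \<Rightarrow> real" and ?G = "bump_grad \<delta> :: 'a \<Rightarrow> 'a"
  have \<delta>0: "0 \<le> \<delta>" using \<delta> by simp
  note bb = bump_bounds[OF \<delta>0 \<delta>(2)]
  have q_out: "?q z = 0" "?G z = 0" if "z \<notin> cball 0 1" for z
    using that bump_outside[OF \<delta>0, of z] \<delta>(2) by auto
  have q_int: "integrable lborel (\<lambda>y. f0 (x - y) * ?q y)" for x
  proof (rule integrable_compact_support[of _ 1 0 1])
    show "norm (f0 (x - y) * ?q y) \<le> 1" for y
      using mult_mono[of "\<bar>f0 (x - y)\<bar>" 1 "?q y" 1] f01 bb(1)[of y] bump_nonneg[of \<delta> y] by (simp add: abs_mult)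
  qed (use q_out in auto)
  have q_int0: "integrable lborel ?q"
    by (rule integrable_compact_support[of _ 1 0 1]) (use q_out bb(1) in \<open>auto simp: abs_of_nonneg[OF bump_nonneg]\<close>)
  have q_int': "integrable lborel (\<lambda>y. f0 y * ?q (x - y))" for x
  proof (rule integrable_compact_support[of _ 1 x 1])
    show "norm (f0 y * ?q (x - y)) \<le> 1" for y
      using mult_mono[of "\<bar>f0 y\<bar>" 1 "?q (x - y)" 1] f01 bb(1)[of "x - y"] bump_nonneg[of \<delta> "x - y"] by (simp add: abs_mult)
    show "f0 y * ?q (x - y) = 0" if "y \<notin> cball x 1" for y
      using that by (subst q_out(1)) (simp_all add: dist_norm norm_minus_commute)
  qed simp
  have G_int: "integrable lborel (\<lambda>y. f0 y *\<^sub>R ?G (x - y))" for x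
  proof (rule integrable_compact_support[of _ 4 x 1])
    show "norm (f0 y *\<^sub>R ?G (x - y)) \<le> 4" for y
      using mult_mono[of "\<bar>f0 y\<bar>" 1 "norm (?G (x - y))" 4] f01 bb(2)[of "x - y"] by simp
    show "f0 y *\<^sub>R ?G (x - y) = 0" if "y \<notin> cball x 1" for y
      using that by (subst q_out(2)) (simp_all add: dist_norm norm_minus_commute)
  qed simp
  define C0 where "C0 = (\<integral>y. ?q y \<partial>lborel)"
  have C0: "0 < C0"
  proof -
    \<comment> \<open>On the ball of radius \<open>\<delta> / 2\<close> one has
      \<open>\<delta>^2 - (norm y)^2 \<ge> 3 / 4 * \<delta>^2\<close>, which bounds the total mass
      from below.\<close>
    have "0 < (3 / 4 * \<delta>\<^sup>2)\<^sup>2 * measure lborel (cball (0::'a) (\<delta> / 2))"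
      using \<delta> by (intro mult_pos_pos content_cball_pos) auto
    also have "\<dots> = (\<integral>y. (3 / 4 * \<delta>\<^sup>2)\<^sup>2 * indicator (cball (0::'a) (\<delta> / 2)) y \<partial>lborel)"
      by simp
    also have "\<dots> \<le> C0"
      unfolding C0_def
    proof (rule integral_mono[OF _ q_int0])
      show "integrable lborel (\<lambda>y. (3 / 4 * \<delta>\<^sup>2)\<^sup>2 * indicator (cball (0::'a) (\<delta> / 2)) y)"
        using emeasure_lborel_cball_finite[of "0::'a" "\<delta> / 2"]
        by (intro integrable_mult_right integrable_real_indicator) (auto simp: top.not_eq_extremum)
      fix y :: 'a
      show "(3 / 4 * \<delta>\<^sup>2)\<^sup>2 * indicator (cball (0::'a) (\<delta> / 2)) y \<le> ?q y"
      proof (cases "norm y \<le> \<delta> / 2")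
        case True
        have "(norm y)\<^sup>2 \<le> (\<delta> / 2)\<^sup>2" using True by (intro power_mono) auto
        then have "3 / 4 * \<delta>\<^sup>2 \<le> \<delta>\<^sup>2 - (norm y)\<^sup>2" by (simp add: power_divide)
        also have "\<dots> \<le> max 0 (\<delta>\<^sup>2 - (norm y)\<^sup>2)" by simp
        finally have "3 / 4 * \<delta>\<^sup>2 \<le> max 0 (\<delta>\<^sup>2 - (norm y)\<^sup>2)" .
        then have "(3 / 4 * \<delta>\<^sup>2)\<^sup>2 \<le> ?q y"
          unfolding bump_def by (intro power_mono) auto
        then show ?thesis using True by simp
      qed (simp add: bump_nonneg)
    qed
    finally show ?thesis .
  qed
  define f where "f = (\<lambda>x. (\<integral>y. f0 y * ?q (x - y) \<partial>lborel) / C0)"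
  define V where "V = (\<lambda>x. (1 / C0) *\<^sub>R (\<integral>y. f0 y *\<^sub>R ?G (x - y) \<partial>lborel))"
  \<comment> \<open>Both forms of the convolution are used: with \<open>f0\<close> translated for
    the range and the Lipschitz constant, with the kernel translated for the derivative.\<close>
  have f_alt: "f x = (\<integral>y. f0 (x - y) * ?q y \<partial>lborel) / C0" for x
    using lborel_integral_reflect[of "\<lambda>y. f0 (x - y) * ?q y" x] by (simp add: f_def)
  have f_ab: "a \<le> f x \<and> f x \<le> b" for x
  proof -
    have "(\<integral>y. a * ?q y \<partial>lborel) \<le> (\<integral>y. f0 (x - y) * ?q y \<partial>lborel)"
      "(\<integral>y. f0 (x - y) * ?q y \<partial>lborel) \<le> (\<integral>y. b * ?q y \<partial>lborel)"
      by (intro integral_mono q_int integrable_mult_right q_int0 mult_right_mono bump_nonneg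
          conjunct1[OF ab(3)] conjunct2[OF ab(3)])+
    then show ?thesis
      using C0 by (simp add: f_alt pos_le_divide_eq pos_divide_le_eq C0_def)
  qed
  have f_Lip: "\<bar>f x - f z\<bar> \<le> L * norm (x - z)" for x z
  proof -
    have "(f x - f z) * C0 = (\<integral>y. f0 (x - y) * ?q y - f0 (z - y) * ?q y \<partial>lborel)"
    proof -
      have "(f x - f z) * C0 = (\<integral>y. f0 (x - y) * ?q y \<partial>lborel) - (\<integral>y. f0 (z - y) * ?q y \<partial>lborel)"
        using C0 by (simp add: f_alt left_diff_distrib)
      then show ?thesis by (simp add: Bochner_Integration.integral_diff[OF q_int q_int])
    qed
    also have "\<bar>\<dots>\<bar> \<le> (\<integral>y. \<bar>f0 (x - y) * ?q y - f0 (z - y) * ?q y\<bar> \<partial>lborel)"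
      by (rule integral_abs_bound)
    also have "\<dots> \<le> (\<integral>y. L * norm (x - z) * ?q y \<partial>lborel)"
    proof (rule integral_mono)
      fix y
      have "\<bar>f0 (x - y) - f0 (z - y)\<bar> * ?q y \<le> L * norm (x - z) * ?q y"
        using L(2)[of "x - y" "z - y"] by (intro mult_right_mono bump_nonneg) simp
      then show "\<bar>f0 (x - y) * ?q y - f0 (z - y) * ?q y\<bar> \<le> L * norm (x - z) * ?q y"
        by (simp add: left_diff_distrib[symmetric] abs_mult bump_nonneg)
    qed (auto intro!: q_int q_int0)
    finally have "\<bar>f x - f z\<bar> * C0 \<le> L * norm (x - z) * C0"
      using C0 by (simp add: abs_mult C0_def)
    then show ?thesis using C0 by simp
  qed
  define K where "K = 27 * measure lborel (cball (0::'a) 2) / C0"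
  have small: "\<bar>f (x + w) - f x - w \<bullet> V x\<bar> \<le> K * (norm w)\<^sup>2" if w: "norm w \<le> 1" for x w
  proof -
    let ?d = "\<lambda>y. ?q ((x - y) + w) - ?q (x - y) - w \<bullet> ?G (x - y)"
    have eq: "f0 y * ?d y = f0 y * ?q (x + w - y) - f0 y * ?q (x - y) - w \<bullet> (f0 y *\<^sub>R ?G (x - y))" for y
    proof -
      have "(x - y) + w = x + w - y" by simp
      then show ?thesis by (simp add: algebra_simps)
    qed
    have ind_m: "(indicator (cball (0::'a) 2) :: 'a \<Rightarrow> real) \<in> borel_measurable borel"
      by (rule borel_measurable_indicator) simp
    have iG: "integrable lborel (\<lambda>y. w \<bullet> (f0 y *\<^sub>R ?G (x - y)))"
      by (intro integrable_inner_right G_int)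
    have G_inner: "(\<integral>y. w \<bullet> (f0 y *\<^sub>R ?G (x - y)) \<partial>lborel) = w \<bullet> (\<integral>y. f0 y *\<^sub>R ?G (x - y) \<partial>lborel)"
      by (intro integral_inner_right G_int)
    have int: "integrable lborel (\<lambda>y. f0 y * ?d y)"
      unfolding eq by (intro Bochner_Integration.integrable_diff q_int' iG)
    have d: "(f (x + w) - f x - w \<bullet> V x) * C0 = (\<integral>y. f0 y * ?d y \<partial>lborel)"
    proof -
      have "(f (x + w) - f x - w \<bullet> V x) * C0 = (\<integral>y. f0 y * ?q (x + w - y) \<partial>lborel)
        - (\<integral>y. f0 y * ?q (x - y) \<partial>lborel) - w \<bullet> (\<integral>y. f0 y *\<^sub>R ?G (x - y) \<partial>lborel)"
        using C0 by (simp add: f_def V_def left_diff_distrib)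
      then show ?thesis
        unfolding eq by (simp only: Bochner_Integration.integral_diff
            Bochner_Integration.integrable_diff q_int' iG G_inner)
    qed
    have "\<bar>(f (x + w) - f x - w \<bullet> V x) * C0\<bar> \<le> (\<integral>y. \<bar>f0 y * ?d y\<bar> \<partial>lborel)"
      unfolding d by (rule integral_abs_bound)
    also have "\<dots> \<le> (\<integral>y. 27 * (norm w)\<^sup>2 * indicator (cball 0 2) (x - y) \<partial>lborel)"
    proof (rule integral_mono)
      show "integrable lborel (\<lambda>y. \<bar>f0 y * ?d y\<bar>)" using int by simp
      show "integrable lborel (\<lambda>y. 27 * (norm w)\<^sup>2 * indicator (cball 0 2) (x - y) :: real)"
      proof (rule integrable_compact_support[of _ "27 * (norm w)\<^sup>2" x 2])
        show "norm (27 * (norm w)\<^sup>2 * indicator (cball 0 2) (x - y) :: real) \<le> 27 * (norm w)\<^sup>2" for y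
          by (simp add: indicator_def)
        show "27 * (norm w)\<^sup>2 * indicator (cball 0 2) (x - y) = (0::real)" if "y \<notin> cball x 2" for y
          using that by (simp add: dist_norm norm_minus_commute)
        have "(\<lambda>y. indicator (cball (0::'a) 2) (x - y) :: real) \<in> borel_measurable borel"
          by (rule measurable_compose[OF _ ind_m]) simp
        then show "(\<lambda>y. 27 * (norm w)\<^sup>2 * indicator (cball (0::'a) 2) (x - y) :: real) \<in> borel_measurable borel"
          by simp
      qed
      fix y
      have "\<bar>f0 y\<bar> * \<bar>?d y\<bar> \<le> 1 * (27 * (norm w)\<^sup>2 * indicator (cball 0 2) (x - y))"
        by (rule mult_mono[OF f01(1) bump_quad[OF \<delta>0 \<delta>(2) w]]) auto
      then show "\<bar>f0 y * ?d y\<bar> \<le> 27 * (norm w)\<^sup>2 * indicator (cball 0 2) (x - y)"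
        by (simp add: abs_mult)
    qed
    also have "\<dots> = 27 * (norm w)\<^sup>2 * measure lborel (cball (0::'a) 2)"
      using lborel_integral_reflect[OF ind_m, of x] by simp
    finally have "\<bar>f (x + w) - f x - w \<bullet> V x\<bar> * C0 \<le> 27 * (norm w)\<^sup>2 * measure lborel (cball (0::'a) 2)"
      using C0 by (simp add: abs_mult)
    then have "\<bar>f (x + w) - f x - w \<bullet> V x\<bar> \<le> 27 * (norm w)\<^sup>2 * measure lborel (cball (0::'a) 2) / C0"
      using C0 by (simp only: pos_le_divide_eq)
    then show ?thesis by (simp add: K_def mult_ac)
  qed
  have VL: "norm (V x) \<le> L" for x
  proof (rule gradient_norm_le[of 1 L f x "V x" K])
    show "\<bar>f (x + w) - f x\<bar> \<le> L * norm w" for w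
      using f_Lip[of "x + w" x] by simp
  qed (use L(1) small in auto)
  show ?thesis
  \<comment> \<open>The summand \<open>1 + L\<close> covers increments longer than 1: there
    \<open>f\<close> changes by at most 1 and the linear term is at most \<open>L * norm w\<close>,
    and both are dominated by the squared length.\<close>
  proof (rule that[of f V "K + (1 + L)"])
    show "f \<in> borel_measurable borel"
      by (rule borel_measurable_continuous_onI[OF Lipschitz_cont[OF f_Lip]])
    show "V \<in> borel_measurable borel"
      unfolding V_def by measurable
    show "f x = c" if "\<And>y. y \<in> cball x \<delta> \<Longrightarrow> f0 y = c" for x c
    proof -
      have eq: "f0 (x - y) * ?q y = c * ?q y" for y
        using that[of "x - y"] bump_outside(1)[OF \<delta>0, of y] by (cases "norm y \<le> \<delta>") (auto simp: dist_norm)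
      have "(\<integral>y. f0 (x - y) * ?q y \<partial>lborel) = c * C0"
        unfolding eq C0_def by simp
      then show ?thesis using C0 by (simp add: f_alt)
    qed
    show "\<bar>f (x + w) - f x - w \<bullet> V x\<bar> \<le> (K + (1 + L)) * (norm w)\<^sup>2" for x w
    proof (cases "norm w \<le> 1")
      case True
      have "K * (norm w)\<^sup>2 \<le> (K + (1 + L)) * (norm w)\<^sup>2" using L(1) by (intro mult_right_mono) auto
      then show ?thesis using small[OF True, of x] by linarith
    next
      case False
      have "\<bar>f (x + w) - f x\<bar> \<le> 1" using f_ab[of x] f_ab[of "x + w"] ab(1,2) by auto
      moreover have "\<bar>w \<bullet> V x\<bar> \<le> norm w * L"
        using Cauchy_Schwarz_ineq2[of w "V x"] VL[of x] mult_left_mono[of "norm (V x)" L "norm w"] by simp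
      ultimately have "\<bar>f (x + w) - f x - w \<bullet> V x\<bar> \<le> 1 + norm w * L" by linarith
      also have "\<dots> \<le> (norm w)\<^sup>2 * 1 + (norm w)\<^sup>2 * L"
      proof -
        have "norm w \<le> (norm w)\<^sup>2"
          using False mult_left_mono[of 1 "norm w" "norm w"] by (simp add: power2_eq_square)
        then show ?thesis
          using False L(1) by (intro add_mono mult_right_mono) auto
      qed
      also have "\<dots> \<le> (K + (1 + L)) * (norm w)\<^sup>2"
      proof -
        have "0 \<le> K" using C0 by (simp add: K_def)
        then show ?thesis by (simp add: algebra_simps)
      qed
      finally show ?thesis .
    qed
  qed (use f_ab VL in auto)
qed

section \<open>Growth of the volume of neighbourhoods\<close>

lemma gauss_profile_antimono:
  assumes "1 / 2 \<le> a" "a \<le> b" "b < 1"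
  shows "gauss_profile b \<le> gauss_profile a"
proof -
  have "gauss_quantile (1 / 2) = 0"
    using gauss_quantile_cdf[of 0] by (simp add: gauss_cdf_0)
  then have "0 \<le> gauss_quantile a" "gauss_quantile a \<le> gauss_quantile b"
    using assms gauss_quantile_le_iff[of "1 / 2" a] gauss_quantile_le_iff[of a b] by auto
  then show ?thesis
    unfolding gauss_profile_def by (intro std_normal_density_mono) auto
qed

text \<open>The value at 0 being unspecified, the one-sided limit is what removes the contribution
  of \<eta> from the regions where the cut-off is constant.\<close>

lemma gauss_profile_at_0: "(gauss_profile \<longlongrightarrow> 0) (at_right 0)"
proof (rule tendstoI)
  fix e :: real assume e: "0 < e"
  have "(std_normal_density \<longlongrightarrow> 0) at_bot"
    unfolding std_normal_density_def by real_asymp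
  then have "\<forall>\<^sub>F x in at_bot. dist (std_normal_density x) 0 < e"
    using e by (rule tendstoD)
  then obtain z where z: "\<And>x. x \<le> z \<Longrightarrow> std_normal_density x < e"
    by (auto simp: eventually_at_bot_linorder)
  show "\<forall>\<^sub>F a in at_right 0. dist (gauss_profile a) 0 < e"
    unfolding eventually_at_right_field
  proof (intro exI[of _ "gauss_cdf z"] conjI allI impI)
    fix a assume a: "0 < a" "a < gauss_cdf z"
    then have "gauss_cdf (gauss_quantile a) < gauss_cdf z"
      using gauss_cdf_less_1[of z] by simp
    then have "gauss_quantile a \<le> z" by simp
    then show "dist (gauss_profile a) 0 < e"
      using z gauss_profile_pos[of a] by (simp add: gauss_profile_def dist_real_def)
  qed (rule gauss_cdf_pos)
qed

definition nbhd_measure :: "'a::euclidean_space set \<Rightarrow> real \<Rightarrow> real" where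
  "nbhd_measure K t = measure unif_cube {x. infdist x K \<le> t}"

lemma nbhd_sets [measurable]: "{x :: 'a::euclidean_space. infdist x K \<le> t} \<in> sets borel"
proof -
  have "(\<lambda>x. infdist x K) \<in> borel_measurable borel"
    by (intro borel_measurable_continuous_onI continuous_on_infdist continuous_on_id)
  then show ?thesis by measurable
qed

interpretation unif_cube: prob_space "unif_cube :: 'a::euclidean_space measure"
  by (rule prob_space_unif_cube)

lemma nbhd_measure_mono:
  assumes "s \<le> t"
  shows "nbhd_measure (K :: 'a::euclidean_space set) s \<le> nbhd_measure K t"
  unfolding nbhd_measure_def using assms by (intro unif_cube.finite_measure_mono) auto

text \<open>A discrete form of \<open>u' \<ge> \<surd>(2\<pi>) I(u)\<close> for the volume \<open>u\<close> of the neighbourhoods of \<open>K\<close>: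
  Bobkov's inequality for a mollified cut-off of the distance function that descends
  between the distances \<open>s\<close> and \<open>t\<close>.\<close>

lemma nbhd_measure_growth:
  fixes K :: "'a::euclidean_space set"
  assumes st: "s < t" and us: "1 / 2 < nbhd_measure K s" and ut: "nbhd_measure K t < 1"
  shows "(t - s) * gauss_profile (nbhd_measure K t)
    \<le> (1 / sqrt (2 * pi) + (t - s)) * (nbhd_measure K t - nbhd_measure K s)"
proof -
  let ?u = "nbhd_measure K" and ?M = "unif_cube :: 'a measure" and ?d = "\<lambda>x. infdist x K"
  let ?k = "1 / sqrt (2 * pi)"
  have k0: "0 < ?k" by simp
  have lip: "\<bar>?d x - ?d y\<bar> \<le> norm (x - y)" for x y
    using infdist_triangle_abs[of x K y] by (simp add: dist_norm)
  have step: "gauss_profile (?u t + \<eta>) \<le> gauss_profile \<eta> + (1 + ?k / e) * (?u t - ?u s)"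
    if e: "0 < e" "e < t - s" and \<eta>: "0 < \<eta>" "\<eta> < 1 / 2" "(1 - \<eta>) * ?u s \<ge> 1 / 2" "?u t + \<eta> < 1" for e \<eta>
  proof -
    \<comment> \<open>The cut-off descends over a length \<open>e\<close>, which leaves a margin
      \<open>\<delta>1\<close> on either side. With \<open>2 * \<delta> \<le> \<delta>1\<close>, the
      mollified function is still constant up to distance \<open>s + \<delta>\<close> and from
      \<open>t - \<delta>\<close> on.\<close>
    define \<delta>1 where "\<delta>1 = (t - s - e) / 2"
    define \<delta> where "\<delta> = min 1 (\<delta>1 / 2)"
    have \<delta>1: "0 < \<delta>1" "s + \<delta>1 + e = t - \<delta>1" using e by (auto simp: \<delta>1_def field_simps)
    have \<delta>: "0 < \<delta>" "\<delta> \<le> 1" "2 * \<delta> \<le> \<delta>1" using \<delta>1 by (auto simp: \<delta>_def)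
    define c where "c = (\<lambda>x. max 0 (min 1 ((t - \<delta>1 - ?d x) / e)))"
    define f0 where "f0 = (\<lambda>x. \<eta> + (1 - 2 * \<eta>) * c x)"
    have c01: "0 \<le> c x" "c x \<le> 1" for x by (auto simp: c_def)
    have clamp: "\<bar>max 0 (min 1 a) - max 0 (min 1 b)\<bar> \<le> \<bar>a - b\<bar>" for a b :: real
      by linarith
    have f0_Lip: "\<bar>f0 x - f0 y\<bar> \<le> 1 / e * norm (x - y)" for x y
    proof -
      have "\<bar>c x - c y\<bar> \<le> \<bar>(t - \<delta>1 - ?d x) / e - (t - \<delta>1 - ?d y) / e\<bar>"
        unfolding c_def by (rule clamp)
      also have "\<dots> = \<bar>?d y - ?d x\<bar> / e"
        using e(1) by (simp add: diff_divide_distrib[symmetric])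
      also have "\<dots> \<le> norm (x - y) / e"
        using lip[of y x] e(1) by (intro divide_right_mono) (auto simp: norm_minus_commute)
      finally have c: "\<bar>c x - c y\<bar> \<le> norm (x - y) / e" .
      have "f0 x - f0 y = (1 - 2 * \<eta>) * (c x - c y)" by (simp add: f0_def algebra_simps)
      then have "\<bar>f0 x - f0 y\<bar> = (1 - 2 * \<eta>) * \<bar>c x - c y\<bar>" using \<eta> by (simp add: abs_mult)
      also have "\<dots> \<le> 1 * \<bar>c x - c y\<bar>" using \<eta> by (intro mult_right_mono) auto
      finally show ?thesis using c by simp
    qed
    have f0_bd: "\<eta> \<le> f0 x \<and> f0 x \<le> 1 - \<eta>" for x
    proof -
      have "0 \<le> (1 - 2 * \<eta>) * c x" "(1 - 2 * \<eta>) * c x \<le> (1 - 2 * \<eta>) * 1"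
        using c01[of x] \<eta> by (auto intro!: mult_left_mono)
      then show ?thesis by (simp add: f0_def)
    qed
    obtain f :: "'a \<Rightarrow> real" and V :: "'a \<Rightarrow> 'a" and B where fV:
      "f \<in> borel_measurable borel" "V \<in> borel_measurable borel"
      "\<And>x. \<eta> \<le> f x \<and> f x \<le> 1 - \<eta>" "\<And>x. norm (V x) \<le> 1 / e"
      "\<And>x w. \<bar>f (x + w) - f x - w \<bullet> V x\<bar> \<le> B * (norm w)\<^sup>2"
      "\<And>x a. (\<And>y. y \<in> cball x \<delta> \<Longrightarrow> f0 y = a) \<Longrightarrow> f x = a"
      by (rule Lipschitz_mollify[of "1 / e" f0 \<eta> "1 - \<eta>" \<delta>])
         (use e(1) \<eta> \<delta> f0_Lip f0_bd in auto)
    have near: "f x = 1 - \<eta>" if "?d x \<le> s + \<delta>" for x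
    proof (rule fV(6))
      fix y assume "y \<in> cball x \<delta>"
      then have "?d y \<le> s + \<delta>1" using lip[of x y] that \<delta>(3) by (simp add: dist_norm)
      then have "(t - \<delta>1 - ?d y) / e \<ge> 1" using \<delta>1(2) e(1) by (simp add: pos_le_divide_eq)
      then have "c y = 1" unfolding c_def by simp
      then show "f0 y = 1 - \<eta>" by (simp add: f0_def)
    qed
    have far: "f x = \<eta>" if "?d x \<ge> t - \<delta>" for x
    proof (rule fV(6))
      fix y assume "y \<in> cball x \<delta>"
      then have "?d y \<ge> t - \<delta>1" using lip[of x y] that \<delta>(3) by (simp add: dist_norm)
      then have "(t - \<delta>1 - ?d y) / e \<le> 0" using e(1) by (simp add: divide_nonpos_pos)
      then have "c y = 0" unfolding c_def by simp
      then show "f0 y = \<eta>" by (simp add: f0_def)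
    qed
    have V0: "V x = 0" if "?d x \<le> s \<or> t < ?d x" for x
    proof -
      have "norm (V x) \<le> 0"
      proof (rule gradient_norm_le[of \<delta> 0 f x "V x" B])
        fix w :: 'a assume w: "norm w < \<delta>"
        have dw: "\<bar>?d (x + w) - ?d x\<bar> < \<delta>" using lip[of "x + w" x] w by simp
        show "\<bar>f (x + w) - f x\<bar> \<le> 0 * norm w"
        proof (cases "?d x \<le> s")
          case True
          then have "?d (x + w) \<le> s + \<delta>" "?d x \<le> s + \<delta>"
            using dw \<delta>(1) by linarith+
          then have "f (x + w) = 1 - \<eta>" "f x = 1 - \<eta>" by (simp_all add: near)
          then show ?thesis by simp
        next
          case False
          then have "t - \<delta> \<le> ?d (x + w)" "t - \<delta> \<le> ?d x"
            using dw \<delta>(1) that by linarith+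
          then have "f (x + w) = \<eta>" "f x = \<eta>" by (simp_all add: far)
          then show ?thesis by simp
        qed
      qed (use \<delta> fV(5) in auto)
      then show ?thesis by simp
    qed
    let ?m = "\<integral>x. f x \<partial>?M"
    let ?A = "\<lambda>r. {x. ?d x \<le> r}"
    have mu: "(\<integral>x. indicator (?A r) x \<partial>?M) = ?u r" for r
      by (simp add: nbhd_measure_def)
    have i_int: "integrable ?M (indicator (?A r) :: 'a \<Rightarrow> real)" for r
      by (intro unif_cube.integrable_const_bound[of _ 1]) auto
    have f_int: "integrable ?M f"
    proof (rule unif_cube.integrable_const_bound[of _ 1])
      have "norm (f x) \<le> 1" for x using fV(3)[of x] \<eta>(1) by auto
      then show "AE x in ?M. norm (f x) \<le> 1" by simp
    qed (use fV(1) in simp)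
    have m_lower: "1 / 2 \<le> ?m"
    proof -
      have "(\<integral>x. (1 - \<eta>) * indicator (?A s) x \<partial>?M) \<le> ?m"
      proof (rule integral_mono)
        fix x show "(1 - \<eta>) * indicator (?A s) x \<le> f x"
          using near[of x] fV(3)[of x] \<delta>(1) \<eta>(1) by (auto simp: indicator_def)
      qed (use i_int f_int in auto)
      then show ?thesis using \<eta>(3) mu[of s] by simp
    qed
    have m_upper: "?m \<le> ?u t + \<eta>"
    proof -
      have "?m \<le> (\<integral>x. \<eta> + indicator (?A t) x \<partial>?M)"
      proof (rule integral_mono)
        fix x show "f x \<le> \<eta> + indicator (?A t) x"
          using far[of x] fV(3)[of x] \<delta>(1) \<eta>(1) by (auto simp: indicator_def not_le)
      qed (use i_int f_int in auto)
      also have "\<dots> = \<eta> + ?u t"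
        using i_int[of t] mu[of t] by (simp add: unif_cube.prob_space)
      finally show ?thesis by simp
    qed
    \<comment> \<open>The mean lies between 1/2 and \<open>?u t + \<eta>\<close>, a range on which
      the profile decreases; a volume above 1/2 at distance \<open>s\<close> is essential
      here.\<close>
    have "gauss_profile (?u t + \<eta>) \<le> gauss_profile ?m"
      by (rule gauss_profile_antimono[OF m_lower m_upper \<eta>(4)])
    also have "\<dots> \<le> (\<integral>x. sqrt ((gauss_profile (f x))\<^sup>2 + 1 / (2 * pi) * (norm (V x))\<^sup>2) \<partial>?M)"
      by (rule bobkov_cube[OF \<eta>(1) fV(3) fV(1,2,4,5)])
    \<comment> \<open>Outside the layer between \<open>s\<close> and \<open>t\<close> the gradient
      vanishes and, by symmetry, the profile equals its value at \<eta>. In the layer the crude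
      bound 1 on the profile suffices: it yields the extra \<open>t - s\<close> in the final
      coefficient, negligible beside \<open>1 / sqrt (2 * pi)\<close> for close distances.\<close>
    also have "\<dots> \<le> (\<integral>x. gauss_profile \<eta> + (1 + ?k / e) * (indicator (?A t) x - indicator (?A s) x) \<partial>?M)"
    proof (rule integral_mono_AE')
      show "integrable ?M (\<lambda>x. gauss_profile \<eta> + (1 + ?k / e) * (indicator (?A t) x - indicator (?A s) x))"
        using i_int by auto
      have p: "gauss_profile \<eta> \<ge> 0" using gauss_profile_pos[of \<eta>] by simp
      have pe: "0 \<le> 1 + ?k / e" using k0 e(1) by simp
      have ind: "(0::real) \<le> indicator (?A t) x - indicator (?A s) x" for x
        using st by (auto simp: indicator_def)
      show "AE x in ?M. 0 \<le> gauss_profile \<eta> + (1 + ?k / e) * (indicator (?A t) x - indicator (?A s) x)"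
        by (intro AE_I2 add_nonneg_nonneg[OF p mult_nonneg_nonneg[OF pe ind]])
      show "AE x in ?M. sqrt ((gauss_profile (f x))\<^sup>2 + 1 / (2 * pi) * (norm (V x))\<^sup>2)
        \<le> gauss_profile \<eta> + (1 + ?k / e) * (indicator (?A t) x - indicator (?A s) x)"
      proof (rule AE_I2)
        fix x
        show "sqrt ((gauss_profile (f x))\<^sup>2 + 1 / (2 * pi) * (norm (V x))\<^sup>2)
          \<le> gauss_profile \<eta> + (1 + ?k / e) * (indicator (?A t) x - indicator (?A s) x)"
        proof (cases "?d x \<le> s \<or> t < ?d x")
          case True
          have "gauss_profile (f x) = gauss_profile \<eta>"
          proof (cases "?d x \<le> s")
            case True
            then have "f x = 1 - \<eta>" using \<delta>(1) by (intro near) simp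
            then show ?thesis using \<eta> by (simp add: gauss_profile_minus)
          next
            case False
            then have "f x = \<eta>" using \<open>?d x \<le> s \<or> t < ?d x\<close> \<delta>(1) by (intro far) simp
            then show ?thesis by simp
          qed
          then show ?thesis
            using V0[OF True] p mult_nonneg_nonneg[OF pe ind[of x]] by simp
        next
          case False
          have "sqrt ((gauss_profile (f x))\<^sup>2 + 1 / (2 * pi) * (norm (V x))\<^sup>2)
            \<le> sqrt ((gauss_profile (f x))\<^sup>2) + sqrt (1 / (2 * pi) * (norm (V x))\<^sup>2)"
            by (rule sqrt_add_le_add_sqrt) auto
          also have "\<dots> = gauss_profile (f x) + ?k * norm (V x)"
            using gauss_profile_pos[of "f x"] by (simp add: real_sqrt_mult real_sqrt_divide)
          also have "\<dots> \<le> 1 + ?k * (1 / e)"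
            using fV(4)[of x] gauss_profile_le_1 k0 by (intro add_mono mult_left_mono) auto
          also have "\<dots> \<le> gauss_profile \<eta> + (1 + ?k / e) * (indicator (?A t) x - indicator (?A s) x)"
            using False p by simp
          finally show ?thesis .
        qed
      qed
    qed
    also have "\<dots> = gauss_profile \<eta> + (1 + ?k / e) * (?u t - ?u s)"
      using i_int[of t] i_int[of s] mu[of t] mu[of s] by (simp add: unif_cube.prob_space)
    finally show ?thesis .
  qed
  have u0: "0 < ?u t" using us nbhd_measure_mono[of s t K] st by simp
  have limit: "gauss_profile (?u t) \<le> (1 + ?k / e) * (?u t - ?u s)" if e: "0 < e" "e < t - s" for e
  proof -
    have "isCont (\<lambda>\<eta>. gauss_profile (?u t + \<eta>)) 0"
      by (rule isCont_o2[of 0 "\<lambda>\<eta>. ?u t + \<eta>"]) (use isCont_gauss_profile u0 ut in auto)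
    then have l1: "((\<lambda>\<eta>. gauss_profile (?u t + \<eta>)) \<longlongrightarrow> gauss_profile (?u t)) (at_right 0)"
      by (auto simp: isCont_def intro: filterlim_mono at_le)
    have l2: "((\<lambda>\<eta>. gauss_profile \<eta> + (1 + ?k / e) * (?u t - ?u s))
        \<longlongrightarrow> 0 + (1 + ?k / e) * (?u t - ?u s)) (at_right 0)"
      by (intro tendsto_add gauss_profile_at_0 tendsto_const)
    have "\<forall>\<^sub>F \<eta> in at_right 0. gauss_profile (?u t + \<eta>) \<le> gauss_profile \<eta> + (1 + ?k / e) * (?u t - ?u s)"
    proof -
      \<comment> \<open>The three entries secure \<open>\<eta> < 1 / 2\<close>,
        \<open>?u t + \<eta> < 1\<close> and \<open>(1 - \<eta>) * ?u s \<ge> 1 / 2\<close>.\<close>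
      define r where "r = min (1 / 2) (min (1 - ?u t) (1 - 1 / (2 * ?u s)))"
      have "0 < r" using us ut by (auto simp: r_def pos_divide_less_eq)
      moreover have "gauss_profile (?u t + \<eta>) \<le> gauss_profile \<eta> + (1 + ?k / e) * (?u t - ?u s)"
        if "0 < \<eta>" "\<eta> < r" for \<eta>
      proof (rule step[OF e])
        have "1 / (2 * ?u s) \<le> 1 - \<eta>" using that by (simp add: r_def)
        then show "1 / 2 \<le> (1 - \<eta>) * ?u s" using us by (simp add: pos_divide_le_eq field_simps)
      qed (use that in \<open>auto simp: r_def\<close>)
      ultimately show ?thesis unfolding eventually_at_right_field by blast
    qed
    then have "gauss_profile (?u t) \<le> 0 + (1 + ?k / e) * (?u t - ?u s)"
      by (rule tendsto_le[OF trivial_limit_at_right_real l2 l1])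
    then show ?thesis by simp
  qed
  \<comment> \<open>Letting the length of the descent tend to \<open>t - s\<close> removes the
    margin left for the mollification.\<close>
  have "((\<lambda>e. (1 + ?k / e) * (?u t - ?u s)) \<longlongrightarrow> (1 + ?k / (t - s)) * (?u t - ?u s)) (at_left (t - s))"
    using st by (intro tendsto_intros) auto
  moreover have "\<forall>\<^sub>F e in at_left (t - s). gauss_profile (?u t) \<le> (1 + ?k / e) * (?u t - ?u s)"
    unfolding eventually_at_left_field using st limit by (intro exI[of _ 0]) auto
  ultimately have "gauss_profile (?u t) \<le> (1 + ?k / (t - s)) * (?u t - ?u s)"
    by (intro tendsto_lowerbound[OF _ _ trivial_limit_at_left_real])
  then have "(t - s) * gauss_profile (?u t) \<le> (t - s) * ((1 + ?k / (t - s)) * (?u t - ?u s))"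
    using st by (intro mult_left_mono) auto
  also have "\<dots> = (?k + (t - s)) * (?u t - ?u s)"
    using st by (simp add: field_simps)
  finally show ?thesis .
qed

text \<open>Euler's scheme for \<open>u' \<ge> I(u) / c\<close>, in the coordinate \<open>\<Phi>\<^sup>-\<^sup>1(u)\<close> in which the bound is linear.\<close>

lemma gauss_quantile_growth:
  assumes c: "0 < c" and t: "0 \<le> t" and u0: "1 / 2 < u 0" and ut: "u t < 1"
    and mono: "\<And>r s. r \<le> s \<Longrightarrow> u r \<le> u s"
    and growth: "\<And>r s. 0 \<le> r \<Longrightarrow> r < s \<Longrightarrow> s \<le> t \<Longrightarrow>
      (s - r) * gauss_profile (u s) \<le> (c + (s - r)) * (u s - u r)"
  shows "gauss_quantile (u 0) + t / c \<le> gauss_quantile (u t)"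
proof (cases "t = 0")
  case False
  then have t0: "0 < t" using t by simp
  let ?z = "\<lambda>s. gauss_quantile (u s)"
  have u01: "0 < u s" "u s < 1" if "0 \<le> s" "s \<le> t" for s
    using mono[OF that(1)] mono[OF that(2)] u0 ut by linarith+
  have z_mono: "?z r \<le> ?z s" if "0 \<le> r" "r \<le> s" "s \<le> t" for r s
    using u01[of r] u01[of s] mono[of r s] that by (subst gauss_quantile_le_iff) auto
  have "gauss_quantile (1 / 2) = 0"
    using gauss_quantile_cdf[of 0] by (simp add: gauss_cdf_0)
  then have z0: "0 \<le> ?z 0"
    using u01[of 0] u0 t gauss_quantile_le_iff[of "1 / 2" "u 0"] by auto
  let ?Z = "?z t"
  \<comment> \<open>If the quantile increases by more than \<alpha> there is nothing to do.
    Otherwise \<open>growth\<close> gives \<open>\<alpha> * \<phi>(z s) \<le> u s - u r\<close>, and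
    the mean value theorem bounds the right side by \<open>\<phi>(z r) * (z s - z r)\<close>, as the
    density \<phi> decreases on the positive half-line. The ratio of the two densities is at least
    \<open>exp (- (\<alpha> * ?Z))\<close> because the increment is at most \<alpha>.\<close>
  have step: "\<alpha> * exp (- (\<alpha> * ?Z)) \<le> ?z s - ?z r"
    if r: "0 \<le> r" "r < s" "s \<le> t" and \<alpha>: "\<alpha> = (s - r) / (c + (s - r))" for r s \<alpha>
  proof (cases "?z s - ?z r \<le> \<alpha>")
    case True
    have \<alpha>0: "0 < \<alpha>" using r c by (simp add: \<alpha>)
    have zr: "0 \<le> ?z r" "?z r \<le> ?z s" "?z s \<le> ?Z"
      using z_mono[of 0 r] z_mono[of r s] z_mono[of s t] z0 r by auto
    have "u s - u r \<le> std_normal_density (?z r) * (?z s - ?z r)"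
    proof (cases "?z r = ?z s")
      case True
      then have "u r = u s" using u01[of r] u01[of s] r by (metis gauss_cdf_quantile le_less_trans less_imp_le order_trans)
      then show ?thesis using True by simp
    next
      case False
      then have "?z r < ?z s" using zr by simp
      then obtain x where x: "?z r < x" "gauss_cdf (?z s) - gauss_cdf (?z r) = (?z s - ?z r) * std_normal_density x"
        using MVT2[of "?z r" "?z s" gauss_cdf std_normal_density] has_real_derivative_gauss_cdf by blast
      have "std_normal_density x \<le> std_normal_density (?z r)"
        using x zr by (intro std_normal_density_mono) auto
      then have "(?z s - ?z r) * std_normal_density x \<le> (?z s - ?z r) * std_normal_density (?z r)"
        using zr by (intro mult_left_mono) auto
      then show ?thesis using x(2) u01[of r] u01[of s] r by (simp add: mult.commute)
    qed
    moreover have "\<alpha> * std_normal_density (?z s) \<le> u s - u r"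
      using growth[OF r] r c by (simp add: \<alpha> gauss_profile_def pos_divide_le_eq mult.commute)
    ultimately have 1: "\<alpha> * std_normal_density (?z s) \<le> std_normal_density (?z r) * (?z s - ?z r)"
      by linarith
    have "((?z s)\<^sup>2 - (?z r)\<^sup>2) / 2 = (?z s - ?z r) * ((?z s + ?z r) / 2)"
      by (simp add: power2_eq_square algebra_simps)
    also have "\<dots> \<le> \<alpha> * ?Z"
      using True zr \<alpha>0 by (intro mult_mono) auto
    finally have "exp (- (\<alpha> * ?Z)) \<le> exp (- (((?z s)\<^sup>2 - (?z r)\<^sup>2) / 2))" by simp
    then have "std_normal_density (?z r) * exp (- (\<alpha> * ?Z))
        \<le> std_normal_density (?z r) * exp (- (((?z s)\<^sup>2 - (?z r)\<^sup>2) / 2))"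
      by (intro mult_left_mono) auto
    also have "\<dots> = std_normal_density (?z s)"
      by (simp add: std_normal_density_def mult_exp_exp diff_divide_distrib)
    finally have "\<alpha> * (std_normal_density (?z r) * exp (- (\<alpha> * ?Z))) \<le> \<alpha> * std_normal_density (?z s)"
      using \<alpha>0 by (intro mult_left_mono) auto
    with 1 have "std_normal_density (?z r) * (\<alpha> * exp (- (\<alpha> * ?Z))) \<le> std_normal_density (?z r) * (?z s - ?z r)"
      by (simp add: mult_ac)
    then show ?thesis
      by (rule mult_left_le_imp_le) (simp add: normal_density_pos)
  next
    case False
    have "0 \<le> \<alpha>" using r c by (simp add: \<alpha>)
    moreover have "0 \<le> ?Z" using z_mono[of 0 t] z0 t by simp
    ultimately have "\<alpha> * exp (- (\<alpha> * ?Z)) \<le> \<alpha> * 1" by (intro mult_left_mono) auto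
    then show ?thesis using False by simp
  qed
  \<comment> \<open>Sum over \<open>Suc N\<close> equal steps of length
    \<open>t / real (Suc N)\<close>. As the step length tends to 0, so does \<alpha>, and the sum
    tends to \<open>t / c\<close>.\<close>
  have "real (Suc N) * ((t / real (Suc N)) / (c + t / real (Suc N))
      * exp (- ((t / real (Suc N)) / (c + t / real (Suc N)) * ?Z))) \<le> ?z t - ?z 0" for N
  proof -
    define \<tau> where "\<tau> = t / real (Suc N)"
    have \<tau>: "0 < \<tau>" "real (Suc N) * \<tau> = t" using t0 by (auto simp: \<tau>_def)
    define \<alpha> where "\<alpha> = \<tau> / (c + \<tau>)"
    have "k \<le> Suc N \<Longrightarrow> real k * (\<alpha> * exp (- (\<alpha> * ?Z))) \<le> ?z (real k * \<tau>) - ?z 0" for k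
    proof (induction k)
      case (Suc k)
      have "real (Suc k) * \<tau> \<le> real (Suc N) * \<tau>"
        using Suc.prems \<tau>(1) by (intro mult_right_mono) auto
      then have "\<alpha> * exp (- (\<alpha> * ?Z)) \<le> ?z (real (Suc k) * \<tau>) - ?z (real k * \<tau>)"
        using \<tau> by (intro step) (auto simp: \<alpha>_def algebra_simps)
      then show ?case using Suc by (simp add: algebra_simps)
    qed simp
    from this[of "Suc N"] show ?thesis
      unfolding \<tau>(2) \<alpha>_def \<tau>_def by simp
  qed
  moreover have "(\<lambda>N. real (Suc N) * ((t / real (Suc N)) / (c + t / real (Suc N))
      * exp (- ((t / real (Suc N)) / (c + t / real (Suc N)) * ?Z)))) \<longlonglongrightarrow> t / c"
  proof -
    have eq: "real (Suc N) * ((t / real (Suc N)) / (c + t / real (Suc N))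
      * exp (- ((t / real (Suc N)) / (c + t / real (Suc N)) * ?Z)))
      = t / (c + t / real (Suc N)) * exp (- ((t / real (Suc N)) / (c + t / real (Suc N)) * ?Z))" for N
      by simp
    have T: "(\<lambda>N. t / real (Suc N)) \<longlonglongrightarrow> 0"
      by real_asymp
    have "(\<lambda>N. t / (c + t / real (Suc N)) * exp (- ((t / real (Suc N)) / (c + t / real (Suc N)) * ?Z)))
      \<longlonglongrightarrow> t / (c + 0) * exp (- (0 / (c + 0) * ?Z))"
      using c by (intro tendsto_intros T) auto
    then show ?thesis unfolding eq by simp
  qed
  ultimately have "t / c \<le> ?z t - ?z 0"
    by (intro LIMSEQ_le_const2) auto
  then show ?thesis by simp
qed simp

text \<open>For nonnegative arguments \<open>(s + x)^2 \<ge> s^2 + x^2\<close>, so the density at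
  \<open>s + x\<close> is at most \<open>exp (- s^2 / 2)\<close> times the density at
  \<open>x\<close>. Integration over the half-line produces the factor 1/2.\<close>

lemma gauss_tail:
  assumes "0 \<le> s"
  shows "1 - gauss_cdf s \<le> exp (- s\<^sup>2 / 2) / 2"
proof -
  have fin: "gauss_cdf (s + r) - gauss_cdf s \<le> exp (- s\<^sup>2 / 2) * (gauss_cdf r - gauss_cdf 0)" if "0 \<le> r" for r
  proof -
    let ?h = "\<lambda>r. exp (- s\<^sup>2 / 2) * (gauss_cdf r - gauss_cdf 0) - (gauss_cdf (s + r) - gauss_cdf s)"
    have "?h 0 \<le> ?h r"
    proof (rule DERIV_nonneg_imp_nondecreasing[OF that])
      fix x assume x: "0 \<le> x" "x \<le> r"
      have d: "(?h has_real_derivative exp (- s\<^sup>2 / 2) * std_normal_density x - std_normal_density (s + x)) (at x)"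
      proof -
        have "((\<lambda>r. s + r) has_real_derivative 1) (at x)" by (auto intro!: derivative_eq_intros)
        from DERIV_chain2[OF has_real_derivative_gauss_cdf this]
        have "((\<lambda>r. gauss_cdf (s + r)) has_real_derivative std_normal_density (s + x)) (at x)" by simp
        then show ?thesis
          by (auto intro!: derivative_eq_intros has_real_derivative_gauss_cdf)
      qed
      have "s\<^sup>2 + x\<^sup>2 \<le> (s + x)\<^sup>2" using x assms by (simp add: power2_sum)
      then have "exp (- (s + x)\<^sup>2 / 2) \<le> exp (- s\<^sup>2 / 2 + - x\<^sup>2 / 2)" by (simp add: field_simps)
      then have "exp (- (s + x)\<^sup>2 / 2) \<le> exp (- s\<^sup>2 / 2) * exp (- x\<^sup>2 / 2)" by (simp only: exp_add)
      then have "std_normal_density (s + x) \<le> exp (- s\<^sup>2 / 2) * std_normal_density x"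
        by (simp add: std_normal_density_def divide_right_mono)
      then show "\<exists>y. (?h has_real_derivative y) (at x) \<and> 0 \<le> y"
        using d by (intro exI[of _ "exp (- s\<^sup>2 / 2) * std_normal_density x - std_normal_density (s + x)"]) auto
    qed
    then show ?thesis by simp
  qed
  have l1: "((\<lambda>r. gauss_cdf (s + r) - gauss_cdf s) \<longlongrightarrow> 1 - gauss_cdf s) at_top"
    by (intro tendsto_intros filterlim_compose[OF std_normal.cdf_lim_at_top_prob]
        filterlim_tendsto_add_at_top[OF tendsto_const] filterlim_ident)
  have l2: "((\<lambda>r. exp (- s\<^sup>2 / 2) * (gauss_cdf r - gauss_cdf 0)) \<longlongrightarrow> exp (- s\<^sup>2 / 2) * (1 - 1 / 2)) at_top"
    unfolding gauss_cdf_0 by (intro tendsto_intros std_normal.cdf_lim_at_top_prob)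
  have "1 - gauss_cdf s \<le> exp (- s\<^sup>2 / 2) * (1 - 1 / 2)"
    by (rule tendsto_le[OF trivial_limit_at_top_linorder l2 l1])
       (rule eventually_at_top_linorderI[of 0], rule fin)
  then show ?thesis by simp
qed

text \<open>The quantile of the volume is at least its initial value plus
  \<open>sqrt (2 * pi) * t\<close>. The initial value is positive since \<open>K\<close> has volume
  above 1/2, which makes the bound strict. A neighbourhood of full measure leaves a null set and
  needs no growth estimate.\<close>

theorem cube_isoperimetry:
  fixes K :: "'a::euclidean_space set"
  assumes K: "closed K" "1 / 2 < measure unif_cube K" and t: "0 \<le> t"
  shows "measure unif_cube {x. t < infdist x K} < exp (- pi * t\<^sup>2) / 2"
proof -
  let ?u = "nbhd_measure K"
  have Kne: "K \<noteq> {}" using K(2) by auto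
  have "infdist x K \<le> 0 \<longleftrightarrow> x \<in> K" for x
    using in_closed_iff_infdist_zero[OF K(1) Kne, of x] infdist_nonneg[of x K]
    by (simp only: order_antisym_conv)
  then have "{x. infdist x K \<le> 0} = K" by (simp only: Collect_mem_eq)
  then have u0: "1 / 2 < ?u 0" using K(2) by (simp add: nbhd_measure_def)
  have compl: "measure unif_cube {x. t < infdist x K} = 1 - ?u t"
  proof -
    have "{x. t < infdist x K} = space unif_cube - {x. infdist x K \<le> t}" by auto
    then show ?thesis
      unfolding nbhd_measure_def using unif_cube.prob_compl[of "{x. infdist x K \<le> t}"] by simp
  qed
  show ?thesis
  proof (cases "?u t < 1")
    case False
    moreover have "0 < exp (- pi * t\<^sup>2) / 2" by simp
    ultimately show ?thesis unfolding compl by linarith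
  next
    case True
    have q0: "0 < gauss_quantile (?u 0)"
    proof -
      have "gauss_cdf 0 < gauss_cdf (gauss_quantile (?u 0))"
        using u0 True nbhd_measure_mono[OF t, of K] by (simp add: gauss_cdf_0)
      then show ?thesis by simp
    qed
    have "gauss_quantile (?u 0) + t / (1 / sqrt (2 * pi)) \<le> gauss_quantile (?u t)"
    proof (rule gauss_quantile_growth)
      show "(s - r) * gauss_profile (?u s) \<le> (1 / sqrt (2 * pi) + (s - r)) * (?u s - ?u r)"
        if "0 \<le> r" "r < s" "s \<le> t" for r s
      proof (rule nbhd_measure_growth[OF that(2)])
        show "1 / 2 < ?u r" using nbhd_measure_mono[OF that(1), of K] u0 by linarith
        show "?u s < 1" using nbhd_measure_mono[OF that(3), of K] True by linarith
      qed
      show "?u r \<le> ?u s" if "r \<le> s" for r s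
        using that by (rule nbhd_measure_mono)
    qed (use t u0 True in simp_all)
    then have "sqrt (2 * pi) * t < gauss_quantile (?u t)"
      using q0 by (simp add: mult.commute)
    then have "gauss_cdf (sqrt (2 * pi) * t) < gauss_cdf (gauss_quantile (?u t))" by simp
    then have "gauss_cdf (sqrt (2 * pi) * t) < ?u t"
      using u0 True nbhd_measure_mono[OF t, of K] by simp
    moreover have "1 - gauss_cdf (sqrt (2 * pi) * t) \<le> exp (- (sqrt (2 * pi) * t)\<^sup>2 / 2) / 2"
      using t by (intro gauss_tail) auto
    moreover have "- (sqrt (2 * pi) * t)\<^sup>2 / 2 = - pi * t\<^sup>2"
      by (simp add: power_mult_distrib)
    ultimately show ?thesis unfolding compl by simp
  qed
qed

section \<open>Concentration for the Hamming distance\<close>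

context real_prob_power
begin

lemma mcdiarmid_tail:
  assumes I: "finite I" "I \<noteq> {}" and s: "s > 0"
    and gm: "g \<in> borel_measurable (PU I)" and gb: "\<And>x. x \<in> space (PU I) \<Longrightarrow> \<bar>g x\<bar> \<le> C"
    and gd: "\<And>x j y. x \<in> space (PU I) \<Longrightarrow> j \<in> I \<Longrightarrow> \<bar>g (x(j := y)) - g x\<bar> \<le> 1"
  shows "measure (PU I) {x \<in> space (PU I). (\<integral>x. g x \<partial>PU I) + s \<le> g x} \<le> exp (- 2 * s\<^sup>2 / real (card I))"
proof -
  interpret P: prob_space "PU I" by (rule prob_space_PU)
  let ?n = "real (card I)" and ?m = "\<integral>x. g x \<partial>PU I"
  let ?A = "{x \<in> space (PU I). ?m + s \<le> g x}"
  \<comment> \<open>The minimiser of the Chernoff exponent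
    \<open>l^2 * ?n / 8 - l * s\<close>.\<close>
  define l where "l = 4 * s / ?n"
  have n: "0 < ?n" using I by (simp add: card_gt_0_iff)
  have l: "0 < l" using s n by (simp add: l_def)
  have A: "?A \<in> sets (PU I)" using gm by measurable
  have "measure (PU I) ?A * exp (l * (?m + s)) = (\<integral>x. indicator ?A x * exp (l * (?m + s)) \<partial>PU I)"
    using A by simp
  also have "\<dots> \<le> (\<integral>x. exp (l * g x) \<partial>PU I)"
  proof (rule integral_mono)
    show "integrable (PU I) (\<lambda>x. indicator ?A x * exp (l * (?m + s)))"
      using A by (intro integrable_mult_left integrable_real_indicator) (auto simp: P.emeasure_eq_measure)
    show "integrable (PU I) (\<lambda>x. exp (l * g x))"
    proof (rule P.integrable_const_bound[of _ "exp (l * C)"])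
      show "AE x in PU I. norm (exp (l * g x)) \<le> exp (l * C)"
        using abs_le_D1[OF gb] l by (intro AE_I2) simp
    qed (use gm in measurable)
    show "indicator ?A x * exp (l * (?m + s)) \<le> exp (l * g x)" for x
      using l by (auto simp: indicator_def)
  qed
  also have "\<dots> \<le> exp (l * ?m + l\<^sup>2 * ?n / 8)"
    by (rule mcdiarmid_mgf[OF I(1) l gm gb gd])
  finally have "measure (PU I) ?A \<le> exp (l * ?m + l\<^sup>2 * ?n / 8) / exp (l * (?m + s))"
    by (simp only: pos_le_divide_eq exp_gt_zero)
  also have "\<dots> = exp ((l * ?m + l\<^sup>2 * ?n / 8) - l * (?m + s))"
    by (simp only: exp_diff)
  also have "(l * ?m + l\<^sup>2 * ?n / 8) - l * (?m + s) = - 2 * s\<^sup>2 / ?n"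
  proof -
    have "l\<^sup>2 * ?n = l * (4 * s)" using n by (simp add: l_def power2_eq_square)
    moreover have "- 2 * s\<^sup>2 / ?n = - (l * s) / 2" by (simp add: l_def power2_eq_square)
    ultimately show ?thesis by (simp add: distrib_left)
  qed
  finally show ?thesis .
qed

end

text \<open>With natural number values the infimum over a nonempty set is attained.\<close>

definition hamming_infdist :: "'a::euclidean_space \<Rightarrow> 'a set \<Rightarrow> nat" where
  "hamming_infdist x K = (INF y\<in>K. card {b \<in> Basis. x \<bullet> b \<noteq> y \<bullet> b})"

lemma hamming_infdist_le: "y \<in> K \<Longrightarrow> hamming_infdist x K \<le> card {b \<in> Basis. x \<bullet> b \<noteq> y \<bullet> b}"
  unfolding hamming_infdist_def by (rule cINF_lower) auto

lemma hamming_infdist_attained: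
  assumes "K \<noteq> {}"
  obtains y where "y \<in> K" "hamming_infdist x K = card {b \<in> Basis. x \<bullet> b \<noteq> y \<bullet> b}"
proof -
  have "hamming_infdist x K \<in> (\<lambda>y. card {b \<in> Basis. x \<bullet> b \<noteq> y \<bullet> b}) ` K"
    unfolding hamming_infdist_def using assms by (intro Inf_nat_def1) auto
  then show ?thesis using that by auto
qed

lemma hamming_infdist_le_DIM:
  assumes "K \<noteq> {}"
  shows "hamming_infdist (x :: 'a::euclidean_space) K \<le> DIM('a)"
proof -
  obtain y where "y \<in> K" using assms by auto
  from hamming_infdist_le[OF this, of x] show ?thesis
    by (rule order_trans) (auto intro: card_mono)
qed

text \<open>The bounded difference property: a nearest point for \<open>x\<close> also serves for
  \<open>x'\<close>, at the cost of the coordinate \<open>j\<close>. Exchanging the two points gives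
  the other direction.\<close>

lemma hamming_infdist_update:
  assumes K: "K \<noteq> {}" and eq: "\<And>b. b \<in> Basis \<Longrightarrow> b \<noteq> j \<Longrightarrow> x' \<bullet> b = x \<bullet> b"
  shows "hamming_infdist x' K \<le> hamming_infdist x K + 1"
proof -
  obtain y where y: "y \<in> K" "hamming_infdist x K = card {b \<in> Basis. x \<bullet> b \<noteq> y \<bullet> b}"
    using hamming_infdist_attained[OF K] .
  have "hamming_infdist x' K \<le> card {b \<in> Basis. x' \<bullet> b \<noteq> y \<bullet> b}"
    by (rule hamming_infdist_le[OF y(1)])
  also have "\<dots> \<le> card (insert j {b \<in> Basis. x \<bullet> b \<noteq> y \<bullet> b})"
    using eq by (intro card_mono) auto
  also have "\<dots> \<le> card {b \<in> Basis. x \<bullet> b \<noteq> y \<bullet> b} + 1"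
    by (simp add: card_insert_if)
  finally show ?thesis using y(2) by simp
qed

text \<open>For compact \<open>K\<close> the Hamming neighbourhoods are finite unions of the closed sets
  obtained by adding coordinate subspaces to \<open>K\<close>.\<close>

lemma closed_hamming_nbhd:
  fixes K :: "'a::euclidean_space set"
  assumes K: "compact K" "K \<noteq> {}"
  shows "closed {x. hamming_infdist x K \<le> k}"
proof -
  let ?V = "\<lambda>S. {v :: 'a. \<forall>b\<in>Basis - S. v \<bullet> b = 0}"
  have eq: "{x. hamming_infdist x K \<le> k} = (\<Union>S\<in>{S. S \<subseteq> Basis \<and> card S \<le> k}. (\<Union>y\<in>K. \<Union>v\<in>?V S. {y + v}))"
  proof (intro equalityI subsetI)
    fix x assume "x \<in> {x. hamming_infdist x K \<le> k}"
    moreover obtain y where y: "y \<in> K" "hamming_infdist x K = card {b \<in> Basis. x \<bullet> b \<noteq> y \<bullet> b}"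
      using hamming_infdist_attained[OF K(2)] .
    ultimately have "card {b \<in> Basis. x \<bullet> b \<noteq> y \<bullet> b} \<le> k" by simp
    then have S: "{b \<in> Basis. x \<bullet> b \<noteq> y \<bullet> b} \<in> {S. S \<subseteq> Basis \<and> card S \<le> k}" by simp
    have v: "x - y \<in> ?V {b \<in> Basis. x \<bullet> b \<noteq> y \<bullet> b}" by (simp add: inner_diff_left)
    show "x \<in> (\<Union>S\<in>{S. S \<subseteq> Basis \<and> card S \<le> k}. (\<Union>y\<in>K. \<Union>v\<in>?V S. {y + v}))"
      by (rule UN_I[OF S], rule UN_I[OF y(1)], rule UN_I[OF v]) simp
  next
    fix x assume "x \<in> (\<Union>S\<in>{S. S \<subseteq> Basis \<and> card S \<le> k}. (\<Union>y\<in>K. \<Union>v\<in>?V S. {y + v}))"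
    then obtain S y v where S: "S \<subseteq> Basis" "card S \<le> k" "y \<in> K" "v \<in> ?V S" "x = y + v" by auto
    have "hamming_infdist x K \<le> card {b \<in> Basis. x \<bullet> b \<noteq> y \<bullet> b}"
      by (rule hamming_infdist_le[OF S(3)])
    also have "\<dots> \<le> card S"
      using S by (intro card_mono finite_subset[OF S(1) finite_Basis]) (auto simp: inner_add_left)
    finally show "x \<in> {x. hamming_infdist x K \<le> k}" using S(2) by simp
  qed
  have "closed (?V S)" for S
  proof -
    have "?V S = (\<Inter>b\<in>Basis - S. {v. b \<bullet> v = 0})" by (auto simp: inner_commute)
    then show ?thesis by (simp only:) (intro closed_INT ballI closed_hyperplane)
  qed
  then have cl: "closed (\<Union>y\<in>K. \<Union>v\<in>?V S. {y + v})" for S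
    by (intro compact_closed_sums K(1))
  have fin: "finite {S :: 'a set. S \<subseteq> Basis \<and> card S \<le> k}"
    by (rule finite_subset[of _ "Pow Basis"]) auto
  show ?thesis
    unfolding eq by (rule closed_UN[OF fin]) (rule ballI, rule cl)
qed

theorem hamming_concentration:
  fixes K :: "'a::euclidean_space set"
  assumes K: "compact K" "1 / 2 < measure unif_cube K"
    and \<epsilon>: "sqrt (real DIM('a) * ln 2 / 2) \<le> \<epsilon>"
  shows "measure unif_cube {x. \<epsilon> < real (hamming_infdist x K)}
    < exp (- (2 / real DIM('a)) * (\<epsilon> - sqrt (real DIM('a) * ln 2 / 2))\<^sup>2)"
proof -
  let ?n = "real DIM('a)" and ?r = "sqrt (real DIM('a) * ln 2 / 2)"
  let ?P = "unif01.PU (Basis :: 'a set)"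
  interpret P: prob_space ?P by (rule unif01.prob_space_PU)
  have Kne: "K \<noteq> {}" using K(2) by auto
  have n: "0 < ?n" by simp
  have r: "0 < ?r" using n by simp
  define h where "h = (\<lambda>x. real (hamming_infdist x K))"
  define g where "g = (\<lambda>x. h (of_coords x))"
  have hm: "h \<in> borel_measurable borel"
  proof (rule borel_measurableI_le)
    fix y
    show "{x \<in> space borel. h x \<le> y} \<in> sets borel"
    proof (cases "0 \<le> y")
      case True
      have "{x \<in> space borel. h x \<le> y} = {x. hamming_infdist x K \<le> nat \<lfloor>y\<rfloor>}"
        using True by (auto simp: h_def le_nat_iff le_floor_iff)
      then show ?thesis using closed_hamming_nbhd[OF K(1) Kne] by (simp add: borel_closed)
    next
      case False
      then have "{x \<in> space borel. h x \<le> y} = {}" by (auto simp: h_def)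
      then show ?thesis by simp
    qed
  qed
  have gm: "g \<in> borel_measurable ?P"
    unfolding g_def by (rule measurable_compose[OF measurable_of_coords hm])
  have gb: "\<bar>g x\<bar> \<le> ?n" for x
    using hamming_infdist_le_DIM[OF Kne, of "of_coords x"] by (simp add: g_def h_def)
  have gd: "\<bar>g (x(j := y)) - g x\<bar> \<le> 1" if "j \<in> Basis" for x j y
  proof -
    have "hamming_infdist (of_coords (x(j := y)) :: 'a) K \<le> hamming_infdist (of_coords x) K + 1"
      "hamming_infdist (of_coords x :: 'a) K \<le> hamming_infdist (of_coords (x(j := y))) K + 1"
      by (rule hamming_infdist_update[OF Kne, of j], simp add: of_coords_inner)+
    then show ?thesis unfolding g_def h_def by linarith
  qed
  define m where "m = (\<integral>x. g x \<partial>?P)"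
  have transfer: "measure unif_cube {x. Q (h x)} = measure ?P {x \<in> space ?P. Q (g x)}"
    if "{x. Q (h x)} \<in> sets borel" for Q
  proof -
    have "measure unif_cube {x. Q (h x)} = measure (distr ?P borel of_coords) {x. Q (h x)}"
      by (simp only: distr_of_coords)
    also have "\<dots> = measure ?P (of_coords -` {x. Q (h x)} \<inter> space ?P)"
      using that by (intro measure_distr) auto
    also have "of_coords -` {x. Q (h x)} \<inter> space ?P = {x \<in> space ?P. Q (g x)}"
      by (auto simp: g_def)
    finally show ?thesis .
  qed
  \<comment> \<open>For positive \<open>m\<close>, the event \<open>g = 0\<close> is a deviation of
    \<open>- g\<close> above its mean \<open>- m\<close> by \<open>m\<close>. It contains the points
    of \<open>K\<close>, so \<open>1 / 2 < exp (- 2 * m^2 / ?n)\<close>; solving for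
    \<open>m\<close> gives the threshold \<open>?r\<close>, strictly.\<close>
  have "m < ?r"
  proof (cases "0 < m")
    case True
    have "h x = 0" if "x \<in> K" for x
      using hamming_infdist_le[OF that, of x] by (simp add: h_def)
    then have "measure unif_cube K \<le> measure unif_cube {x. h x \<le> 0}"
    proof (intro finite_measure.finite_measure_mono)
      show "finite_measure (unif_cube :: 'a measure)"
        using prob_space_unif_cube by (rule prob_space.finite_measure)
    qed (use hm in auto)
    also have "\<dots> = measure ?P {x \<in> space ?P. g x \<le> 0}"
      using hm by (intro transfer) measurable
    also have "\<dots> = measure ?P {x \<in> space ?P. (\<integral>x. - g x \<partial>?P) + m \<le> - g x}"
      by (simp add: m_def)
    also have "\<dots> \<le> exp (- 2 * m\<^sup>2 / real (card (Basis :: 'a set)))"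
    proof (rule unif01.mcdiarmid_tail[OF finite_Basis _ True])
      show "\<bar>- g (x(j := y)) - - g x\<bar> \<le> 1" if "j \<in> Basis" for x j y
        using gd[OF that, of x y] by linarith
    qed (use gm gb in auto)
    finally have "1 / 2 < exp (- 2 * m\<^sup>2 / ?n)" using K(2) by simp
    then have "ln (1 / 2) < ln (exp (- 2 * m\<^sup>2 / ?n))" by (subst ln_less_cancel_iff) auto
    then have "m\<^sup>2 < ?n * ln 2 / 2" using n by (simp add: ln_div field_simps)
    then show ?thesis by (rule real_less_rsqrt)
  next
    case False
    then show ?thesis using r by linarith
  qed
  then have s: "0 \<le> \<epsilon> - ?r" "\<epsilon> - ?r < \<epsilon> - m" using \<epsilon> by auto
  have "measure unif_cube {x. \<epsilon> < h x} = measure ?P {x \<in> space ?P. \<epsilon> < g x}"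
    using hm by (intro transfer) measurable
  also have "\<dots> \<le> measure ?P {x \<in> space ?P. m + (\<epsilon> - m) \<le> g x}"
    using gm by (intro P.finite_measure_mono) auto
  also have "\<dots> \<le> exp (- 2 * (\<epsilon> - m)\<^sup>2 / real (card (Basis :: 'a set)))"
    unfolding m_def using s gm gb gd by (intro unif01.mcdiarmid_tail) (auto simp: m_def)
  also have "\<dots> < exp (- (2 / ?n) * (\<epsilon> - ?r)\<^sup>2)"
  proof -
    have "(\<epsilon> - ?r)\<^sup>2 < (\<epsilon> - m)\<^sup>2" using s by (intro power_strict_mono) auto
    then have "2 / ?n * (\<epsilon> - ?r)\<^sup>2 < 2 / ?n * (\<epsilon> - m)\<^sup>2" using n by (intro mult_strict_left_mono) auto
    then show ?thesis by simp
  qed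
  finally show ?thesis by (simp add: h_def)
qed

section \<open>Adversarial examples\<close>

text \<open>A concave power lies below its tangent at 1; this is convexity of the exponential
  between 0 and \<open>ln x\<close>.\<close>

lemma powr_le_tangent:
  fixes x :: real
  assumes "0 \<le> x" "0 < a" "a \<le> 1"
  shows "x powr a \<le> 1 + a * (x - 1)"
proof (cases "x = 0")
  case False
  then have x: "0 < x" using assms by simp
  have "convex_on UNIV (exp :: real \<Rightarrow> real)" by (rule convex_on_exp[of 1, simplified])
  from convex_onD[OF this, of a 0 "ln x"] assms
  have "exp (a * ln x) \<le> (1 - a) * exp 0 + a * exp (ln x)" by simp
  then show ?thesis using x by (simp add: powr_def algebra_simps)
qed (use assms in simp)

text \<open>For \<open>p < 2\<close> this is the power mean inequality, valid also below 1 where the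
  triangle inequality fails. For \<open>p \<ge> 2\<close> the exponent of the dimension is 0: after
  division by the Euclidean norm all coordinates are at most 1, so a higher power only decreases
  them.\<close>

lemma lp_norm_le_norm:
  fixes z :: "real ^ 'n"
  assumes "0 < p"
  shows "lp_norm p z \<le> real CARD('n) powr (1 / min p 2 - 1 / 2) * norm z"
proof (cases "z = 0")
  case True
  then show ?thesis using assms by (simp add: lp_norm_def)
next
  case False
  let ?n = "real CARD('n)"
  have n: "0 < ?n" by simp
  have N: "0 < norm z" using False by simp
  have norm2: "(\<Sum>i\<in>UNIV. \<bar>z $ i\<bar>\<^sup>2) = (norm z)\<^sup>2"
    by (simp add: norm_vec_def L2_set_def sum_nonneg)
  have sum_nn: "0 \<le> (\<Sum>i\<in>UNIV. \<bar>z $ i\<bar> powr p)" by (intro sum_nonneg) auto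
  show ?thesis
  proof (cases "p < 2")
    case True
    \<comment> \<open>The mean square of the coordinates. In units of \<open>M\<close> the squares
      average to 1, so the linear terms of the tangent bounds cancel in the sum.\<close>
    define M where "M = (norm z)\<^sup>2 / ?n"
    have M: "0 < M" using N by (simp add: M_def)
    have "(\<Sum>i\<in>UNIV. \<bar>z $ i\<bar> powr p) = (\<Sum>i\<in>UNIV. M powr (p / 2) * ((\<bar>z $ i\<bar>\<^sup>2 / M) powr (p / 2)))"
    proof (intro sum.cong refl)
      fix i
      have "\<bar>z $ i\<bar> powr p = (\<bar>z $ i\<bar>\<^sup>2) powr (p / 2)"
      proof (cases "z $ i = 0")
        case False
        then have "\<bar>z $ i\<bar>\<^sup>2 = \<bar>z $ i\<bar> powr 2" by simp
        then show ?thesis by (simp only: powr_powr) simp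
      qed (use assms in simp)
      then show "\<bar>z $ i\<bar> powr p = M powr (p / 2) * ((\<bar>z $ i\<bar>\<^sup>2 / M) powr (p / 2))"
        using M by (simp add: powr_divide)
    qed
    also have "\<dots> \<le> (\<Sum>i\<in>UNIV. M powr (p / 2) * (1 + p / 2 * (\<bar>z $ i\<bar>\<^sup>2 / M - 1)))"
      using assms True M by (intro sum_mono mult_left_mono powr_le_tangent) auto
    also have "\<dots> = M powr (p / 2) * (?n + p / 2 * ((\<Sum>i\<in>UNIV. \<bar>z $ i\<bar>\<^sup>2) / M - ?n))"
      by (simp only: sum_distrib_left[symmetric] sum.distrib sum_subtractf sum_divide_distrib) simp
    also have "(\<Sum>i\<in>UNIV. \<bar>z $ i\<bar>\<^sup>2) / M - ?n = 0"
      unfolding norm2 using N by (simp add: M_def)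
    finally have "(\<Sum>i\<in>UNIV. \<bar>z $ i\<bar> powr p) \<le> M powr (p / 2) * ?n" by simp
    then have "lp_norm p z \<le> (M powr (p / 2) * ?n) powr (1 / p)"
      using assms sum_nn by (simp add: lp_norm_def powr_mono2)
    also have "\<dots> = M powr (1 / 2) * ?n powr (1 / p)"
      using assms M by (simp add: powr_mult powr_powr)
    also have "M powr (1 / 2) = norm z * ?n powr (- 1 / 2)"
    proof -
      have "((norm z)\<^sup>2) powr (1 / 2) = norm z"
        by (simp add: powr_half_sqrt)
      then show ?thesis
        by (simp add: M_def powr_divide powr_minus_divide)
    qed
    also have "norm z * ?n powr (- 1 / 2) * ?n powr (1 / p) = ?n powr (1 / p - 1 / 2) * norm z"
      by (simp add: powr_add[symmetric] mult.assoc)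
    finally show ?thesis using True by simp
  next
    case False
    have "(\<Sum>i\<in>UNIV. (\<bar>z $ i\<bar> / norm z) powr p) \<le> (\<Sum>i\<in>UNIV. (\<bar>z $ i\<bar> / norm z)\<^sup>2)"
    proof (rule sum_mono)
      fix i
      have le1: "\<bar>z $ i\<bar> / norm z \<le> 1"
        using component_le_norm_cart[of z i] N by simp
      show "(\<bar>z $ i\<bar> / norm z) powr p \<le> (\<bar>z $ i\<bar> / norm z)\<^sup>2"
      proof (cases "z $ i = 0")
        case nz: False
        have "(\<bar>z $ i\<bar> / norm z) powr p \<le> (\<bar>z $ i\<bar> / norm z) powr 2"
          using False le1 nz N by (intro powr_mono') auto
        then show ?thesis using nz N by simp
      qed simp
    qed
    also have "\<dots> = 1"
      using norm2 N by (simp add: power_divide sum_divide_distrib[symmetric])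
    finally have "(\<Sum>i\<in>UNIV. \<bar>z $ i\<bar> powr p) / norm z powr p \<le> 1"
      using N by (simp add: powr_divide sum_divide_distrib)
    then have "(\<Sum>i\<in>UNIV. \<bar>z $ i\<bar> powr p) \<le> norm z powr p"
      using N by (simp add: pos_divide_le_eq)
    then have "lp_norm p z \<le> (norm z powr p) powr (1 / p)"
      using assms sum_nn by (simp add: lp_norm_def powr_mono2)
    also have "\<dots> = norm z" using assms N by (simp add: powr_powr)
    finally show ?thesis using False by simp
  qed
qed

section \<open>From the classifier to compact and Borel sets\<close>

lemma unit_cube_eq_cbox: "(unit_cube :: (real ^ 'n) set) = cbox 0 One"
proof -
  have "x \<in> cbox 0 One \<longleftrightarrow> (\<forall>i. 0 \<le> x $ i \<and> x $ i \<le> 1)" for x :: "real ^ 'n"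
  proof -
    have "x \<in> cbox 0 One \<longleftrightarrow> (\<forall>b\<in>Basis. 0 \<le> x \<bullet> b \<and> x \<bullet> b \<le> 1)"
      by (simp add: mem_box)
    also have "\<dots> \<longleftrightarrow> (\<forall>i. 0 \<le> x $ i \<and> x $ i \<le> 1)"
      by (auto simp: Basis_vec_def inner_axis)
    finally show ?thesis .
  qed
  then show ?thesis by (auto simp: unit_cube_def)
qed

lemma lp_norm_0_eq: "lp_norm 0 (x - y) = real (card {b \<in> Basis. x \<bullet> b \<noteq> y \<bullet> b})"
  for x y :: "real ^ 'n"
proof -
  have "{b \<in> Basis. x \<bullet> b \<noteq> y \<bullet> b} = (\<lambda>i. axis i 1) ` {i. (x - y) $ i \<noteq> 0}"
    by (auto simp: Basis_vec_def inner_axis)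
  moreover have "inj_on (\<lambda>i. axis i 1 :: real ^ 'n) {i. (x - y) $ i \<noteq> 0}"
    by (auto simp: inj_on_def axis_eq_axis)
  ultimately show ?thesis by (simp add: lp_norm_def card_image)
qed

lemma measure_unif_cube: "A \<in> sets borel \<Longrightarrow> measure unif_cube A = measure lborel (cbox 0 One \<inter> A)"
  for A :: "'a::euclidean_space set"
  by (subst measure_uniform_measure) (auto simp: emeasure_lborel_cbox measure_lborel_cbox)

text \<open>The region outside the class is only Lebesgue measurable. Inner regularity supplies a
  compact part, for which nearest points exist and neighbourhoods are Borel, while the strict volume
  bound survives.\<close>

lemma inner_compact_cube:
  fixes A :: "(real ^ 'n) set"
  assumes A: "A \<in> sets lebesgue" "A \<subseteq> unit_cube" and r: "r < measure lebesgue A"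
  obtains K where "compact K" "K \<subseteq> A" "r < measure unif_cube K"
proof -
  have cube: "(unit_cube :: (real ^ 'n) set) \<in> lmeasurable"
    unfolding unit_cube_eq_cbox by simp
  have Al: "A \<in> lmeasurable" using fmeasurableI2[OF cube A(2) A(1)] .
  obtain K where K: "closed K" "K \<subseteq> A" "A - K \<in> lmeasurable"
    "emeasure lebesgue (A - K) < ennreal (measure lebesgue A - r)"
    using sets_lebesgue_inner_closed[OF A(1), of "measure lebesgue A - r"] r by auto
  have comp: "compact K"
    using K(1,2) A(2) bounded_subset[OF bounded_cbox] unfolding unit_cube_eq_cbox
    by (metis compact_eq_bounded_closed order_trans)
  have Kl: "K \<in> lmeasurable" by (rule lmeasurable_compact[OF comp])
  have "measure lebesgue (A - K) < measure lebesgue A - r"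
    using K(3,4) r by (simp add: emeasure_eq_measure2 ennreal_less_iff)
  moreover have "measure lebesgue (A - K) = measure lebesgue A - measure lebesgue K"
    using Al Kl K(2) by (intro measurable_measure_Diff) auto
  moreover have "measure unif_cube K = measure lebesgue K"
  proof -
    have "measure unif_cube K = measure lborel (cbox 0 One \<inter> K)"
      using K(1) by (intro measure_unif_cube) (simp add: borel_closed)
    also have "cbox 0 One \<inter> K = K" using K(2) A(2) unfolding unit_cube_eq_cbox by auto
    finally show ?thesis using K(1) by (simp add: borel_closed)
  qed
  ultimately show ?thesis using that comp K(2) by simp
qed

text \<open>Connects the support, a Lebesgue measurable set, with the concentration bounds, which
  concern Borel sets under the uniform measure.\<close>

lemma measure_lebesgue_le_unif_cube:
  fixes S :: "(real ^ 'n) set"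
  assumes "S \<in> sets lebesgue" "S \<subseteq> unit_cube" "S \<subseteq> B" "B \<in> sets borel"
  shows "measure lebesgue S \<le> measure unif_cube B"
proof -
  have "measure lebesgue S \<le> measure lebesgue (cbox 0 One \<inter> B)"
  proof (rule measure_mono_fmeasurable)
    show "S \<subseteq> cbox 0 One \<inter> B" using assms(2,3) unfolding unit_cube_eq_cbox by auto
    show "cbox 0 One \<inter> B \<in> lmeasurable"
      using assms(4) by (intro fmeasurable_Int_fmeasurable) auto
  qed (rule assms(1))
  also have "\<dots> = measure unif_cube B"
    using assms(4) by (simp add: measure_unif_cube)
  finally show ?thesis .
qed

theorem theorem4:
  fixes m :: nat and \<rho> :: "nat \<Rightarrow> real ^ 'n \<Rightarrow> real"
    and C :: "real ^ 'n \<Rightarrow> nat" and c :: nat and p \<epsilon> :: real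
  assumes dens: "\<And>k. k \<in> {1..m} \<Longrightarrow> bounded_prob_density_cube (\<rho> k)"
    and range: "\<And>x. x \<in> unit_cube \<Longrightarrow> C x \<in> {1..m}"
    and meas: "\<And>k. {x \<in> unit_cube. C x = k} \<in> sets lebesgue"
    and c: "c \<in> {1..m}"
    and fc: "measure lebesgue {x \<in> unit_cube. C x = c} < 1 / 2"
    and p: "p \<ge> 0"
    and eps: "\<epsilon> > 0"
    and vol: "(p > 0 \<and>
               measure lebesgue {x \<in> unit_cube. \<rho> c x > 0}
                 \<ge> 1 / 2 * exp (- pi * \<epsilon>\<^sup>2 * real CARD('n) powr (1 - 2 / min p 2)))
            \<or> (p = 0 \<and> \<epsilon> \<ge> sqrt (real CARD('n) * ln 2 / 2) \<and>
               measure lebesgue {x \<in> unit_cube. \<rho> c x > 0}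
                 \<ge> exp (- (2 / real CARD('n)) * (\<epsilon> - sqrt (real CARD('n) * ln 2 / 2))\<^sup>2))"
  shows "\<exists>x xh. x \<in> unit_cube \<and> \<rho> c x > 0 \<and> xh \<in> unit_cube \<and> C xh \<noteq> c
               \<and> lp_norm p (x - xh) \<le> \<epsilon>"
proof (rule ccontr)
  assume contra: "\<not> ?thesis"
  let ?n = "real CARD('n)"
  let ?S = "{x \<in> unit_cube. \<rho> c x > 0}" and ?A = "{x \<in> unit_cube. C x \<noteq> c}"
  have n: "0 < ?n" by simp
  have cube: "(unit_cube :: (real ^ 'n) set) \<in> lmeasurable" "measure lebesgue (unit_cube :: (real ^ 'n) set) = 1"
    unfolding unit_cube_eq_cbox by (simp_all add: measure_lborel_cbox)
  have A_eq: "?A = unit_cube - {x \<in> unit_cube. C x = c}" by auto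
  have A: "?A \<in> sets lebesgue"
    unfolding A_eq using cube(1) meas[of c] by auto
  have "measure lebesgue ?A = 1 - measure lebesgue {x \<in> unit_cube. C x = c}"
    unfolding A_eq using cube meas[of c]
    by (subst measurable_measure_Diff) auto
  then have "1 / 2 < measure lebesgue ?A" using fc by simp
  then obtain K where K: "compact K" "K \<subseteq> ?A" "1 / 2 < measure unif_cube K"
    using inner_compact_cube[OF A] by blast
  have Kne: "K \<noteq> {}" using K(3) by auto
  have far: "\<epsilon> < lp_norm p (x - y)" if "x \<in> ?S" "y \<in> K" for x y
    using contra that K(2) by force
  \<comment> \<open>Measurability of the support is extracted from integrability of the density, cut
    off by the indicator since nothing is known about it outside the cube.\<close>
  have S: "?S \<in> sets lebesgue"
  proof -
    have "set_integrable lebesgue unit_cube (\<rho> c)"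
      using dens[OF c] by (simp add: bounded_prob_density_cube_def)
    then have "(\<lambda>x. indicator unit_cube x *\<^sub>R \<rho> c x) \<in> borel_measurable lebesgue"
      by (auto simp: set_integrable_def)
    then have "{x \<in> space lebesgue. 0 < indicator unit_cube x *\<^sub>R \<rho> c x} \<in> sets lebesgue"
      by measurable
    also have "{x \<in> space lebesgue. 0 < indicator unit_cube x *\<^sub>R \<rho> c x} = ?S"
      by (auto simp: indicator_def)
    finally show ?thesis .
  qed
  from vol show False
  proof (elim disjE conjE)
    assume p0: "0 < p"
      and v: "1 / 2 * exp (- pi * \<epsilon>\<^sup>2 * ?n powr (1 - 2 / min p 2)) \<le> measure lebesgue ?S"
    define q where "q = min p 2"
    \<comment> \<open>The Euclidean radius matched to \<epsilon> by the norm comparison: a point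
      further than \<epsilon> in the p-norm is further than \<open>\<epsilon>'\<close> in the
      Euclidean norm. Its square carries the power of the dimension in the hypothesis.\<close>
    define \<epsilon>' where "\<epsilon>' = \<epsilon> * ?n powr (1 / 2 - 1 / q)"
    have \<epsilon>': "0 < \<epsilon>'" using eps n by (simp add: \<epsilon>'_def)
    have "\<epsilon>'\<^sup>2 = \<epsilon>\<^sup>2 * ?n powr (1 - 2 / q)"
      using n by (simp add: \<epsilon>'_def power_mult_distrib powr_power right_diff_distrib)
    moreover have "?S \<subseteq> {x. \<epsilon>' < infdist x K}"
    proof
      fix x assume x: "x \<in> ?S"
      obtain y where y: "y \<in> K" "infdist x K = dist x y"
        using infdist_attains_inf[OF compact_imp_closed[OF K(1)] Kne] by blast
      have "\<epsilon> < ?n powr (1 / q - 1 / 2) * norm (x - y)"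
        using far[OF x y(1)] lp_norm_le_norm[OF p0, of "x - y"] unfolding q_def by linarith
      then have "\<epsilon>' < (?n powr (1 / q - 1 / 2) * norm (x - y)) * ?n powr (1 / 2 - 1 / q)"
        unfolding \<epsilon>'_def using n by (intro mult_strict_right_mono) auto
      also have "\<dots> = norm (x - y) * ?n powr ((1 / q - 1 / 2) + (1 / 2 - 1 / q))"
        by (simp only: powr_add mult_ac)
      also have "\<dots> = norm (x - y)" using n by simp
      finally show "x \<in> {x. \<epsilon>' < infdist x K}" using y(2) by (simp add: dist_norm)
    qed
    then have "measure lebesgue ?S \<le> measure unif_cube {x. \<epsilon>' < infdist x K}"
    proof (intro measure_lebesgue_le_unif_cube[OF S])
      have "{x. \<epsilon>' < infdist x K} = - {x. infdist x K \<le> \<epsilon>'}" by auto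
      then show "{x. \<epsilon>' < infdist x K} \<in> sets borel" using nbhd_sets[of K \<epsilon>'] by (simp add: Compl_in_sets_lebesgue borel_comp)
    qed auto
    moreover have "measure unif_cube {x. \<epsilon>' < infdist x K} < exp (- pi * \<epsilon>'\<^sup>2) / 2"
      using K \<epsilon>' by (intro cube_isoperimetry compact_imp_closed) auto
    ultimately show False using v by (simp add: q_def mult.assoc)
  next
    assume p0: "p = 0" and e: "sqrt (?n * ln 2 / 2) \<le> \<epsilon>"
      and v: "exp (- (2 / ?n) * (\<epsilon> - sqrt (?n * ln 2 / 2))\<^sup>2) \<le> measure lebesgue ?S"
    have "?S \<subseteq> {x. \<epsilon> < real (hamming_infdist x K)}"
    proof
      fix x assume x: "x \<in> ?S"
      obtain y where y: "y \<in> K" "hamming_infdist x K = card {b \<in> Basis. x \<bullet> b \<noteq> y \<bullet> b}"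
        using hamming_infdist_attained[OF Kne] .
      show "x \<in> {x. \<epsilon> < real (hamming_infdist x K)}"
        using far[OF x y(1)] y(2) unfolding p0 lp_norm_0_eq by simp
    qed
    then have "measure lebesgue ?S \<le> measure unif_cube {x. \<epsilon> < real (hamming_infdist x K)}"
    proof (intro measure_lebesgue_le_unif_cube[OF S])
      \<comment> \<open>Integer distances exceed \<epsilon> exactly when they exceed its floor, so
        the set is the complement of a closed Hamming neighbourhood.\<close>
      have "{x. \<epsilon> < real (hamming_infdist x K)} = - {x. hamming_infdist x K \<le> nat \<lfloor>\<epsilon>\<rfloor>}"
        using eps by (auto simp: le_nat_iff le_floor_iff not_le[symmetric])
      then show "{x. \<epsilon> < real (hamming_infdist x K)} \<in> sets borel"
        using closed_hamming_nbhd[OF K(1) Kne] by (simp add: borel_comp borel_closed)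
    qed auto
    moreover have "measure unif_cube {x. \<epsilon> < real (hamming_infdist x K)}
      < exp (- (2 / ?n) * (\<epsilon> - sqrt (?n * ln 2 / 2))\<^sup>2)"
      using hamming_concentration[OF K(1,3), of \<epsilon>] e by simp
    ultimately show False using v by linarith
  qed
qed

end
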